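(* Let $2\leq m\leq n$ be integers and let $\psi$ be an approximating function. Put $\Psi(r):=\psi(r)/r$. Let $f$ and $g$ be dimension functions with $g(r)=r^{-(n-m+1)(m-1)}f(r)$. Assume that $r^{-(m-1)(n+1)}f(r)$ is monotonic and that $r^{-(m-1)n}f(r)$ is increasing. Then $\mathcal{H}^{f}(W_0(m,n;\psi))=0$ if \[ \sum_{r=1}^\infty f(\Psi(r))\,\Psi(r)^{-(m-1)n}\,r^{m-1}<\infty. \] If \[ \sum_{r=1}^\infty f(\Psi(r))\,\Psi(r)^{-(m-1)n}\,r^{m-1}=\infty, \] then \[ \mathcal{H}^{f}(W_0(m,n;\psi))= \begin{cases} \infty & \text{if } r^{-(m-1)(n+1)}f(r)\to\infty \text{ as } r\to0,\\ \mathcal{H}^f(\Gamma) & \text{if } r^{-(m-1)(n+1)}f(r)\to C \text{ as } r\to0, \end{cases} \] where $C>0$ is some fixed (finite) constant.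
   Context: An approximating function is a decreasing function $\psi:\mathbb{R}^+\to\mathbb{R}^+$ with $\psi(r)\to 0$ as $r\to\infty$. $\mathbb{I}^{mn}:=[-\tfrac12,\tfrac12]^{mn}$, and its points are regarded as $m\times n$ matrices $X$. For a vector, $|\cdot|$ denotes the supremum norm; for $\mathbf{q}\in\mathbb{Z}^m$ (a row vector), $\mathbf{q}X\in\mathbb{R}^n$ is the vector-matrix product. Define \[ W_0(m,n;\psi):=\{X\in\mathbb{I}^{mn}: |\mathbf{q}X|<\psi(|\mathbf{q}|)\text{ for infinitely many }\mathbf{q}\in\mathbb{Z}^m\setminus\{\mathbf{0}\}\}. \] $\Gamma$ denotes the set of $X\in\mathbb{I}^{mn}$ of rank at most $m-1$; it has dimension $(m-1)(n+1)$ and, for $m\le n$, contains $W_0(m,n;\psi)$. A dimension function is an increasing continuous function $f:\mathbb{R}^+\to\mathbb{R}^+$ with $f(r)\to0$ as $r\to0$. The Hausdorff $f$-measure of $X\subset\mathbb{R}^k$ is $\mathcal{H}^f(X)=\lim_{\rho\to0}\mathcal{H}^f_\rho(X)$, where $\mathcal{H}^f_\rho(X)=\inf\sum_i f(\mathrm{diam}(B_i))$, the infimum being over all countable covers $\{B_i\}$ of $X$ by Euclidean balls of diameter at most $\rho$. *)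

theory Defs
  imports "HOL-Analysis.Analysis"
begin

definition approximating_function :: "(real \<Rightarrow> real) \<Rightarrow> bool" where
  "approximating_function \<psi> \<longleftrightarrow>
     (\<forall>r>0. \<psi> r > 0) \<and> antimono_on {0<..} \<psi> \<and> (\<psi> \<longlongrightarrow> 0) at_top"

definition dimension_function :: "(real \<Rightarrow> real) \<Rightarrow> bool" where
  "dimension_function f \<longleftrightarrow>
     (\<forall>r>0. f r > 0) \<and> mono_on {0<..} f \<and> continuous_on {0<..} f \<and> (f \<longlongrightarrow> 0) (at_right 0)"

text \<open>Both finite and infinite countable covers are allowed, via the index set \<open>I\<close>. The balls are
  nondegenerate, so only values of \<open>f\<close> at positive arguments matter; the empty family covers
  the empty set.\<close>

definition ball_cover ::
    "real \<Rightarrow> 'a::euclidean_space set \<Rightarrow> nat set \<Rightarrow> (nat \<Rightarrow> 'a set) \<Rightarrow> bool" where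
  "ball_cover \<rho> X I B \<longleftrightarrow>
     (\<forall>i\<in>I. \<exists>c r. r > 0 \<and> B i = ball c r \<and> diameter (B i) \<le> \<rho>) \<and> X \<subseteq> (\<Union>i\<in>I. B i)"

definition hausdorff_premeasure ::
    "(real \<Rightarrow> real) \<Rightarrow> real \<Rightarrow> 'a::euclidean_space set \<Rightarrow> ennreal" where
  "hausdorff_premeasure f \<rho> X =
     (INF (I, B) \<in> {(I, B). ball_cover \<rho> X I B}. \<Sum>\<^sub>\<infinity>i\<in>I. ennreal (f (diameter (B i))))"

definition hausdorff_measure :: "(real \<Rightarrow> real) \<Rightarrow> 'a::euclidean_space set \<Rightarrow> ennreal" where
  "hausdorff_measure f X = Lim (at_right 0) (\<lambda>\<rho>. hausdorff_premeasure f \<rho> X)"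

text \<open>The limit in the definition above always exists in \<open>[0, \<infinity>]\<close>, by monotonicity in \<open>\<rho>\<close>.\<close>

lemma hausdorff_premeasure_antimono:
  assumes "\<rho> \<le> \<sigma>"
  shows "hausdorff_premeasure f \<sigma> X \<le> hausdorff_premeasure f \<rho> X"
  unfolding hausdorff_premeasure_def
  by (rule INF_superset_mono) (use assms in \<open>fastforce simp: ball_cover_def\<close>)+

lemma hausdorff_premeasure_tendsto_SUP:
  "((\<lambda>\<rho>. hausdorff_premeasure f \<rho> X) \<longlongrightarrow> (SUP \<rho>\<in>{0<..}. hausdorff_premeasure f \<rho> X)) (at_right 0)"
proof (rule order_tendstoI)
  fix a assume "a < (SUP \<rho>\<in>{0<..}. hausdorff_premeasure f \<rho> X)"
  then obtain \<sigma> where \<sigma>: "\<sigma> > 0" "a < hausdorff_premeasure f \<sigma> X"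
    by (auto simp: less_SUP_iff)
  have "\<forall>\<^sub>F \<rho> in at_right 0. \<rho> < \<sigma>"
    using \<sigma>(1) by (rule order_tendstoD(2)[OF tendsto_ident_at])
  then show "\<forall>\<^sub>F \<rho> in at_right 0. a < hausdorff_premeasure f \<rho> X"
    by eventually_elim (use \<sigma>(2) hausdorff_premeasure_antimono in \<open>meson less_imp_le less_le_trans\<close>)
next
  fix a assume *: "(SUP \<rho>\<in>{0<..}. hausdorff_premeasure f \<rho> X) < a"
  have "\<forall>\<^sub>F \<rho> in at_right (0::real). \<rho> > 0"
    by (rule eventually_at_right_less)
  then show "\<forall>\<^sub>F \<rho> in at_right 0. hausdorff_premeasure f \<rho> X < a"
    by eventually_elim (use * in \<open>meson SUP_upper greaterThan_iff le_less_trans\<close>)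
qed

lemma hausdorff_measure_eq_SUP:
  "hausdorff_measure f X = (SUP \<rho>\<in>{0<..}. hausdorff_premeasure f \<rho> X)"
  unfolding hausdorff_measure_def
  by (rule tendsto_Lim[OF _ hausdorff_premeasure_tendsto_SUP]) simp

text \<open>Matrices with \<open>m = CARD('m)\<close> rows and \<open>n = CARD('n)\<close> columns. The norm of the type
  \<^typ>\<open>real ^ 'n ^ 'm\<close> is the Euclidean norm of the \<open>m n\<close> entries.\<close>

definition unit_cube :: "(real ^ 'n ^ 'm) set" where
  "unit_cube = {X. \<forall>i j. X $ i $ j \<in> {-1/2..1/2}}"

definition W0 :: "(real \<Rightarrow> real) \<Rightarrow> (real ^ 'n ^ 'm) set" where
  "W0 \<psi> = {X \<in> unit_cube.
     infinite {q :: real ^ 'm. (\<forall>i. q $ i \<in> \<int>) \<and> q \<noteq> 0 \<and> infnorm (q v* X) < \<psi> (infnorm q)}}"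

definition low_rank :: "(real ^ 'n ^ 'm) set" where
  "low_rank = {X \<in> unit_cube. rank X \<le> CARD('m) - 1}"

end

theory Submission
  imports Defs "HOL-Analysis.Kronecker_Approximation_Theorem"
begin

text \<open>
  Write \<open>k = m - 1\<close>. A matrix of rank less than \<open>m\<close> annihilates some vector from the left. Dividing this
  vector by its largest entry and solving for the corresponding row, the matrix becomes
  \<open>kernel_param \<tau> v Y\<close>: the \<open>k\<close> rows \<open>Y\<close> are free, and the remaining row is \<open>- (\<Sum>a. v a Y a)\<close> with
  \<open>v\<close> in \<open>[-1, 1]\<close> to the power \<open>k\<close>. For an integer vector with entries \<open>p a\<close> at the rows of \<open>Y\<close> and \<open>q\<close> at
  the dependent row, the product with this matrix is \<open>\<Sum>a. (p a - q v a) Y a\<close>. Hence the matrix lies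
  in \<open>W0 \<psi>\<close> as soon as \<open>v\<close> is infinitely often within \<open>\<Psi> q / k\<close> of a rational point \<open>p / q\<close>. So \<open>W0 \<psi>\<close> looks
  like the product of a limsup set from simultaneous approximation in dimension \<open>k\<close> with a cube of
  dimension \<open>k n\<close>, and \<open>low_rank\<close>, which contains it, has dimension \<open>k (n + 1)\<close>.

  \<^bold>\<open>Convergence.\<close> For one integer vector of norm \<open>r\<close>, the matrices in question form a neighbourhood
  of width about \<open>\<Psi> r\<close> of a subspace of dimension \<open>k n\<close>. About \<open>\<Psi> r\<close> to the power \<open>- k n\<close> balls
  cover it, and there are about \<open>r\<close> to the power \<open>k\<close> such vectors; the Borel--Cantelli argument
  \<open>hausdorff_cantelli\<close> applies. The balls have diameter exactly \<open>\<Psi> r\<close>, so that no doubling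
  condition on \<open>f\<close> enters.

  \<^bold>\<open>Divergence.\<close> Both cases rest on \<open>disjoint_rational_balls\<close>: if \<open>V\<close> decreases and the sum of
  \<open>q ^ k * V q\<close> diverges, then each cube contains finitely many disjoint cubes, centred at rational
  points whose denominators \<open>q\<close> are as large as desired and with volume at most \<open>2 ^ k * V q\<close>, that
  fill a fixed proportion of it. Dirichlet's theorem provides many well separated rational points at
  each scale (\<open>ubiquity\<close>), and a greedy choice over the scales combines them.

  If \<open>f r / r ^ (k (n + 1))\<close> tends to a positive constant, the choice \<open>V = \<Theta> ^ k\<close> with \<open>\<Theta> r = \<Psi> r / k\<close>
  yields Khintchine's theorem: almost every \<open>v\<close> is approximable. The exceptional set is null, its
  image in the matrices has zero measure (\<open>hausdorff_null_kernel_param_image\<close>), and so \<open>W0 \<psi>\<close> and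
  \<open>low_rank\<close> have the same measure.

  If this quotient tends to infinity, put \<open>F r = f r / r ^ (k n)\<close> and \<open>V = F \<circ> \<Theta>\<close>, as in the mass
  transference principle. Instead of building a measure on a Cantor set, the proof shows directly
  that cheap covers miss a point. Given a family of dyadic cubes, a dyadic cube \<open>D\<close> is called deficient
  if it lies in no member of the family and the members inside \<open>D\<close> cost less than \<open>f\<close> of its side. A deficient cube contains
  cubes in which the family costs an arbitrarily small multiple of the volume
  (\<open>deficient_contains_sparse\<close>), and such a sparse cube contains a deficient one on which \<open>v\<close> is well
  approximable (\<open>sparse_cube_contains_deficient\<close>). Iterating, the deficient cubes shrink to a point of
  the limsup set that the family does not cover (\<open>nested_deficient_cubes\<close>). Therefore covering the part
  of the limsup set in a cube of side \<open>2\<close> to the power \<open>- N\<close> costs at least \<open>f\<close> of this side. The number of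
  such cubes grows like \<open>2\<close> to the power \<open>N k (n + 1)\<close>, so the total cost tends to infinity.
\<close>

section \<open>Cubes and rational points\<close>

definition sup_ball :: "real ^ 'k \<Rightarrow> real \<Rightarrow> (real ^ 'k) set" where
  "sup_ball c r = {x. \<forall>i. \<bar>x $ i - c $ i\<bar> < r}"

lemma sup_ball_eq_box: "sup_ball c r = box (\<chi> i. c $ i - r) (\<chi> i. c $ i + r)"
  by (auto simp: sup_ball_def mem_box_cart abs_less_iff) (smt (verit))+

lemma open_sup_ball: "open (sup_ball c r)"
  by (simp add: sup_ball_eq_box open_box)

lemma lmeasurable_sup_ball: "sup_ball c r \<in> lmeasurable"
  by (simp add: sup_ball_eq_box)

lemma measure_sup_ball:
  fixes c :: "real ^ 'k"
  assumes "r \<ge> 0"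
  shows "measure lebesgue (sup_ball c r) = (2 * r) ^ CARD('k)"
proof -
  have "measure lebesgue (sup_ball c r) = measure lborel (cbox (\<chi> i. c $ i - r) (\<chi> i. c $ i + r))"
    by (simp add: sup_ball_eq_box measure_completion measure_lborel_box_eq measure_lborel_cbox_eq)
  also have "\<dots> = (2 * r) ^ CARD('k)"
    using assms by (subst content_cbox_if_cart) (auto simp: cbox_interval less_eq_vec_def)
  finally show ?thesis .
qed

text \<open>Comparison of volumes is the only use of Lebesgue measure in the counting arguments: this lemma
  bounds packings from above, the next one bounds covers from below.\<close>

lemma sum_volumes_le_of_disjoint:
  fixes c :: "'a \<Rightarrow> real ^ 'k"
  assumes "finite S" "\<And>a. a \<in> S \<Longrightarrow> 0 \<le> r a" "0 \<le> R"
    and "\<And>a. a \<in> S \<Longrightarrow> sup_ball (c a) (r a) \<subseteq> sup_ball C R"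
    and "disjoint_family_on (\<lambda>a. sup_ball (c a) (r a)) S"
  shows "(\<Sum>a\<in>S. (2 * r a) ^ CARD('k)) \<le> (2 * R) ^ CARD('k)"
proof -
  have "(\<Sum>a\<in>S. (2 * r a) ^ CARD('k)) = (\<Sum>a\<in>S. measure lebesgue (sup_ball (c a) (r a)))"
    using assms(2) by (simp add: measure_sup_ball)
  also have "\<dots> = measure lebesgue (\<Union>a\<in>S. sup_ball (c a) (r a))"
    using assms(1,5) by (subst measure_finite_Union)
      (auto simp: lmeasurable_sup_ball fmeasurableD emeasure_eq_measure2)
  also have "\<dots> \<le> measure lebesgue (sup_ball C R)"
    using assms(1,4) by (intro measure_mono_fmeasurable)
      (auto simp: lmeasurable_sup_ball fmeasurableD intro!: sets.finite_UN)
  finally show ?thesis using assms(3) by (simp add: measure_sup_ball)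
qed

lemma volume_le_sum_of_cover:
  fixes c :: "'a \<Rightarrow> real ^ 'k"
  assumes "finite S" "\<And>a. a \<in> S \<Longrightarrow> 0 \<le> r a" "0 \<le> R"
    and "sup_ball C R \<subseteq> (\<Union>a\<in>S. sup_ball (c a) (r a))"
  shows "(2 * R) ^ CARD('k) \<le> (\<Sum>a\<in>S. (2 * r a) ^ CARD('k))"
proof -
  have "(2 * R) ^ CARD('k) = measure lebesgue (sup_ball C R)"
    using assms(3) by (simp add: measure_sup_ball)
  also have "\<dots> \<le> measure lebesgue (\<Union>a\<in>S. sup_ball (c a) (r a))"
    using assms(1,4) by (intro measure_mono_fmeasurable)
      (auto simp: lmeasurable_sup_ball fmeasurableD intro!: fmeasurable.finite_UN)
  also have "\<dots> \<le> (\<Sum>a\<in>S. measure lebesgue (sup_ball (c a) (r a)))"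
    using assms(1) by (intro measure_UNION_le) (auto simp: lmeasurable_sup_ball fmeasurableD)
  also have "\<dots> = (\<Sum>a\<in>S. (2 * r a) ^ CARD('k))"
    using assms(2) by (simp add: measure_sup_ball)
  finally show ?thesis .
qed

definition rational_point :: "('k \<Rightarrow> int) \<times> nat \<Rightarrow> real ^ 'k" where
  "rational_point a = (\<chi> i. of_int (fst a i) / real (snd a))"

lemma card_int_interval_le:
  fixes L u :: real
  assumes "0 \<le> L"
  shows "finite {p::int. \<bar>of_int p - u\<bar> < L}" "card {p::int. \<bar>of_int p - u\<bar> < L} \<le> 2 * L + 1"
proof -
  have sub: "{p::int. \<bar>of_int p - u\<bar> < L} \<subseteq> {\<lceil>u - L\<rceil>..\<lfloor>u + L\<rfloor>}"
    by (auto simp: ceiling_le_iff le_floor_iff abs_less_iff)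
  then show "finite {p::int. \<bar>of_int p - u\<bar> < L}" using finite_subset by blast
  have "card {p::int. \<bar>of_int p - u\<bar> < L} \<le> card {\<lceil>u - L\<rceil>..\<lfloor>u + L\<rfloor>}"
    by (rule card_mono[OF _ sub]) simp
  also have "real \<dots> \<le> 2 * L + 1"
    using assms by (auto simp: of_nat_nat) linarith
  finally show "card {p::int. \<bar>of_int p - u\<bar> < L} \<le> 2 * L + 1" by simp
qed

lemma card_fun_constraints:
  fixes A :: "'k::finite \<Rightarrow> 'b set"
  shows "card {p. \<forall>i. p i \<in> A i} = (\<Prod>i\<in>UNIV. card (A i))"
    and "(\<And>i. finite (A i)) \<Longrightarrow> finite {p. \<forall>i. p i \<in> A i}"
proof -
  have eq: "{p. \<forall>i. p i \<in> A i} = PiE UNIV A" by (auto simp: PiE_def extensional_def)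
  show "card {p. \<forall>i. p i \<in> A i} = (\<Prod>i\<in>UNIV. card (A i))"
    unfolding eq by (rule card_PiE) simp
  show "(\<And>i. finite (A i)) \<Longrightarrow> finite {p. \<forall>i. p i \<in> A i}"
    unfolding eq by (rule finite_PiE) auto
qed

lemma card_int_vectors_le:
  fixes u :: "real ^ 'k" and L :: real
  assumes "0 \<le> L"
  shows "finite {p::'k \<Rightarrow> int. \<forall>i. \<bar>of_int (p i) - u $ i\<bar> < L}"
    "card {p::'k \<Rightarrow> int. \<forall>i. \<bar>of_int (p i) - u $ i\<bar> < L} \<le> (2 * L + 1) ^ CARD('k)"
proof -
  let ?A = "\<lambda>i. {p::int. \<bar>of_int p - u $ i\<bar> < L}"
  have eq: "{p::'k \<Rightarrow> int. \<forall>i. \<bar>of_int (p i) - u $ i\<bar> < L} = {p. \<forall>i. p i \<in> ?A i}" by simp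
  show "finite {p::'k \<Rightarrow> int. \<forall>i. \<bar>of_int (p i) - u $ i\<bar> < L}"
    unfolding eq by (rule card_fun_constraints(2)) (rule card_int_interval_le(1)[OF assms])
  have "real (card {p. \<forall>i. p i \<in> ?A i}) = (\<Prod>i\<in>UNIV. real (card (?A i)))"
    using card_fun_constraints(1)[of ?A] by (simp only: of_nat_prod)
  also have "\<dots> \<le> (\<Prod>i\<in>(UNIV::'k set). 2 * L + 1)"
    by (intro prod_mono) (use card_int_interval_le(2)[OF assms] in auto)
  finally show "card {p::'k \<Rightarrow> int. \<forall>i. \<bar>of_int (p i) - u $ i\<bar> < L} \<le> (2 * L + 1) ^ CARD('k)"
    unfolding eq by simp
qed

text \<open>Dirichlet's theorem with error \<open>1 / (q Q)\<close> for \<open>q \<le> Q ^ k\<close>: with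
  this choice of the range all scales below are integer powers.\<close>

lemma dirichlet_vector:
  fixes x :: "real ^ 'k"
  assumes "0 < Q"
  shows "\<exists>(p :: 'k \<Rightarrow> int) q. 0 < q \<and> q \<le> Q ^ CARD('k) \<and>
    (\<forall>i. \<bar>x $ i - of_int (p i) / real q\<bar> < 1 / (real q * real Q))"
proof -
  obtain e where e: "bij_betw e (UNIV :: 'k set) {0..<CARD('k)}"
    using ex_bij_betw_finite_nat[of "UNIV :: 'k set"] by auto
  obtain q p where qp: "0 < q" "q \<le> int (Q ^ CARD('k))"
      "\<And>i. i < CARD('k) \<Longrightarrow> \<bar>of_int q * (x $ inv_into UNIV e i) - of_int (p i)\<bar> < 1 / Q"
    using Dirichlet_approx_simult[OF assms, of "CARD('k)" "\<lambda>i. x $ inv_into UNIV e i"] by blast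
  show ?thesis
  proof (intro exI[of _ "nat q"] exI[of _ "\<lambda>i. p (e i)"] conjI allI)
    show "0 < nat q" using qp by auto
    show "nat q \<le> Q ^ CARD('k)" using qp(2) by linarith
    fix i :: 'k
    have "e i < CARD('k)" "inv_into UNIV e (e i) = i"
      using e bij_betwE[OF e] by (auto simp: bij_betw_def)
    with qp(3)[of "e i"] have *: "\<bar>of_int q * x $ i - of_int (p (e i))\<bar> < 1 / Q" by simp
    have "x $ i - of_int (p (e i)) / real (nat q) = (of_int q * x $ i - of_int (p (e i))) / of_int q"
      using qp(1) by (simp add: field_simps)
    then have "\<bar>x $ i - of_int (p (e i)) / real (nat q)\<bar> = \<bar>of_int q * x $ i - of_int (p (e i))\<bar> / of_int q"
      using qp(1) by (simp add: abs_divide)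
    also have "\<dots> < (1 / Q) / of_int q"
      using * qp(1) by (intro divide_strict_right_mono) auto
    finally show "\<bar>x $ i - of_int (p (e i)) / real (nat q)\<bar> < 1 / (real (nat q) * real Q)"
      using qp(1) by (simp add: mult.commute)
  qed
qed

definition separated :: "real \<Rightarrow> (('k::finite \<Rightarrow> int) \<times> nat) set \<Rightarrow> bool" where
  "separated \<delta> S \<longleftrightarrow> (\<forall>a\<in>S. \<forall>b\<in>S. a \<noteq> b \<longrightarrow> (\<exists>i. \<delta> \<le> \<bar>rational_point a $ i - rational_point b $ i\<bar>))"

text \<open>The \<open>\<delta>\<close>-neighbourhoods of a maximal \<open>\<delta>\<close>-separated set
  cover the whole set; a set of largest cardinality is maximal.\<close>

lemma maximal_separated:
  assumes "finite G"
  obtains S where "S \<subseteq> G" "separated \<delta> S"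
    "\<And>g. g \<in> G \<Longrightarrow> \<exists>a\<in>S. g = a \<or> (\<forall>i. \<bar>rational_point g $ i - rational_point a $ i\<bar> < \<delta>)"
proof -
  let ?P = "\<lambda>S. S \<subseteq> G \<and> separated \<delta> S"
  have "?P {}" by (auto simp: separated_def)
  moreover have "\<forall>S. ?P S \<longrightarrow> card S < Suc (card G)"
    using assms by (auto simp: less_Suc_eq_le intro: card_mono)
  ultimately have "\<exists>S. ?P S \<and> (\<forall>S'. ?P S' \<longrightarrow> card S' \<le> card S)"
    by (rule ex_has_greatest_nat)
  then obtain S where S: "?P S" "\<And>S'. ?P S' \<Longrightarrow> card S' \<le> card S" by blast
  show thesis
  proof (rule that[of S])
    show "S \<subseteq> G" "separated \<delta> S" using S by auto
    fix g assume g: "g \<in> G"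
    show "\<exists>a\<in>S. g = a \<or> (\<forall>i. \<bar>rational_point g $ i - rational_point a $ i\<bar> < \<delta>)"
    proof (rule ccontr)
      assume neg: "\<not> ?thesis"
      then have "g \<notin> S" by auto
      moreover have "?P (insert g S)"
        using S(1) g neg by (auto simp: separated_def not_less abs_minus_commute) 
      moreover have "finite S" using S(1) assms finite_subset by blast
      ultimately show False using S(2)[of "insert g S"] by simp
    qed
  qed
qed

section \<open>Ubiquity of rational points\<close>

text \<open>Multiplication by \<open>q\<close> turns these points into integer points of a cube that is
  \<open>q\<close> times larger.\<close>

lemma rationals_of_denominator_near:
  fixes c :: "real ^ 'k"
  assumes "0 < q" "0 \<le> r"
  shows "finite {p::'k \<Rightarrow> int. \<forall>i. \<bar>rational_point (p, q) $ i - c $ i\<bar> < r}"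
    "card {p::'k \<Rightarrow> int. \<forall>i. \<bar>rational_point (p, q) $ i - c $ i\<bar> < r} \<le> (2 * (real q * r) + 1) ^ CARD('k)"
proof -
  have "\<bar>of_int z / real q - c $ i\<bar> < r \<longleftrightarrow> \<bar>of_int z - (real q *\<^sub>R c) $ i\<bar> < real q * r" for z :: int and i
  proof -
    have "of_int z - (real q *\<^sub>R c) $ i = real q * (of_int z / real q - c $ i)"
      using assms by (simp add: field_simps)
    then have "\<bar>of_int z - (real q *\<^sub>R c) $ i\<bar> = real q * \<bar>of_int z / real q - c $ i\<bar>"
      by (simp add: abs_mult)
    then show ?thesis using assms by simp
  qed
  then have eq: "{p::'k \<Rightarrow> int. \<forall>i. \<bar>rational_point (p, q) $ i - c $ i\<bar> < r}
      = {p. \<forall>i. \<bar>of_int (p i) - (real q *\<^sub>R c) $ i\<bar> < real q * r}"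
    by (auto simp: rational_point_def)
  show "finite {p::'k \<Rightarrow> int. \<forall>i. \<bar>rational_point (p, q) $ i - c $ i\<bar> < r}"
    unfolding eq using assms by (intro card_int_vectors_le) auto
  show "card {p::'k \<Rightarrow> int. \<forall>i. \<bar>rational_point (p, q) $ i - c $ i\<bar> < r} \<le> (2 * (real q * r) + 1) ^ CARD('k)"
    unfolding eq using assms by (intro card_int_vectors_le) auto
qed

text \<open>The scale is \<open>\<rho> = 1 / Q ^ (k + 1)\<close>, about the typical distance between rational
  points of denominator at most \<open>Q ^ k\<close>. Separation by \<open>2 \<rho>\<close> makes the cubes of
  radius \<open>\<rho>\<close> disjoint.\<close>

definition spread_rationals :: "nat \<Rightarrow> nat \<Rightarrow> real ^ 'k \<Rightarrow> real \<Rightarrow> (('k \<Rightarrow> int) \<times> nat) set \<Rightarrow> bool" where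
  "spread_rationals Q T c h S \<longleftrightarrow> finite S \<and> separated (2 / real Q ^ (CARD('k) + 1)) S \<and>
     (\<forall>a\<in>S. T \<le> snd a \<and> 0 < snd a \<and> snd a \<le> Q ^ CARD('k) \<and>
        sup_ball (rational_point a) (1 / real Q ^ (CARD('k) + 1)) \<subseteq> sup_ball c h)"

text \<open>By Dirichlet's theorem each point of the cube of half the size is within \<open>1 / (q Q)\<close>
  of some \<open>p / q\<close> with \<open>q \<le> Q ^ k\<close>. Denominators \<open>q \<le> \<delta> * Q ^
  k\<close> account for at most half of the volume if \<open>\<delta>\<close> is a small constant and
  \<open>Q\<close> is large. The other points are within \<open>\<rho> / \<delta>\<close> of a rational point
  of large denominator, hence within a multiple of \<open>\<rho>\<close> of a maximal separated set of such
  points, and comparing volumes bounds its cardinality from below. The constant \<open>c1\<close> depends on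
  the dimension only, which matters later: the ratio of successive scales is chosen in terms of
  \<open>c1\<close>.\<close>

lemma ubiquity:
  "\<exists>c1>0. \<forall>(c::real ^ 'k) h T. 0 < h \<and> h \<le> 1 \<longrightarrow>
     (\<exists>Q0. \<forall>Q\<ge>Q0. \<exists>S. spread_rationals Q T c h S \<and> c1 * h ^ CARD('k) * (real Q ^ (CARD('k) + 1)) ^ CARD('k) \<le> real (card S))"
proof -
  let ?k = "CARD('k)"
  define \<delta> :: real where "\<delta> = 1 / (4 * 8 ^ ?k)"
  define c1 :: real where "c1 = 1 / (2 * (2 * (2 + 1 / \<delta>)) ^ ?k)"
  have \<delta>: "0 < \<delta>" by (simp add: \<delta>_def)
  have c1: "0 < c1" using \<delta> by (auto simp: c1_def intro!: divide_pos_pos zero_less_power add_pos_pos)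
  have kpos: "0 < ?k" by simp
  have main: "\<exists>Q0. \<forall>Q\<ge>Q0. \<exists>S. spread_rationals Q T c h S \<and> c1 * h ^ ?k * (real Q ^ (?k + 1)) ^ ?k \<le> real (card S)"
    if h: "0 < h" "h \<le> 1" for c :: "real ^ 'k" and h T
  proof -
    (* In this order, the four lower bounds for Q make Q positive, the contribution of the denominators
       below 1 / h small, all remaining denominators at least T, and the chosen cubes fit. *)
    obtain Q0 :: nat where Q0: "real Q0 \<ge> max (max 1 (4 * 8 ^ ?k / h ^ (?k + 1))) (max (real T / \<delta>) ((1 / \<delta> + 1) * 2 / h))"
      using real_arch_simple by blast
    have "\<exists>S. spread_rationals Q T c h S \<and> c1 * h ^ ?k * (real Q ^ (?k + 1)) ^ ?k \<le> real (card S)" if QQ: "Q \<ge> Q0" for Q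
    proof -
      have Q: "real Q \<ge> 1" "real Q \<ge> 4 * 8 ^ ?k / h ^ (?k + 1)" "real Q \<ge> real T / \<delta>" "real Q \<ge> (1 / \<delta> + 1) * 2 / h"
        using Q0 QQ by (auto simp: of_nat_le_iff[symmetric] simp del: of_nat_le_iff)
      have Qk: "real Q \<le> real Q ^ ?k" using Q(1) kpos by (metis One_nat_def Suc_leI power_increasing power_one_right)
      have Qk1: "real Q \<le> real Q ^ (?k + 1)" using Q(1) by (metis add.commute le_add1 power_increasing power_one_right)
      define N :: real where "N = real Q ^ ?k"
      define \<rho> where "\<rho> = 1 / real Q ^ (?k + 1)"
      have N: "N \<ge> 1" "N \<ge> real Q" using Q(1) Qk by (auto simp: N_def)
      have \<rho>: "0 < \<rho>" using Q(1) by (simp add: \<rho>_def)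
      have \<rho>N: "\<rho> = 1 / (N * real Q)" by (simp add: \<rho>_def N_def mult.commute)
      have \<rho>h: "(1 / \<delta> + 1) * \<rho> \<le> h / 2"
      proof -
        have "(1 / \<delta> + 1) * \<rho> \<le> (1 / \<delta> + 1) * (1 / real Q)"
          using Qk1 Q(1) \<delta> by (intro mult_left_mono) (auto simp: \<rho>_def intro!: divide_left_mono)
        also have "\<dots> \<le> h / 2" using Q(1,4) h by (simp add: field_simps)
        finally show ?thesis .
      qed
      let ?small = "{q::nat. 0 < q \<and> real q \<le> \<delta> * N}"
      let ?r = "\<lambda>q::nat. 1 / (real q * real Q)"
      let ?near = "\<lambda>q. {p::'k \<Rightarrow> int. \<forall>i. \<bar>rational_point (p, q) $ i - c $ i\<bar> < h / 2 + ?r q}"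
      define Bad where "Bad = (SIGMA q:?small. ?near q)"
      define G where "G = {(p :: 'k \<Rightarrow> int, q :: nat). \<delta> * N < real q \<and> q \<le> Q ^ ?k \<and> (\<forall>i. \<bar>rational_point (p, q) $ i - c $ i\<bar> < h / 2 + \<rho> / \<delta>)}"
      have fin_small: "finite ?small"
        by (rule finite_subset[of _ "{..nat \<lfloor>\<delta> * N\<rfloor>}"]) (auto simp: le_nat_floor)
      have finBad: "finite Bad"
        unfolding Bad_def using fin_small h by (intro finite_SigmaI rationals_of_denominator_near) auto
      have Gpos: "0 < q" if "(p, q) \<in> G" for p q
        using that \<delta> N(1) by (auto simp: G_def) (smt (verit) mult_pos_pos of_nat_0_less_iff)
      have "G \<subseteq> prod.swap ` (SIGMA q:{0<..Q ^ ?k}. {p. \<forall>i. \<bar>rational_point (p, q) $ i - c $ i\<bar> < h / 2 + \<rho> / \<delta>})"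
      proof
        fix a assume a: "a \<in> G"
        obtain p q where [simp]: "a = (p, q)" by (cases a)
        have "0 < q" using Gpos a by simp
        with a show "a \<in> prod.swap ` (SIGMA q:{0<..Q ^ ?k}. {p. \<forall>i. \<bar>rational_point (p, q) $ i - c $ i\<bar> < h / 2 + \<rho> / \<delta>})"
          by (auto simp: G_def image_iff)
      qed
      moreover have "finite (SIGMA q:{0<..Q ^ ?k}. {p::'k \<Rightarrow> int. \<forall>i. \<bar>rational_point (p, q) $ i - c $ i\<bar> < h / 2 + \<rho> / \<delta>})"
        using h \<rho> \<delta> by (intro finite_SigmaI rationals_of_denominator_near) auto
      ultimately have finG: "finite G" using finite_subset by blast
      obtain S where S: "S \<subseteq> G" "separated (2 * \<rho>) S"
        "\<And>g. g \<in> G \<Longrightarrow> \<exists>a\<in>S. g = a \<or> (\<forall>i. \<bar>rational_point g $ i - rational_point a $ i\<bar> < 2 * \<rho>)"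
        using maximal_separated[OF finG] by blast
      have finS: "finite S" using S(1) finG finite_subset by blast
      (* Bad collects the cubes around rational points of small denominator; the remaining points
         of the cube are close to the separated set S. *)
      let ?cen = "\<lambda>u. case u of Inl a \<Rightarrow> rational_point (snd a, fst a) | Inr a \<Rightarrow> rational_point a"
      let ?rad = "\<lambda>u. case u of Inl a \<Rightarrow> ?r (fst a) | Inr a \<Rightarrow> (2 + 1 / \<delta>) * \<rho>"
      have cover: "sup_ball c (h / 2) \<subseteq> (\<Union>u\<in>Bad <+> S. sup_ball (?cen u) (?rad u))"
      proof
        fix x assume "x \<in> sup_ball c (h / 2)"
        then have x: "\<And>i. \<bar>x $ i - c $ i\<bar> < h / 2" by (simp add: sup_ball_def)
        have Qpos: "0 < Q" using Q(1) by (cases Q) auto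
        obtain p q where pq: "0 < q" "q \<le> Q ^ ?k" "\<And>i. \<bar>x $ i - of_int (p i) / real q\<bar> < ?r q"
          using dirichlet_vector[OF Qpos, of x] by blast
        have pq': "\<bar>x $ i - rational_point (p, q) $ i\<bar> < ?r q" for i
          using pq(3) by (simp add: rational_point_def)
        have near: "\<bar>rational_point (p, q) $ i - c $ i\<bar> < h / 2 + ?r q" for i
          using x[of i] pq'[of i] by linarith
        have UN: "x \<in> (\<Union>u\<in>Bad <+> S. sup_ball (?cen u) (?rad u))"
          if "u \<in> Bad <+> S" "x \<in> sup_ball (?cen u) (?rad u)" for u
          using that by (rule UN_I)
        show "x \<in> (\<Union>u\<in>Bad <+> S. sup_ball (?cen u) (?rad u))"
        proof (cases "real q \<le> \<delta> * N")
          case True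
          then have "(q, p) \<in> Bad" using pq(1) near by (simp add: Bad_def)
          moreover have "x \<in> sup_ball (rational_point (p, q)) (?r q)" using pq' by (simp add: sup_ball_def)
          ultimately show ?thesis using UN[OF InlI[of "(q, p)"]] by simp
        next
          case False
          have "?r q \<le> 1 / (\<delta> * N * real Q)"
            using False \<delta> N Q(1) pq(1) by (intro divide_left_mono mult_right_mono mult_pos_pos) auto
          also have "\<dots> = \<rho> / \<delta>" by (simp add: \<rho>N field_simps)
          finally have r: "?r q \<le> \<rho> / \<delta>" .
          then have "\<bar>rational_point (p, q) $ i - c $ i\<bar> < h / 2 + \<rho> / \<delta>" for i
            using near[of i] by linarith
          then have "(p, q) \<in> G" using False pq(2) by (simp add: G_def)
          then obtain a where a: "a \<in> S" "(p, q) = a \<or> (\<forall>i. \<bar>rational_point (p, q) $ i - rational_point a $ i\<bar> < 2 * \<rho>)"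
            using S(3) by blast
          have "\<bar>x $ i - rational_point a $ i\<bar> < (2 + 1 / \<delta>) * \<rho>" for i
          proof -
            have "\<bar>rational_point (p, q) $ i - rational_point a $ i\<bar> < 2 * \<rho>" using a(2) \<rho> by auto
            then have "\<bar>x $ i - rational_point a $ i\<bar> < \<rho> / \<delta> + 2 * \<rho>" using pq'[of i] r by linarith
            then show ?thesis by (simp add: algebra_simps)
          qed
          then have "x \<in> sup_ball (rational_point a) ((2 + 1 / \<delta>) * \<rho>)" by (simp add: sup_ball_def)
          then show ?thesis using UN[OF InrI[OF a(1)]] by simp
        qed
      qed
      have "h ^ ?k \<le> (\<Sum>u\<in>Bad <+> S. (2 * ?rad u) ^ ?k)"
        using volume_le_sum_of_cover[OF _ _ _ cover] finBad finS h \<delta> \<rho>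
        by (auto split: sum.splits)
      also have "\<dots> = (\<Sum>a\<in>Bad. (2 * ?r (fst a)) ^ ?k) + (\<Sum>a\<in>S. (2 * ((2 + 1 / \<delta>) * \<rho>)) ^ ?k)"
        by (subst sum.Plus) (use finBad finS in \<open>auto simp: o_def power_mult_distrib power_divide intro!: sum.cong\<close>)
      finally have vol: "h ^ ?k \<le> (\<Sum>a\<in>Bad. (2 * ?r (fst a)) ^ ?k) + card S * (2 * ((2 + 1 / \<delta>) * \<rho>)) ^ ?k"
        by simp
      have "(\<Sum>a\<in>Bad. (2 * ?r (fst a)) ^ ?k) = (\<Sum>q\<in>?small. card (?near q) * (2 * ?r q) ^ ?k)"
      proof -
        have "(\<Sum>q\<in>?small. \<Sum>p\<in>?near q. (2 * ?r q) ^ ?k) = (\<Sum>(q, p)\<in>Bad. (2 * ?r q) ^ ?k)"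
          unfolding Bad_def using fin_small h
          by (intro sum.Sigma ballI rationals_of_denominator_near) auto
        then show ?thesis by (simp add: split_def)
      qed
      also have "\<dots> \<le> (\<Sum>q\<in>?small. (8 * h) ^ ?k / N + (if real q < 1 / h then 8 ^ ?k / N else 0))"
      proof (rule sum_mono)
        fix q assume "q \<in> ?small"
        then have q: "0 < q" by simp
        have rq: "real q * ?r q \<le> 1" using q Q(1) by simp
        have "card (?near q) * (2 * ?r q) ^ ?k \<le> (2 * (real q * (h / 2 + ?r q)) + 1) ^ ?k * (2 * ?r q) ^ ?k"
          using q h Q(1) by (intro mult_right_mono rationals_of_denominator_near) auto
        also have "\<dots> \<le> ((real q * h + 3) * (2 * ?r q)) ^ ?k"
          unfolding power_mult_distrib[symmetric]
        proof (intro power_mono mult_right_mono)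
          have "2 * (real q * (h / 2 + ?r q)) = real q * h + 2 * (real q * ?r q)"
            by (simp only: distrib_left)
          then show "2 * (real q * (h / 2 + ?r q)) + 1 \<le> real q * h + 3" using rq by linarith
        qed (use h Q(1) in auto)
        also have "(real q * h + 3) * (2 * ?r q) = (2 * h + 6 / real q) / real Q"
          using q Q(1) by (simp add: field_simps)
        also have "\<dots> ^ ?k = (2 * h + 6 / real q) ^ ?k / N" by (simp add: power_divide N_def)
        also have "\<dots> \<le> (8 * h) ^ ?k / N + (if real q < 1 / h then 8 ^ ?k / N else 0)"
        proof (cases "real q < 1 / h")
          case True
          have "6 / real q \<le> 6" using q by (simp add: divide_le_eq)
          then have "(2 * h + 6 / real q) ^ ?k \<le> 8 ^ ?k" using h by (intro power_mono) auto
          then show ?thesis using True N h by (simp add: divide_right_mono add_increasing)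
        next
          case False
          have "1 \<le> real q * h" using False h by (simp add: field_simps)
          then have "6 / real q \<le> 6 * h" using q by (simp add: divide_le_eq mult.commute)
          then have "(2 * h + 6 / real q) ^ ?k \<le> (8 * h) ^ ?k" using h by (intro power_mono) auto
          then show ?thesis using False N by (simp add: divide_right_mono)
        qed
        finally show "card (?near q) * (2 * ?r q) ^ ?k \<le> (8 * h) ^ ?k / N + (if real q < 1 / h then 8 ^ ?k / N else 0)" .
      qed
      also have "\<dots> = card ?small * ((8 * h) ^ ?k / N) + card {q\<in>?small. real q < 1 / h} * (8 ^ ?k / N)"
        by (simp add: sum.distrib sum.inter_filter[symmetric, OF fin_small])
      also have "\<dots> \<le> (\<delta> * N) * ((8 * h) ^ ?k / N) + (1 / h) * (8 ^ ?k / N)"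
      proof (intro add_mono mult_right_mono)
        have "card ?small \<le> card {1..nat \<lfloor>\<delta> * N\<rfloor>}"
          by (rule card_mono) (auto simp: le_nat_floor)
        also have "real \<dots> \<le> \<delta> * N" using \<delta> N by simp
        finally show "real (card ?small) \<le> \<delta> * N" by simp
        have "card {q\<in>?small. real q < 1 / h} \<le> card {1..nat \<lfloor>1 / h\<rfloor>}"
          by (rule card_mono) (auto simp: le_nat_floor)
        also have "real \<dots> \<le> 1 / h" using h by simp
        finally show "real (card {q\<in>?small. real q < 1 / h}) \<le> 1 / h" by simp
      qed (use h N in auto)
      also have "\<dots> \<le> h ^ ?k / 4 + h ^ ?k / 4"
      proof (rule add_mono)
        show "(\<delta> * N) * ((8 * h) ^ ?k / N) \<le> h ^ ?k / 4"
          using N by (simp add: \<delta>_def power_mult_distrib)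
        have "4 * 8 ^ ?k / h ^ (?k + 1) \<le> N" using Q(2) N(2) by linarith
        then show "(1 / h) * (8 ^ ?k / N) \<le> h ^ ?k / 4"
          using h N by (simp add: field_simps)
      qed
      finally have "(\<Sum>a\<in>Bad. (2 * ?r (fst a)) ^ ?k) \<le> h ^ ?k / 2" by simp
      with vol have half: "h ^ ?k / 2 \<le> card S * (2 * ((2 + 1 / \<delta>) * \<rho>)) ^ ?k" by linarith
      have "c1 * h ^ ?k * (real Q ^ (?k + 1)) ^ ?k = (h ^ ?k / 2) / (2 * ((2 + 1 / \<delta>) * \<rho>)) ^ ?k"
        by (simp add: c1_def \<rho>_def power_mult_distrib power_divide)
      also have "\<dots> \<le> card S"
        using half \<delta> \<rho> by (subst pos_divide_le_eq) (auto intro!: zero_less_power mult_pos_pos add_pos_pos)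
      finally have cardS: "c1 * h ^ ?k * (real Q ^ (?k + 1)) ^ ?k \<le> card S" .
      have inside: "T \<le> snd a \<and> 0 < snd a \<and> snd a \<le> Q ^ ?k \<and> sup_ball (rational_point a) (1 / real Q ^ (?k + 1)) \<subseteq> sup_ball c h"
        if "a \<in> S" for a
      proof -
        obtain p q where a: "a = (p, q)" by (cases a)
        have G: "(p, q) \<in> G" using that S(1) a by auto
        have "real T \<le> \<delta> * N" using Q(3) N(2) \<delta> by (smt (verit) pos_divide_le_eq mult.commute)
        moreover have "\<delta> * N < real q" using G by (simp add: G_def)
        ultimately have "T \<le> q" by linarith
        moreover have "sup_ball (rational_point a) \<rho> \<subseteq> sup_ball c h"
        proof
          fix x assume "x \<in> sup_ball (rational_point a) \<rho>"
          then have x: "\<bar>x $ i - rational_point (p, q) $ i\<bar> < \<rho>" for i by (simp add: a sup_ball_def)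
          have g: "\<bar>rational_point (p, q) $ i - c $ i\<bar> < h / 2 + \<rho> / \<delta>" for i using G by (simp add: G_def)
          have "\<bar>x $ i - c $ i\<bar> < h" for i
          proof -
            have "\<rho> / \<delta> + \<rho> \<le> h / 2" using \<rho>h by (simp add: algebra_simps)
            then show ?thesis using x[of i] g[of i] by linarith
          qed
          then show "x \<in> sup_ball c h" by (simp add: sup_ball_def)
        qed
        ultimately show ?thesis using Gpos[OF G] G by (auto simp: a \<rho>_def G_def)
      qed
      have "separated (2 / real Q ^ (?k + 1)) S" using S(2) by (simp add: \<rho>_def)
      then show ?thesis using finS inside cardS unfolding spread_rationals_def by blast
    qed
    then show ?thesis by blast
  qed
  show ?thesis using c1 main by blast
qed

section \<open>Disjoint cubes around rational points\<close>

lemma separated_imp_disjoint: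
  assumes "separated (2 * \<rho>) S"
  shows "disjoint_family_on (\<lambda>a. sup_ball (rational_point a) \<rho>) S"
proof (unfold disjoint_family_on_def, intro ballI impI equals0I)
  fix a b x assume ab: "a \<in> S" "b \<in> S" "a \<noteq> b"
    and "x \<in> sup_ball (rational_point a) \<rho> \<inter> sup_ball (rational_point b) \<rho>"
  then have x: "\<bar>x $ i - rational_point a $ i\<bar> < \<rho> \<and> \<bar>x $ i - rational_point b $ i\<bar> < \<rho>" for i
    by (simp add: sup_ball_def)
  have "\<bar>rational_point a $ i - rational_point b $ i\<bar> < 2 * \<rho>" for i
    using x[of i] by linarith
  with assms ab show False unfolding separated_def by (meson not_le)
qed

lemma sup_ball_mono: "r \<le> s \<Longrightarrow> sup_ball c r \<subseteq> sup_ball c s"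
  by (auto simp: sup_ball_def intro: less_le_trans)

lemma power_add_le: "0 \<le> a \<Longrightarrow> 0 \<le> b \<Longrightarrow> (a + b) ^ k \<le> 2 ^ k * (a ^ k + b ^ k)" for a b :: real
proof -
  assume ab: "0 \<le> a" "0 \<le> b"
  have "(a + b) ^ k \<le> (2 * max a b) ^ k" using ab by (intro power_mono) auto
  also have "\<dots> \<le> 2 ^ k * (a ^ k + b ^ k)"
    using ab by (auto simp: power_mult_distrib max_def)
  finally show ?thesis .
qed

text \<open>The cubes of radius \<open>\<rho>\<close> around the points counted here are disjoint and lie in
  the cube of radius \<open>\<theta>y + 2 \<rho>\<close> around \<open>y\<close>. In the bound, the first term
  matters for large \<open>\<theta>y\<close>; the second one is a constant for each \<open>y\<close>.\<close>

lemma card_meeting_le: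
  fixes y :: "real ^ 'k"
  assumes S: "finite S" "separated (2 * \<rho>) S" and \<rho>: "0 < \<rho>" and \<theta>: "\<theta> \<le> \<rho>" and \<theta>y: "0 < \<theta>y"
  shows "card {a\<in>S. sup_ball (rational_point a) \<theta> \<inter> sup_ball y \<theta>y \<noteq> {}}
    \<le> 2 ^ CARD('k) * (\<theta>y / \<rho>) ^ CARD('k) + 4 ^ CARD('k)"
proof -
  let ?K = "{a\<in>S. sup_ball (rational_point a) \<theta> \<inter> sup_ball y \<theta>y \<noteq> {}}"
  have sub: "sup_ball (rational_point a) \<rho> \<subseteq> sup_ball y (\<theta>y + 2 * \<rho>)" if aK: "a \<in> ?K" for a
  proof
    fix x assume "x \<in> sup_ball (rational_point a) \<rho>"
    then have x: "\<bar>x $ i - rational_point a $ i\<bar> < \<rho>" for i by (simp add: sup_ball_def)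
    obtain z where "z \<in> sup_ball (rational_point a) \<theta>" "z \<in> sup_ball y \<theta>y" using aK by auto
    then have z: "\<bar>z $ i - rational_point a $ i\<bar> < \<theta>" "\<bar>z $ i - y $ i\<bar> < \<theta>y" for i by (auto simp: sup_ball_def)
    have "\<bar>x $ i - y $ i\<bar> < \<theta>y + 2 * \<rho>" for i
      using x[of i] z(1)[of i] z(2)[of i] \<theta> by linarith
    then show "x \<in> sup_ball y (\<theta>y + 2 * \<rho>)" by (simp add: sup_ball_def)
  qed
  have "(\<Sum>a\<in>?K. (2 * \<rho>) ^ CARD('k)) \<le> (2 * (\<theta>y + 2 * \<rho>)) ^ CARD('k)"
  proof (rule sum_volumes_le_of_disjoint[where c = rational_point])
    show "disjoint_family_on (\<lambda>a. sup_ball (rational_point a) \<rho>) ?K"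
      using separated_imp_disjoint[OF S(2)] by (rule disjoint_family_on_mono[rotated]) auto
  qed (use S(1) \<rho> \<theta>y sub in auto)
  then have "card ?K * (2 * \<rho>) ^ CARD('k) \<le> ((\<theta>y / \<rho> + 2) * (2 * \<rho>)) ^ CARD('k)"
    using \<rho> by (simp add: algebra_simps)
  then have "card ?K \<le> (\<theta>y / \<rho> + 2) ^ CARD('k)"
    using \<rho> by (simp add: power_mult_distrib)
  also have "\<dots> \<le> 2 ^ CARD('k) * ((\<theta>y / \<rho>) ^ CARD('k) + 2 ^ CARD('k))"
    using \<rho> \<theta>y by (intro power_add_le) auto
  also have "\<dots> = 2 ^ CARD('k) * (\<theta>y / \<rho>) ^ CARD('k) + (2 * 2) ^ CARD('k)"
    unfolding power_mult_distrib by (simp only: distrib_left)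
  finally show ?thesis by simp
qed

text \<open>Cauchy condensation along the denominators \<open>(R ^ t) ^ k\<close>. Truncating the terms at
  \<open>1\<close> is harmless: if the truncated series converged, its terms would eventually lie below
  \<open>1\<close>, and the truncation would do nothing.\<close>

lemma divergent_along_powers:
  fixes V :: "real \<Rightarrow> real" and k R :: nat
  assumes Vpos: "\<And>r. 0 < r \<Longrightarrow> 0 < V r" and Vanti: "antimono_on {0<..} V"
    and div: "\<not> summable (\<lambda>j. real (Suc j) ^ k * V (real (Suc j)))" and R: "2 \<le> R" and k: "0 < k"
  shows "\<not> summable (\<lambda>t. min 1 (V (real ((R ^ t) ^ k)) * (real R ^ t) ^ (k * (k + 1))))"
proof
  let ?N = "\<lambda>t. (R ^ t) ^ k"
  let ?a = "\<lambda>t. V (real (?N t)) * (real R ^ t) ^ (k * (k + 1))"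
  let ?g = "\<lambda>q. real q ^ k * V (real q)"
  have Npos: "0 < ?N t" for t using R by simp
  have apos: "0 \<le> ?a t" for t using Vpos[of "real (?N t)"] R by simp
  assume s: "summable (\<lambda>t. min 1 (?a t))"
  then have "(\<lambda>t. min 1 (?a t)) \<longlonglongrightarrow> 0" by (rule summable_LIMSEQ_zero)
  then have "\<forall>\<^sub>F t in sequentially. min 1 (?a t) < 1" by (rule order_tendstoD) simp
  then have "\<forall>\<^sub>F t in sequentially. min 1 (?a t) = ?a t" by eventually_elim auto
  from summable_cong[OF this] s have sa: "summable ?a" by simp
  define C where "C = (real R ^ k) ^ (k + 1)"
  have C: "0 \<le> C" by (simp add: C_def)
  have block: "(\<Sum>q\<in>{?N t<..?N (Suc t)}. ?g q) \<le> C * ?a t" for t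
  proof -
    have "(\<Sum>q\<in>{?N t<..?N (Suc t)}. ?g q) \<le> (\<Sum>q\<in>{?N t<..?N (Suc t)}. real (?N (Suc t)) ^ k * V (real (?N t)))"
    proof (rule sum_mono)
      fix q assume q: "q \<in> {?N t<..?N (Suc t)}"
      then have "V (real q) \<le> V (real (?N t))"
        using Npos[of t] by (intro monotone_onD[OF Vanti]) (auto simp: of_nat_le_iff simp del: of_nat_power)
      moreover have "real q ^ k \<le> real (?N (Suc t)) ^ k" using q by (intro power_mono) (auto simp del: of_nat_power)
      ultimately show "?g q \<le> real (?N (Suc t)) ^ k * V (real (?N t))"
        using q Npos[of t] Vpos[of "real q"] by (intro mult_mono) auto
    qed
    also have "\<dots> = real (?N (Suc t) - ?N t) * (real (?N (Suc t)) ^ k * V (real (?N t)))" by simp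
    also have "\<dots> \<le> real (?N (Suc t)) * (real (?N (Suc t)) ^ k * V (real (?N t)))"
      using Vpos[of "real (?N t)"] Npos[of t] by (intro mult_right_mono) (auto simp del: of_nat_power)
    also have "\<dots> = real (?N (Suc t)) ^ (k + 1) * V (real (?N t))" by simp
    also have "real (?N (Suc t)) ^ (k + 1) = C * (real R ^ t) ^ (k * (k + 1))"
      by (simp only: C_def of_nat_power of_nat_mult power_Suc power_mult_distrib power_mult)
    finally show ?thesis by (simp add: mult_ac)
  qed
  have partial: "(\<Sum>q\<in>{1..?N J}. ?g q) \<le> ?g 1 + C * (\<Sum>t<J. ?a t)" for J
  proof (induction J)
    case (Suc J)
    have "?N J \<le> ?N (Suc J)" using R by (intro power_mono power_increasing) auto
    then have "{1..?N (Suc J)} = {1..?N J} \<union> {?N J<..?N (Suc J)}" using Npos[of J] by auto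
    then have "(\<Sum>q\<in>{1..?N (Suc J)}. ?g q) = (\<Sum>q\<in>{1..?N J}. ?g q) + (\<Sum>q\<in>{?N J<..?N (Suc J)}. ?g q)"
      by (simp only:) (rule sum.union_disjoint, auto)
    also have "\<dots> \<le> ?g 1 + C * (\<Sum>t<J. ?a t) + C * ?a J" using Suc block[of J] by linarith
    finally show ?case by (simp add: algebra_simps)
  qed simp
  have gpos: "0 \<le> ?g (Suc j)" for j using Vpos[of "real (Suc j)"] by simp
  have "(\<Sum>j<n. ?g (Suc j)) \<le> ?g 1 + C * suminf ?a" for n
  proof -
    have "(\<Sum>j<n. ?g (Suc j)) = (\<Sum>q\<in>{1..n}. ?g q)"
      by (rule sum.reindex_bij_witness[of _ "\<lambda>q. q - 1" Suc]) auto
    also have "\<dots> \<le> ?g 1 + C * suminf ?a"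
    proof -
      have "n < 2 ^ n" by simp
      also have "\<dots> \<le> R ^ n" using R by (intro power_mono) auto
      also have "\<dots> \<le> ?N n" using k R by (intro self_le_power) auto
      finally have "(\<Sum>q\<in>{1..n}. ?g q) \<le> (\<Sum>q\<in>{1..?N n}. ?g q)"
        by (intro sum_mono2) (auto intro!: mult_nonneg_nonneg less_imp_le[OF Vpos])
      also have "\<dots> \<le> ?g 1 + C * (\<Sum>t<n. ?a t)" by (rule partial)
      also have "\<dots> \<le> ?g 1 + C * suminf ?a"
        using C sa apos by (intro add_left_mono mult_left_mono sum_le_suminf) auto
      finally show ?thesis .
    qed
    finally show ?thesis .
  qed
  then have "summable (\<lambda>j. ?g (Suc j))"
    using gpos by (intro summableI_nonneg_bounded) auto
  with div show False by simp
qed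

text \<open>The radii \<open>\<theta>\<close> may be smaller than \<open>V\<close> allows, because the
  selection below truncates them at the scale of the separation of the points.\<close>

definition rational_packing ::
    "(real \<Rightarrow> real) \<Rightarrow> nat \<Rightarrow> real ^ 'k \<Rightarrow> real \<Rightarrow> (('k \<Rightarrow> int) \<times> nat) set \<Rightarrow> (('k \<Rightarrow> int) \<times> nat \<Rightarrow> real) \<Rightarrow> bool" where
  "rational_packing V T c h S \<theta> \<longleftrightarrow> finite S \<and>
     (\<forall>a\<in>S. T \<le> snd a \<and> 0 < snd a \<and> 0 < \<theta> a \<and> \<theta> a ^ CARD('k) \<le> V (real (snd a)) \<and>
        sup_ball (rational_point a) (\<theta> a) \<subseteq> sup_ball c h) \<and>
     disjoint_family_on (\<lambda>a. sup_ball (rational_point a) (\<theta> a)) S"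

text \<open>Go through the scales \<open>Q = R ^ t\<close> and add, at each scale, all points of a separated
  set whose cubes avoid those chosen before. An earlier cube of radius \<open>\<theta>\<close> rules out at
  most about \<open>(\<theta> / \<rho>) ^ k\<close> points plus a constant. The first contributions add up to
  the volume chosen so far, divided by \<open>\<rho> ^ k\<close>; they are a small proportion as long as the
  desired volume \<open>\<kappa>\<close> is not reached. The second ones add up to the number of earlier
  cubes, which is small compared to the number of new points since the latter grows geometrically with large
  ratio \<open>B\<close>. So at least half of the points survive at each scale, and divergence forces the
  process to reach the volume \<open>\<kappa>\<close>.\<close>

theorem disjoint_rational_balls:
  fixes V :: "real \<Rightarrow> real"
  assumes Vpos: "\<And>r. 0 < r \<Longrightarrow> 0 < V r" and Vanti: "antimono_on {0<..} V"
    and div: "\<not> summable (\<lambda>j. real (Suc j) ^ CARD('k) * V (real (Suc j)))"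
  obtains \<kappa> where "0 < \<kappa>"
    and "\<And>(c::real ^ 'k) h T. 0 < h \<Longrightarrow> h \<le> 1 \<Longrightarrow> \<exists>S \<theta>. rational_packing V T c h S \<theta> \<and>
       \<kappa> * (2 * h) ^ CARD('k) \<le> (\<Sum>a\<in>S. (2 * \<theta> a) ^ CARD('k))"
proof -
  let ?k = "CARD('k)"
  obtain c1 :: real where c1: "c1 > 0" and ubi: "\<And>(c::real ^ 'k) h T. 0 < h \<Longrightarrow> h \<le> 1 \<Longrightarrow>
     \<exists>Q0. \<forall>Q\<ge>Q0. \<exists>S. spread_rationals Q T c h S \<and> c1 * h ^ ?k * (real Q ^ (?k + 1)) ^ ?k \<le> real (card S)"
    using ubiquity[where 'k = 'k] by blast
  (* The ratio R is so large that all earlier cubes together are few compared to the new points. *)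
  define R :: nat where "R = nat \<lceil>2 + 4 * 4 ^ ?k / c1\<rceil>"
  define \<kappa> where "\<kappa> = c1 / (4 * 2 ^ ?k)"
  have \<kappa>: "0 < \<kappa>" using c1 by (simp add: \<kappa>_def)
  have Rr: "2 + 4 * 4 ^ ?k / c1 \<le> real R" unfolding R_def by linarith
  have "0 \<le> 4 * 4 ^ ?k / c1" using c1 by simp
  with Rr have R2: "2 \<le> real R" by linarith
  then have R: "2 \<le> R" by linarith
  let ?N = "\<lambda>t. (R ^ t) ^ ?k"
  define \<rho> where "\<rho> t = 1 / real (R ^ t) ^ (?k + 1)" for t
  define B where "B = real R ^ (?k * (?k + 1))"
  have \<rho>: "0 < \<rho> t" for t using R by (simp add: \<rho>_def)
  have \<rho>B: "(1 / \<rho> t) ^ ?k = B ^ t" for t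
  proof -
    have "1 / \<rho> t = (real R ^ t) ^ (?k + 1)" by (simp only: \<rho>_def) simp
    then show ?thesis by (simp only: B_def power_mult[symmetric] mult_ac)
  qed
  have RB: "real R \<le> B" unfolding B_def using R2 by (intro self_le_power) auto
  have geo: "(\<Sum>i<j. B ^ (s + i)) \<le> c1 / (4 * 4 ^ ?k) * B ^ (s + j)" for s j
  proof -
    have B1: "4 * 4 ^ ?k / c1 \<le> B - 1" "0 < B - 1" using RB Rr R2 by linarith+
    have "(\<Sum>i<j. B ^ (s + i)) = B ^ s * ((B ^ j - 1) / (B - 1))"
      using B1 by (simp add: power_add sum_distrib_left[symmetric] geometric_sum)
    also have "\<dots> \<le> B ^ s * (B ^ j / (4 * 4 ^ ?k / c1))"
      using B1 c1 by (intro mult_left_mono frac_le) auto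
    finally show ?thesis by (simp add: power_add field_simps)
  qed
  (* The truncation at \<rho> t keeps the cubes of one scale disjoint. *)
  define \<theta>0 where "\<theta>0 t = min (root ?k (V (real (?N t)))) (\<rho> t)" for t
  have VN: "0 < V (real (?N t))" for t using Vpos R by simp
  have \<theta>0: "0 < \<theta>0 t" "\<theta>0 t \<le> \<rho> t" for t using VN[of t] \<rho>[of t] by (auto simp: \<theta>0_def)
  have \<theta>0V: "\<theta>0 t ^ ?k \<le> V (real (?N t))" for t
  proof -
    have "\<theta>0 t ^ ?k \<le> root ?k (V (real (?N t))) ^ ?k"
      using \<theta>0(1)[of t] by (intro power_mono) (auto simp: \<theta>0_def)
    also have "\<dots> = V (real (?N t))" using VN[of t] by simp
    finally show ?thesis .
  qed
  define b where "b t = (\<theta>0 t / \<rho> t) ^ ?k" for t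
  have b_eq: "b t = min 1 (V (real (?N t)) * (real R ^ t) ^ (?k * (?k + 1)))" for t
  proof -
    define x where "x = root ?k (V (real (?N t)))"
    have x: "0 < x" "x ^ ?k = V (real (?N t))" using VN[of t] by (simp_all add: x_def)
    have \<theta>x: "\<theta>0 t = min x (\<rho> t)" by (simp only: \<theta>0_def x_def)
    have "b t = min 1 ((x / \<rho> t) ^ ?k)"
    proof (cases "x \<le> \<rho> t")
      case True
      then have "(x / \<rho> t) ^ ?k \<le> 1" using x \<rho>[of t] by (intro power_le_one) auto
      then show ?thesis using True by (simp add: b_def \<theta>x)
    next
      case False
      then have "1 \<le> (x / \<rho> t) ^ ?k" using \<rho>[of t] by (intro one_le_power) auto
      then show ?thesis using False \<rho>[of t] by (simp add: b_def \<theta>x min_def)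
    qed
    also have "(x / \<rho> t) ^ ?k = V (real (?N t)) * (1 / \<rho> t) ^ ?k"
      by (simp add: power_divide x(2))
    also have "(1 / \<rho> t) ^ ?k = (real R ^ t) ^ (?k * (?k + 1))"
      by (simp only: \<rho>B B_def) (simp add: power_mult[symmetric] mult_ac)
    finally show ?thesis .
  qed
  have "\<not> summable b"
    using divergent_along_powers[OF Vpos Vanti div R] by (simp add: b_eq[abs_def])
  then have unbounded: "\<exists>j. M < (\<Sum>i<j. b (s + i))" for s M
  proof (rule contrapos_np)
    assume "\<nexists>j. M < (\<Sum>i<j. b (s + i))"
    then have "summable (\<lambda>i. b (i + s))"
      using \<theta>0 \<rho> by (intro summableI_nonneg_bounded[of _ M])
        (auto simp: b_def not_less add.commute less_imp_le)
    then show "summable b" by (simp add: summable_iff_shift)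
  qed
  show thesis
  proof (rule that[OF \<kappa>])
    fix c :: "real ^ 'k" and h :: real and T :: nat
    assume h: "0 < h" "h \<le> 1"
    let ?good = "\<lambda>S \<theta>. finite S \<and>
       (\<forall>a\<in>S. T \<le> snd a \<and> 0 < snd a \<and> 0 < \<theta> a \<and> \<theta> a ^ ?k \<le> V (real (snd a)) \<and>
          sup_ball (rational_point a) (\<theta> a) \<subseteq> sup_ball c h) \<and>
       disjoint_family_on (\<lambda>a. sup_ball (rational_point a) (\<theta> a)) S"
    let ?vol = "\<lambda>S \<theta>. \<Sum>a\<in>S. (2 * \<theta> a) ^ ?k"
    obtain Q0 where Q0: "\<And>Q. Q0 \<le> Q \<Longrightarrow> \<exists>S. spread_rationals Q T c h S \<and> c1 * h ^ ?k * (real Q ^ (?k + 1)) ^ ?k \<le> real (card S)"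
      using ubi[OF h, of T c] by blast
    have level: "\<exists>S. finite S \<and> separated (2 * \<rho> (Q0 + j)) S \<and>
        (\<forall>a\<in>S. T \<le> snd a \<and> 0 < snd a \<and> snd a \<le> ?N (Q0 + j) \<and>
           sup_ball (rational_point a) (\<rho> (Q0 + j)) \<subseteq> sup_ball c h) \<and>
        c1 * h ^ ?k * B ^ (Q0 + j) \<le> real (card S)" for j
    proof -
      have "Q0 \<le> 2 ^ Q0" by (simp add: less_imp_le)
      also have "\<dots> \<le> R ^ Q0" using R by (intro power_mono) auto
      also have "\<dots> \<le> R ^ (Q0 + j)" using R by (intro power_increasing) auto
      finally obtain S where "spread_rationals (R ^ (Q0 + j)) T c h S"
        "c1 * h ^ ?k * (real (R ^ (Q0 + j)) ^ (?k + 1)) ^ ?k \<le> real (card S)"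
        using Q0 by blast
      then have S: "finite S" "separated (2 / real (R ^ (Q0 + j)) ^ (?k + 1)) S"
        "\<forall>a\<in>S. T \<le> snd a \<and> 0 < snd a \<and> snd a \<le> ?N (Q0 + j) \<and>
           sup_ball (rational_point a) (1 / real (R ^ (Q0 + j)) ^ (?k + 1)) \<subseteq> sup_ball c h"
        "c1 * h ^ ?k * (real (R ^ (Q0 + j)) ^ (?k + 1)) ^ ?k \<le> real (card S)"
        unfolding spread_rationals_def by simp_all
      have "(real (R ^ (Q0 + j)) ^ (?k + 1)) ^ ?k = B ^ (Q0 + j)"
        using \<rho>B[of "Q0 + j"] by (simp add: \<rho>_def)
      with S show ?thesis by (intro exI[of _ S]) (simp add: \<rho>_def)
    qed
    have greedy: "\<exists>S \<theta>. ?good S \<theta> \<and> card S \<le> h ^ ?k * (\<Sum>i<j. B ^ (Q0 + i)) \<and>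
        min (\<kappa> * (2 * h) ^ ?k) (c1 / 2 * (2 * h) ^ ?k * (\<Sum>i<j. b (Q0 + i))) \<le> ?vol S \<theta>" for j
    proof (induction j)
      case 0
      show ?case
        using h \<kappa> by (intro exI[of _ "{}"] exI[of _ "\<lambda>_. 1"]) (auto simp: disjoint_family_on_def min_def)
    next
      case (Suc j)
      then obtain F \<theta> where F: "?good F \<theta>" "card F \<le> h ^ ?k * (\<Sum>i<j. B ^ (Q0 + i))"
        "min (\<kappa> * (2 * h) ^ ?k) (c1 / 2 * (2 * h) ^ ?k * (\<Sum>i<j. b (Q0 + i))) \<le> ?vol F \<theta>"
        by blast
      have Bpos: "0 < B ^ (Q0 + j)" using RB R2 by simp
      have bpos: "0 \<le> b (Q0 + j)" using \<theta>0(1)[of "Q0 + j"] \<rho>[of "Q0 + j"] by (simp add: b_def)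
      show ?case
      proof (cases "\<kappa> * (2 * h) ^ ?k \<le> ?vol F \<theta>")
        case True
        have "h ^ ?k * (\<Sum>i<j. B ^ (Q0 + i)) \<le> h ^ ?k * (\<Sum>i<Suc j. B ^ (Q0 + i))"
          using h Bpos by (intro mult_left_mono) auto
        then show ?thesis using F(1,2) True
          by (intro exI[of _ F] exI[of _ \<theta>] conjI) (auto simp: min_le_iff_disj)
      next
        case False
        define t where "t = Q0 + j"
        obtain S where S: "finite S" "separated (2 * \<rho> t) S"
          "\<And>a. a \<in> S \<Longrightarrow> T \<le> snd a \<and> 0 < snd a \<and> snd a \<le> ?N t \<and> sup_ball (rational_point a) (\<rho> t) \<subseteq> sup_ball c h"
          "c1 * h ^ ?k * B ^ t \<le> real (card S)"
          using level[of j] by (auto simp: t_def)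
        let ?ball = "\<lambda>a. sup_ball (rational_point a) (\<theta>0 t)"
        define K where "K y = {a\<in>S. ?ball a \<inter> sup_ball (rational_point y) (\<theta> y) \<noteq> {}}" for y
        define S' where "S' = S - (\<Union>y\<in>F. K y)"
        have "(\<Sum>y\<in>F. real (card (K y))) \<le> (\<Sum>y\<in>F. 2 ^ ?k * (\<theta> y / \<rho> t) ^ ?k + 4 ^ ?k)"
          using F(1) unfolding K_def by (intro sum_mono card_meeting_le S(1,2) \<rho> \<theta>0) auto
        also have "\<dots> = B ^ t * ?vol F \<theta> + 4 ^ ?k * real (card F)"
          unfolding \<rho>B[symmetric]
          by (simp add: sum.distrib sum_distrib_left power_mult_distrib power_divide)
        also have "\<dots> \<le> B ^ t * (\<kappa> * (2 * h) ^ ?k) + 4 ^ ?k * (h ^ ?k * (c1 / (4 * 4 ^ ?k) * B ^ t))"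
        proof (intro add_mono mult_left_mono)
          have "h ^ ?k * (\<Sum>i<j. B ^ (Q0 + i)) \<le> h ^ ?k * (c1 / (4 * 4 ^ ?k) * B ^ t)"
            unfolding t_def using geo h by (intro mult_left_mono) auto
          then show "real (card F) \<le> h ^ ?k * (c1 / (4 * 4 ^ ?k) * B ^ t)" using F(2) by linarith
        qed (use False Bpos in \<open>auto simp: t_def\<close>)
        also have "\<dots> = c1 * h ^ ?k * B ^ t / 2"
          by (simp add: \<kappa>_def power_mult_distrib)
        finally have killed: "(\<Sum>y\<in>F. real (card (K y))) \<le> c1 * h ^ ?k * B ^ t / 2" .
        have "card (\<Union>y\<in>F. K y) \<le> (\<Sum>y\<in>F. card (K y))" using F(1) by (intro card_UN_le) auto
        then have "real (card (\<Union>y\<in>F. K y)) \<le> (\<Sum>y\<in>F. real (card (K y)))"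
          by (metis of_nat_le_iff of_nat_sum)
        moreover have "real (card S') \<ge> real (card S) - real (card (\<Union>y\<in>F. K y))"
          unfolding S'_def using diff_card_le_card_Diff[of "\<Union>y\<in>F. K y" S] S(1) F(1)
          by (auto simp: K_def)
        ultimately have cardS': "c1 / 2 * h ^ ?k * B ^ t \<le> card S'" using killed S(4) by linarith
        have finS': "finite S'" "S' \<subseteq> S" using S(1) by (auto simp: S'_def)
        have disjS: "disjoint_family_on (\<lambda>a. sup_ball (rational_point a) (\<rho> t)) S'"
          using separated_imp_disjoint[OF S(2)] finS'(2) disjoint_family_on_mono by blast
        have "(\<Sum>a\<in>S'. (2 * \<rho> t) ^ ?k) \<le> (2 * h) ^ ?k"
          using finS' S(3) \<rho>[of t] h disjS
          by (intro sum_volumes_le_of_disjoint[where c = rational_point and C = c]) auto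
        then have "card S' * (2 * \<rho> t) ^ ?k \<le> (2 * h) ^ ?k" by simp
        then have "card S' * \<rho> t ^ ?k \<le> h ^ ?k" by (simp add: power_mult_distrib)
        then have cardS'2: "card S' \<le> h ^ ?k * B ^ t"
          unfolding \<rho>B[symmetric] using \<rho>[of t] by (simp add: power_divide field_simps)
        have disjSF: "?ball a \<inter> sup_ball (rational_point y) (\<theta> y) = {}" if "a \<in> S'" "y \<in> F" for a y
          using that by (auto simp: S'_def K_def)
        have centre: "rational_point a \<in> sup_ball (rational_point a) r" if "0 < r" for a :: "('k \<Rightarrow> int) \<times> nat" and r
          using that by (simp add: sup_ball_def)
        have SF: "S' \<inter> F = {}"
          using disjSF centre[OF \<theta>0(1)] centre F(1) by blast
        define \<theta>' where "\<theta>' a = (if a \<in> S' then \<theta>0 t else \<theta> a)" for a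
        have \<theta>'F: "\<theta>' a = \<theta> a" if "a \<in> F" for a using that SF by (auto simp: \<theta>'_def)
        have \<theta>'S: "\<theta>' a = \<theta>0 t" if "a \<in> S'" for a using that by (simp add: \<theta>'_def)
        have ballS: "?ball a \<subseteq> sup_ball (rational_point a) (\<rho> t)" for a
          by (rule sup_ball_mono[OF \<theta>0(2)])
        have good: "?good (S' \<union> F) \<theta>'"
        proof (intro conjI ballI)
          show "finite (S' \<union> F)" using finS' F(1) by auto
          fix a assume a: "a \<in> S' \<union> F"
          have "V (real (?N t)) \<le> V (real (snd a))" if "a \<in> S'"
          proof -
            have "a \<in> S" using that finS'(2) by blast
            then have "real (snd a) \<le> real (?N t)" "0 < snd a" using S(3)[of a] by (simp_all only: of_nat_le_iff)
            then show ?thesis by (intro monotone_onD[OF Vanti]) auto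
          qed
          then show "\<theta>' a ^ ?k \<le> V (real (snd a))"
            using a F(1) \<theta>0V[of t] by (cases "a \<in> S'") (auto simp: \<theta>'_def)
          show "T \<le> snd a" "0 < snd a" using a F(1) finS'(2) S(3)[of a] by blast+
          show "0 < \<theta>' a" using a F(1) \<theta>0(1) by (auto simp: \<theta>'_def)
          show "sup_ball (rational_point a) (\<theta>' a) \<subseteq> sup_ball c h"
          proof (cases "a \<in> S'")
            case True
            then have "sup_ball (rational_point a) (\<rho> t) \<subseteq> sup_ball c h" using S(3) finS' by blast
            then show ?thesis using ballS[of a] \<theta>'S[OF True] by auto
          next
            case False
            then show ?thesis using a F(1) by (auto simp: \<theta>'_def)
          qed
        next
          show "disjoint_family_on (\<lambda>a. sup_ball (rational_point a) (\<theta>' a)) (S' \<union> F)"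
            unfolding disjoint_family_on_def
          proof (intro ballI impI)
            fix x y assume xy: "x \<in> S' \<union> F" "y \<in> S' \<union> F" "x \<noteq> y"
            consider "x \<in> S'" "y \<in> S'" | "x \<in> S'" "y \<in> F" | "x \<in> F" "y \<in> S'" | "x \<in> F" "y \<in> F"
              using xy by blast
            then show "sup_ball (rational_point x) (\<theta>' x) \<inter> sup_ball (rational_point y) (\<theta>' y) = {}"
            proof cases
              case 1
              then show ?thesis using disjoint_family_onD[OF disjS _ _ xy(3)] ballS[of x] ballS[of y]
                by (auto simp: \<theta>'S)
            next
              case 2 then show ?thesis using disjSF by (simp add: \<theta>'S \<theta>'F)
            next
              case 3 then show ?thesis using disjSF[of y x] by (simp add: \<theta>'S \<theta>'F Int_commute)
            next
              case 4 then show ?thesis using F(1) xy(3) by (simp add: \<theta>'F disjoint_family_on_def)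
            qed
          qed
        qed
        have card: "card (S' \<union> F) \<le> h ^ ?k * (\<Sum>i<Suc j. B ^ (Q0 + i))"
          using card_Un_le[of S' F] cardS'2 F(2) by (simp add: t_def algebra_simps)
        have "?vol (S' \<union> F) \<theta>' = (\<Sum>a\<in>S'. (2 * \<theta>' a) ^ ?k) + (\<Sum>a\<in>F. (2 * \<theta>' a) ^ ?k)"
          using finS'(1) F(1) SF by (intro sum.union_disjoint) auto
        also have "\<dots> = card S' * (2 * \<theta>0 t) ^ ?k + ?vol F \<theta>"
          by (simp add: \<theta>'S \<theta>'F)
        finally have vol: "?vol (S' \<union> F) \<theta>' = card S' * (2 * \<theta>0 t) ^ ?k + ?vol F \<theta>" .
        have "c1 / 2 * (2 * h) ^ ?k * b t = (c1 / 2 * h ^ ?k * B ^ t) * (2 * \<theta>0 t) ^ ?k"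
          by (simp add: b_def \<rho>B[symmetric] power_mult_distrib power_divide)
        also have "\<dots> \<le> card S' * (2 * \<theta>0 t) ^ ?k"
          using cardS' \<theta>0(1)[of t] by (intro mult_right_mono) auto
        finally have "c1 / 2 * (2 * h) ^ ?k * b t \<le> card S' * (2 * \<theta>0 t) ^ ?k" .
        moreover have "c1 / 2 * (2 * h) ^ ?k * (\<Sum>i<j. b (Q0 + i)) \<le> ?vol F \<theta>"
          using F(3) False by (auto simp: min_le_iff_disj)
        ultimately have "c1 / 2 * (2 * h) ^ ?k * (\<Sum>i<Suc j. b (Q0 + i)) \<le> ?vol (S' \<union> F) \<theta>'"
          unfolding vol sum.lessThan_Suc distrib_left t_def[symmetric] by linarith
        then show ?thesis using good card by (intro exI[of _ "S' \<union> F"] exI[of _ \<theta>'] conjI) (auto simp: min_le_iff_disj)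
      qed
    qed
    obtain j where j: "\<kappa> / (c1 / 2) < (\<Sum>i<j. b (Q0 + i))" using unbounded by blast
    then have "\<kappa> \<le> c1 / 2 * (\<Sum>i<j. b (Q0 + i))" using c1 by (simp add: field_simps)
    then have "\<kappa> * (2 * h) ^ ?k \<le> (c1 / 2 * (\<Sum>i<j. b (Q0 + i))) * (2 * h) ^ ?k"
      using h by (intro mult_right_mono) auto
    then have "min (\<kappa> * (2 * h) ^ ?k) (c1 / 2 * (2 * h) ^ ?k * (\<Sum>i<j. b (Q0 + i))) = \<kappa> * (2 * h) ^ ?k"
      by (simp add: mult_ac min_def)
    with greedy[of j] show "\<exists>S \<theta>. rational_packing V T c h S \<theta> \<and>
       \<kappa> * (2 * h) ^ ?k \<le> (\<Sum>a\<in>S. (2 * \<theta> a) ^ ?k)"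
      unfolding rational_packing_def by auto
  qed
qed

section \<open>Khintchine's theorem for simultaneous approximation\<close>

text \<open>A variant of the covering lemma behind gauge integrals: its cubes are described by centre and
  radius, and a gauge confines them to \<open>U\<close> and bounds their size.\<close>

lemma cube_decomposition:
  fixes A U :: "(real ^ 'k) set"
  assumes A: "A \<subseteq> U" "A \<subseteq> cbox a (\<chi> i. a $ i + l)" and U: "open U" and \<rho>: "0 < \<rho>" and l: "0 < l"
  obtains \<D> :: "((real ^ 'k) \<times> real) set" where "countable \<D>"
    "\<And>c h. (c, h) \<in> \<D> \<Longrightarrow> 0 < h \<and> h \<le> l \<and> h \<le> \<rho> \<and> sup_ball c h \<subseteq> U \<and> c \<in> cbox a (\<chi> i. a $ i + l)"
    "disjoint_family_on (\<lambda>K. sup_ball (fst K) (snd K)) \<D>"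
    "A \<subseteq> (\<Union>K\<in>\<D>. {x. \<forall>i. \<bar>x $ i - fst K $ i\<bar> \<le> snd K})"
proof -
  define b :: "real ^ 'k" where "b = (\<chi> i. a $ i + l)"
  have box: "box a b \<noteq> {}" using l by (simp add: b_def interval_ne_empty_cart)
  let ?g = "\<lambda>x. if x \<in> A then U \<inter> ball x \<rho> else UNIV"
  have gauge: "gauge ?g" using U A \<rho> by (auto simp: gauge_def)
  obtain \<K> where K: "countable \<K>" "\<Union>\<K> \<subseteq> cbox a b"
    "\<And>K. K \<in> \<K> \<Longrightarrow> interior K \<noteq> {} \<and> (\<exists>c d. K = cbox c d)"
    "pairwise (\<lambda>A B. interior A \<inter> interior B = {}) \<K>"
    "\<And>K. K \<in> \<K> \<Longrightarrow> \<exists>x \<in> A \<inter> K. K \<subseteq> ?g x"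
    "\<And>u v. cbox u v \<in> \<K> \<Longrightarrow> \<exists>n. \<forall>i \<in> Basis. v \<bullet> i - u \<bullet> i = (b \<bullet> i - a \<bullet> i) / 2^n"
    "A \<subseteq> \<Union>\<K>"
    using covering_lemma[OF _ box gauge, of A] A(2) unfolding b_def by blast
  have cube: "\<exists>c h. 0 < h \<and> h \<le> l \<and> h \<le> \<rho> \<and> K = {x. \<forall>i. \<bar>x $ i - c $ i\<bar> \<le> h} \<and> interior K = sup_ball c h"
    if KK: "K \<in> \<K>" for K
  proof -
    obtain u v where uv: "K = cbox u v" using K(3)[OF KK] by blast
    obtain n where n: "\<forall>i \<in> Basis. v \<bullet> i - u \<bullet> i = (b \<bullet> i - a \<bullet> i) / 2^n"
      using K(6) KK uv by blast
    define h :: real where "h = l / 2 / 2 ^ n"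
    have side: "v $ i - u $ i = 2 * h" for i
      using n[rule_format, of "axis i 1"] by (simp add: inner_axis b_def axis_in_Basis_iff h_def)
    have v: "v = (\<chi> i. u $ i + 2 * h)" using side by (simp add: vec_eq_iff algebra_simps)
    let ?c = "\<chi> i. u $ i + h"
    have "1 \<le> (2::real) ^ n" by (rule one_le_power) simp
    then have "1 \<le> 2 * (2::real) ^ n" by linarith
    then have h: "0 < h" "h \<le> l" using l by (simp_all add: h_def divide_le_eq)
    have Keq: "K = {x. \<forall>i. \<bar>x $ i - ?c $ i\<bar> \<le> h}"
      unfolding uv v by (auto simp: mem_box_cart abs_le_iff algebra_simps)
    have Kint: "interior K = sup_ball ?c h"
      by (simp add: uv v interior_cbox sup_ball_eq_box algebra_simps)
    obtain x where x: "K \<subseteq> ball x \<rho>" using K(5)[OF KK] by auto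
    have "u \<in> K" "v \<in> K" using h by (auto simp: uv v mem_box_cart)
    then have "dist u x < \<rho>" "dist v x < \<rho>" using x by (auto simp: dist_commute)
    then have "dist v u < 2 * \<rho>" using dist_triangle2[of v u x] by linarith
    moreover have "2 * h \<le> dist v u"
      using component_le_norm_cart[of "v - u" undefined] side[of undefined] by (simp add: dist_norm)
    ultimately have "h \<le> \<rho>" by linarith
    with h Keq Kint show ?thesis by blast
  qed
  have "\<forall>K\<in>\<K>. \<exists>p. 0 < snd p \<and> snd p \<le> l \<and> snd p \<le> \<rho> \<and>
      K = {x. \<forall>i. \<bar>x $ i - fst p $ i\<bar> \<le> snd p} \<and> interior K = sup_ball (fst p) (snd p)"
  proof
    fix K assume "K \<in> \<K>"
    from cube[OF this] obtain c h where "0 < h \<and> h \<le> l \<and> h \<le> \<rho> \<and> K = {x. \<forall>i. \<bar>x $ i - c $ i\<bar> \<le> h} \<and> interior K = sup_ball c h"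
      by (elim exE)
    then show "\<exists>p. 0 < snd p \<and> snd p \<le> l \<and> snd p \<le> \<rho> \<and>
      K = {x. \<forall>i. \<bar>x $ i - fst p $ i\<bar> \<le> snd p} \<and> interior K = sup_ball (fst p) (snd p)"
      by (intro exI[of _ "(c, h)"]) (unfold fst_conv snd_conv)
  qed
  from bchoice[OF this] obtain p where p: "\<forall>K\<in>\<K>. 0 < snd (p K) \<and> snd (p K) \<le> l \<and> snd (p K) \<le> \<rho> \<and>
      K = {x. \<forall>i. \<bar>x $ i - fst (p K) $ i\<bar> \<le> snd (p K)} \<and> interior K = sup_ball (fst (p K)) (snd (p K))" ..
  define c h where "c K = fst (p K)" and "h K = snd (p K)" for K
  have ch: "0 < h K \<and> h K \<le> l \<and> h K \<le> \<rho> \<and>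
      K = {x. \<forall>i. \<bar>x $ i - c K $ i\<bar> \<le> h K} \<and> interior K = sup_ball (c K) (h K)" if "K \<in> \<K>" for K
    unfolding c_def h_def using p that by (rule bspec)
  have Keq: "K = {x. \<forall>i. \<bar>x $ i - c K $ i\<bar> \<le> h K}" if "K \<in> \<K>" for K
    using ch[OF that] by (elim conjE)
  let ?D = "(\<lambda>K. (c K, h K)) ` \<K>"
  show thesis
  proof (rule that[of ?D])
    show "countable ?D" using K(1) by simp
    fix c' h' assume "(c', h') \<in> ?D"
    then obtain L where L: "L \<in> \<K>" "c' = c L" "h' = h L" by blast
    have "sup_ball (c L) (h L) \<subseteq> U" using ch[OF L(1)] K(5)[OF L(1)] interior_subset[of L] by auto
    moreover have "c L \<in> L"
      by (rule subsetD[OF equalityD2[OF Keq[OF L(1)]]]) (simp add: ch[OF L(1), THEN conjunct1, THEN less_imp_le])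
    ultimately show "0 < h' \<and> h' \<le> l \<and> h' \<le> \<rho> \<and> sup_ball c' h' \<subseteq> U \<and> c' \<in> cbox a (\<chi> i. a $ i + l)"
      using ch[OF L(1)] L K(2) by (auto simp: b_def)
  next
    show "disjoint_family_on (\<lambda>K. sup_ball (fst K) (snd K)) ?D"
    proof (unfold disjoint_family_on_def, intro ballI impI)
      fix x y assume "x \<in> ?D" "y \<in> ?D" "x \<noteq> y"
      then obtain L M where LM: "L \<in> \<K>" "M \<in> \<K>" "x = (c L, h L)" "y = (c M, h M)" "L \<noteq> M" by blast
      then have "interior L \<inter> interior M = {}" using K(4) by (auto simp: pairwise_def)
      then show "sup_ball (fst x) (snd x) \<inter> sup_ball (fst y) (snd y) = {}"
        using ch LM by simp
    qed
    show "A \<subseteq> (\<Union>K\<in>?D. {x. \<forall>i. \<bar>x $ i - fst K $ i\<bar> \<le> snd K})"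
    proof
      fix x assume "x \<in> A"
      then obtain L where L: "L \<in> \<K>" "x \<in> L" using K(7) by blast
      then have "x \<in> {x. \<forall>i. \<bar>x $ i - c L $ i\<bar> \<le> h L}" by (intro subsetD[OF equalityD1[OF Keq]])
      then show "x \<in> (\<Union>K\<in>?D. {x. \<forall>i. \<bar>x $ i - fst K $ i\<bar> \<le> snd K})" using L(1) by auto
    qed
  qed
qed

lemma negligible_sup_ball_boundary: "negligible {x :: real ^ 'k. (\<forall>i. \<bar>x $ i - c $ i\<bar> \<le> h) \<and> x \<notin> sup_ball c h}"
proof -
  have eq: "{x. (\<forall>i. \<bar>x $ i - c $ i\<bar> \<le> h) \<and> x \<notin> sup_ball c h}
      = cbox (\<chi> i. c $ i - h) (\<chi> i. c $ i + h) - box (\<chi> i. c $ i - h) (\<chi> i. c $ i + h)"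
    unfolding sup_ball_eq_box[symmetric] by (auto simp: mem_box_cart abs_le_iff algebra_simps)
  show ?thesis unfolding eq by (rule negligible_frontier_interval)
qed

text \<open>A substitute for the density theorem. If a bounded piece \<open>A\<close> of \<open>C\<close> had
  positive measure, enclose it in an open set \<open>U\<close> whose measure exceeds that of \<open>A\<close>
  by a factor less than \<open>1 + \<kappa>\<close>, and decompose \<open>U\<close> into cubes. In each of
  them \<open>A\<close> occupies at most the proportion \<open>1 - \<kappa>\<close>, and \<open>(1 - \<kappa>)
  * (1 + \<kappa>) < 1\<close>.\<close>

lemma sup_ball_inter_measure_bound_imp_negligible:
  fixes C :: "(real ^ 'k) set"
  assumes C: "C \<in> sets lebesgue" and \<kappa>: "0 < \<kappa>"
    and bound: "\<And>c h. 0 < h \<Longrightarrow> h \<le> 1 \<Longrightarrow> measure lebesgue (C \<inter> sup_ball c h) \<le> (1 - \<kappa>) * (2 * h) ^ CARD('k)"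
  shows "negligible C"
proof -
  have \<kappa>1: "\<kappa> \<le> 1"
  proof -
    have "0 \<le> (1 - \<kappa>) * (2 * 1) ^ CARD('k)"
      using bound[of 1 0] by (meson measure_nonneg order_trans zero_less_one order_refl)
    moreover have "0 < (2 * 1 :: real) ^ CARD('k)" by simp
    ultimately show ?thesis using mult_neg_pos[of "1 - \<kappa>" "(2 * 1) ^ CARD('k)"] by linarith
  qed
  have unit: "negligible (C \<inter> cbox a (\<chi> i. a $ i + 1))" for a :: "real ^ 'k"
  proof (rule ccontr)
    define b :: "real ^ 'k" where "b = (\<chi> i. a $ i + 1)"
    define A where "A = C \<inter> cbox a b"
    assume "\<not> negligible (C \<inter> cbox a (\<chi> i. a $ i + 1))"
    then have nonneg: "\<not> negligible A" by (simp add: A_def b_def)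
    have Am: "A \<in> lmeasurable" unfolding A_def Int_commute[of C]
      by (rule fmeasurable_Int_fmeasurable[OF lmeasurable_cbox C])
    define \<alpha> where "\<alpha> = measure lebesgue A"
    have \<alpha>: "0 < \<alpha>" using nonneg Am by (simp add: \<alpha>_def negligible_iff_measure zero_less_measure_iff)
    have "0 < \<kappa> * \<alpha>" using \<kappa> \<alpha> by simp
    then obtain U where U: "open U" "A \<subseteq> U" "U - A \<in> lmeasurable" "emeasure lebesgue (U - A) < ennreal (\<kappa> * \<alpha>)"
      using sets_lebesgue_outer_open[of A "\<kappa> * \<alpha>"] Am by (auto simp: fmeasurableD)
    have Um: "U \<in> lmeasurable"
    proof -
      have "A \<union> (U - A) = U" using U(2) by auto
      then show ?thesis using fmeasurable.Un[OF Am U(3)] by simp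
    qed
    have "measure lebesgue U = \<alpha> + measure lebesgue (U - A)"
      using measurable_measure_Diff[OF Um, of A] Am U(2) by (simp add: \<alpha>_def fmeasurableD)
    moreover have "measure lebesgue (U - A) < \<kappa> * \<alpha>"
      using U(3,4) \<open>0 < \<kappa> * \<alpha>\<close> by (simp add: emeasure_eq_measure2 ennreal_less_iff)
    ultimately have UA: "measure lebesgue U < (1 + \<kappa>) * \<alpha>" by (simp add: algebra_simps)
    obtain \<D> where D: "countable \<D>"
      "\<And>c h. (c, h) \<in> \<D> \<Longrightarrow> 0 < h \<and> h \<le> 1 \<and> h \<le> 1 \<and> sup_ball c h \<subseteq> U \<and> c \<in> cbox a (\<chi> i. a $ i + 1)"
      "disjoint_family_on (\<lambda>K. sup_ball (fst K) (snd K)) \<D>"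
      "A \<subseteq> (\<Union>K\<in>\<D>. {x. \<forall>i. \<bar>x $ i - fst K $ i\<bar> \<le> snd K})"
      using cube_decomposition[OF U(2) _ U(1) zero_less_one zero_less_one, of a] unfolding A_def b_def by blast
    define B where "B K = sup_ball (fst K) (snd K)" for K :: "(real ^ 'k) \<times> real"
    define Fr where "Fr K = {x :: real ^ 'k. (\<forall>i. \<bar>x $ i - fst K $ i\<bar> \<le> snd K) \<and> x \<notin> sup_ball (fst K) (snd K)}" for K
    have meas: "A \<inter> B K \<in> sets lebesgue" "B K \<in> sets lebesgue" for K
      using Am by (auto simp: B_def fmeasurableD lmeasurable_sup_ball)
    have piece: "emeasure lebesgue (A \<inter> B K) \<le> ennreal (1 - \<kappa>) * emeasure lebesgue (B K)" if K: "K \<in> \<D>" for K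
    proof -
      obtain c h where ch: "K = (c, h)" "0 < h" "h \<le> 1" using D(2) K by (cases K) auto
      have Cm: "C \<inter> B K \<in> lmeasurable"
        unfolding Int_commute[of C] B_def by (rule fmeasurable_Int_fmeasurable[OF lmeasurable_sup_ball C])
      have "emeasure lebesgue (A \<inter> B K) \<le> emeasure lebesgue (C \<inter> B K)"
        using Cm by (intro emeasure_mono) (auto simp: A_def fmeasurableD)
      also have "\<dots> \<le> ennreal ((1 - \<kappa>) * (2 * h) ^ CARD('k))"
        using bound[OF ch(2,3), of c] Cm by (simp add: emeasure_eq_measure2 ennreal_leI B_def ch(1))
      also have "\<dots> = ennreal (1 - \<kappa>) * emeasure lebesgue (B K)"
        using ch(2) \<kappa>1 lmeasurable_sup_ball[of c h]
        by (simp add: B_def ch(1) emeasure_eq_measure2 measure_sup_ball ennreal_mult)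
      finally show ?thesis .
    qed
    have disj: "disjoint_family_on B \<D>" using D(3) by (simp add: B_def[abs_def])
    then have disjA: "disjoint_family_on (\<lambda>K. A \<inter> B K) \<D>"
      unfolding disjoint_family_on_def by blast
    have "negligible (\<Union>K\<in>\<D>. Fr K)"
      using D(1) negligible_sup_ball_boundary by (auto simp: Fr_def intro!: negligible_countable_Union)
    then have N: "(\<Union>K\<in>\<D>. Fr K) \<in> null_sets lebesgue" by (simp add: negligible_iff_null_sets)
    have "A \<subseteq> (\<Union>K\<in>\<D>. A \<inter> B K) \<union> (\<Union>K\<in>\<D>. Fr K)"
    proof
      fix x assume x: "x \<in> A"
      then obtain K where "K \<in> \<D>" "\<forall>i. \<bar>x $ i - fst K $ i\<bar> \<le> snd K" using D(4) by blast
      then show "x \<in> (\<Union>K\<in>\<D>. A \<inter> B K) \<union> (\<Union>K\<in>\<D>. Fr K)"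
        using x unfolding B_def Fr_def by blast
    qed
    moreover have AB: "(\<Union>K\<in>\<D>. A \<inter> B K) \<in> sets lebesgue"
      using D(1) meas by (intro sets.countable_UN') auto
    ultimately have "emeasure lebesgue A \<le> emeasure lebesgue ((\<Union>K\<in>\<D>. A \<inter> B K) \<union> (\<Union>K\<in>\<D>. Fr K))"
      by (intro emeasure_mono sets.Un null_setsD2[OF N])
    also have "\<dots> = emeasure lebesgue (\<Union>K\<in>\<D>. A \<inter> B K)"
      by (rule emeasure_Un_null_set[OF AB N])
    also have "\<dots> = (\<integral>\<^sup>+K. emeasure lebesgue (A \<inter> B K) \<partial>count_space \<D>)"
      using D(1) disjA meas by (intro emeasure_UN_countable) auto
    also have "\<dots> \<le> (\<integral>\<^sup>+K. ennreal (1 - \<kappa>) * emeasure lebesgue (B K) \<partial>count_space \<D>)"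
      by (rule nn_integral_mono) (use piece in \<open>simp only: space_count_space\<close>)
    also have "\<dots> = ennreal (1 - \<kappa>) * (\<integral>\<^sup>+K. emeasure lebesgue (B K) \<partial>count_space \<D>)"
      by (intro nn_integral_cmult) auto
    also have "(\<integral>\<^sup>+K. emeasure lebesgue (B K) \<partial>count_space \<D>) = emeasure lebesgue (\<Union>K\<in>\<D>. B K)"
      using D(1) disj meas by (intro emeasure_UN_countable[symmetric]) auto
    also have "(\<Union>K\<in>\<D>. B K) \<subseteq> U" using D(2) by (force simp: B_def)
    then have "emeasure lebesgue (\<Union>K\<in>\<D>. B K) \<le> emeasure lebesgue U"
      using Um by (intro emeasure_mono) (auto simp: fmeasurableD)
    finally have "emeasure lebesgue A \<le> ennreal (1 - \<kappa>) * emeasure lebesgue U" by (simp add: mult_left_mono)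
    then have "\<alpha> \<le> (1 - \<kappa>) * measure lebesgue U"
      using Am Um \<kappa>1 by (simp add: emeasure_eq_measure2 \<alpha>_def flip: ennreal_mult)
    also have "\<dots> \<le> (1 - \<kappa>) * ((1 + \<kappa>) * \<alpha>)" using UA \<kappa>1 by (intro mult_left_mono) auto
    also have "\<dots> = \<alpha> - \<kappa> ^ 2 * \<alpha>" by (simp add: algebra_simps power2_eq_square)
    also have "\<dots> < \<alpha>" using \<kappa> \<alpha> by simp
    finally show False by simp
  qed
  have "C \<subseteq> (\<Union>z::'k \<Rightarrow> int. C \<inter> cbox (\<chi> i. of_int (z i)) (\<chi> i. (\<chi> i. of_int (z i)) $ i + 1))"
  proof
    fix x assume "x \<in> C"
    then have "x \<in> C \<inter> cbox (\<chi> i. of_int \<lfloor>x $ i\<rfloor>) (\<chi> i. (\<chi> i. of_int \<lfloor>x $ i\<rfloor>) $ i + 1)"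
      by (auto simp: mem_box_cart)
    from UN_I[where B = "\<lambda>z::'k \<Rightarrow> int. C \<inter> cbox (\<chi> i. of_int (z i)) (\<chi> i. (\<chi> i. of_int (z i)) $ i + 1)", OF UNIV_I this]
    show "x \<in> (\<Union>z::'k \<Rightarrow> int. C \<inter> cbox (\<chi> i. of_int (z i)) (\<chi> i. (\<chi> i. of_int (z i)) $ i + 1))" .
  qed
  moreover have "negligible (\<Union>z::'k \<Rightarrow> int. C \<inter> cbox (\<chi> i. of_int (z i)) (\<chi> i. (\<chi> i. of_int (z i)) $ i + 1))"
    by (intro negligible_countable_Union countable_image countableI_type) (elim imageE, simp only: unit)
  ultimately show ?thesis by (rule negligible_subset[rotated])
qed

text \<open>For each \<open>T\<close>, the packings of \<open>disjoint_rational_balls\<close> show that the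
  points without an approximation of denominator at least \<open>T\<close> leave a fixed proportion of every
  cube free.\<close>

theorem khintchine_simultaneous:
  fixes \<Theta> :: "real \<Rightarrow> real"
  assumes pos: "\<And>r. 0 < r \<Longrightarrow> 0 < \<Theta> r" and anti: "antimono_on {0<..} \<Theta>"
    and div: "\<not> summable (\<lambda>j. (real (Suc j) * \<Theta> (real (Suc j))) ^ CARD('k))"
  shows "negligible {x :: real ^ 'k. \<exists>T. \<forall>a. T \<le> snd a \<and> 0 < snd a \<longrightarrow> x \<notin> sup_ball (rational_point a) (\<Theta> (real (snd a)))}"
proof -
  let ?k = "CARD('k)"
  define E where "E T = (\<Union>a\<in>{a. T \<le> snd a \<and> 0 < snd a}. sup_ball (rational_point a :: real ^ 'k) (\<Theta> (real (snd a))))" for T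
  have Eo: "open (E T)" for T unfolding E_def by (intro open_UN ballI open_sup_ball)
  have Vpos: "0 < \<Theta> r ^ ?k" if "0 < r" for r using pos that by simp
  have Vanti: "antimono_on {0<..} (\<lambda>r. \<Theta> r ^ ?k)"
    using anti by (auto simp: monotone_on_def intro!: power_mono less_imp_le[OF pos])
  obtain \<kappa> where \<kappa>: "0 < \<kappa>"
    "\<And>(c::real ^ 'k) h T. 0 < h \<Longrightarrow> h \<le> 1 \<Longrightarrow> \<exists>S \<theta>. rational_packing (\<lambda>r. \<Theta> r ^ ?k) T c h S \<theta> \<and>
       \<kappa> * (2 * h) ^ ?k \<le> (\<Sum>a\<in>S. (2 * \<theta> a) ^ ?k)"
    using disjoint_rational_balls[OF Vpos Vanti, where 'k = 'k] div
    by (auto simp: power_mult_distrib)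
  have "negligible (- E T)" for T
  proof (rule sup_ball_inter_measure_bound_imp_negligible[OF _ \<kappa>(1)])
    show Em: "- E T \<in> sets lebesgue" using Eo[of T] by (intro sets_completionI_sets) (simp add: borel_closed closed_Compl)
    fix c :: "real ^ 'k" and h :: real assume h: "0 < h" "h \<le> 1"
    obtain S \<theta> where "rational_packing (\<lambda>r. \<Theta> r ^ ?k) T c h S \<theta>"
      "\<kappa> * (2 * h) ^ ?k \<le> (\<Sum>a\<in>S. (2 * \<theta> a) ^ ?k)"
      using \<kappa>(2)[OF h, of T c] by blast
    then have S: "finite S"
       "\<And>a. a \<in> S \<Longrightarrow> T \<le> snd a \<and> 0 < snd a \<and> 0 < \<theta> a \<and> \<theta> a ^ ?k \<le> \<Theta> (real (snd a)) ^ ?k \<and>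
          sup_ball (rational_point a) (\<theta> a) \<subseteq> sup_ball c h"
       "disjoint_family_on (\<lambda>a. sup_ball (rational_point a) (\<theta> a)) S"
       "\<kappa> * (2 * h) ^ ?k \<le> (\<Sum>a\<in>S. (2 * \<theta> a) ^ ?k)"
      unfolding rational_packing_def by blast+
    let ?A = "\<Union>a\<in>S. sup_ball (rational_point a) (\<theta> a)"
    have Am: "?A \<in> lmeasurable" using S(1) by (intro fmeasurable.finite_UN) (auto simp: lmeasurable_sup_ball)
    have "sup_ball (rational_point a) (\<theta> a) \<subseteq> E T" if a: "a \<in> S" for a
    proof -
      have "\<theta> a \<le> \<Theta> (real (snd a))"
        using S(2)[OF a] pos[of "real (snd a)"] power_mono_iff[of "\<theta> a" "\<Theta> (real (snd a))" ?k] by simp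
      then have "sup_ball (rational_point a) (\<theta> a) \<subseteq> sup_ball (rational_point a) (\<Theta> (real (snd a)))"
        by (rule sup_ball_mono)
      then show ?thesis using S(2)[OF a] unfolding E_def by blast
    qed
    then have AE: "?A \<subseteq> E T" by blast
    have Asub: "?A \<subseteq> sup_ball c h" using S(2) by blast
    have "- E T \<inter> sup_ball c h \<subseteq> sup_ball c h - ?A" using AE by blast
    then have "measure lebesgue (- E T \<inter> sup_ball c h) \<le> measure lebesgue (sup_ball c h - ?A)"
      using Am by (intro measure_mono_fmeasurable sets.Int Em fmeasurable.Diff)
        (simp_all add: lmeasurable_sup_ball fmeasurableD)
    also have "\<dots> = measure lebesgue (sup_ball c h) - measure lebesgue ?A"
      using Am Asub lmeasurable_sup_ball by (intro measurable_measure_Diff) (auto simp: fmeasurableD)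
    also have "measure lebesgue ?A = (\<Sum>a\<in>S. measure lebesgue (sup_ball (rational_point a) (\<theta> a)))"
      using S(1,3) by (subst measure_finite_Union)
        (auto simp: lmeasurable_sup_ball fmeasurableD emeasure_eq_measure2)
    also have "\<dots> = (\<Sum>a\<in>S. (2 * \<theta> a) ^ ?k)"
      using S(2) by (intro sum.cong refl measure_sup_ball) (auto intro: less_imp_le)
    finally show "measure lebesgue (- E T \<inter> sup_ball c h) \<le> (1 - \<kappa>) * (2 * h) ^ ?k"
      using S(4) h by (simp add: measure_sup_ball algebra_simps)
  qed
  then have "negligible (\<Union>T. - E T)" by (intro negligible_countable_Union) auto
  moreover have "{x :: real ^ 'k. \<exists>T. \<forall>a. T \<le> snd a \<and> 0 < snd a \<longrightarrow> x \<notin> sup_ball (rational_point a) (\<Theta> (real (snd a)))} \<subseteq> (\<Union>T. - E T)"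
    unfolding E_def by blast
  ultimately show ?thesis by (rule negligible_subset)
qed

section \<open>Covers by dyadic cubes\<close>

text \<open>The pair \<open>(s, z)\<close> stands for the dyadic cube of side \<open>1 / 2 ^ s\<close> with
  lower corner \<open>z / 2 ^ s\<close>. Inclusion of half-open dyadic cubes becomes integer division, so that
  the combinatorics below needs no topology.\<close>

definition subcube :: "nat \<times> ('i \<Rightarrow> int) \<Rightarrow> nat \<times> ('i \<Rightarrow> int) \<Rightarrow> bool" where
  "subcube D Q \<longleftrightarrow> fst Q \<le> fst D \<and> (\<forall>i. snd D i div 2 ^ (fst D - fst Q) = snd Q i)"

text \<open>The closed cube: nested closed cubes have a common point.\<close>

definition dyadic_cube :: "nat \<times> ('i::finite \<Rightarrow> int) \<Rightarrow> (real ^ 'i) set" where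
  "dyadic_cube Q = {x. \<forall>i. of_int (snd Q i) \<le> 2 ^ fst Q * x $ i \<and> 2 ^ fst Q * x $ i \<le> of_int (snd Q i) + 1}"

lemma subcube_refl: "subcube D D"
  by (simp add: subcube_def)

lemma div_power2_div_power2: "(z::int) div 2 ^ a div 2 ^ b = z div 2 ^ (a + b)"
  by (simp add: power_add zdiv_zmult2_eq)

lemma subcube_trans: "subcube D Q \<Longrightarrow> subcube Q R \<Longrightarrow> subcube D R"
  unfolding subcube_def
proof (intro conjI allI)
  fix i
  assume *: "fst Q \<le> fst D \<and> (\<forall>i. snd D i div 2 ^ (fst D - fst Q) = snd Q i)"
    "fst R \<le> fst Q \<and> (\<forall>i. snd Q i div 2 ^ (fst Q - fst R) = snd R i)"
  then show "fst R \<le> fst D" by simp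
  have "fst D - fst R = (fst D - fst Q) + (fst Q - fst R)" using * by simp
  then have "snd D i div 2 ^ (fst D - fst R) = snd D i div 2 ^ (fst D - fst Q) div 2 ^ (fst Q - fst R)"
    by (simp only: div_power2_div_power2)
  then show "snd D i div 2 ^ (fst D - fst R) = snd R i" using * by simp
qed

lemma subcube_ancestor:
  assumes "t \<le> fst D"
  shows "subcube D (t, \<lambda>i. snd D i div 2 ^ (fst D - t))"
  using assms by (simp add: subcube_def)

lemma subcube_nested:
  assumes "subcube D Q" "subcube D R" "fst R \<le> fst Q"
  shows "subcube Q R"
proof -
  have "snd Q i div 2 ^ (fst Q - fst R) = snd R i" for i
  proof -
    have "fst D - fst R = (fst D - fst Q) + (fst Q - fst R)" using assms by (simp add: subcube_def)
    then have "snd D i div 2 ^ (fst D - fst R) = snd D i div 2 ^ (fst D - fst Q) div 2 ^ (fst Q - fst R)"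
      by (simp only: div_power2_div_power2)
    then show ?thesis using assms by (simp add: subcube_def)
  qed
  then show ?thesis using assms(3) by (simp add: subcube_def)
qed

lemma subcube_same_level: "subcube D Q \<Longrightarrow> fst D = fst Q \<Longrightarrow> D = Q"
  by (auto simp: subcube_def prod_eq_iff)

lemma int_div_eq_iff: "0 < y \<Longrightarrow> x div y = z \<longleftrightarrow> z * y \<le> x \<and> x + 1 \<le> (z + 1) * y" for x y z :: int
proof
  assume y: "0 < y" and z: "x div y = z"
  have "z * y + x mod y = x" using div_mult_mod_eq[of x y] z by simp
  then show "z * y \<le> x \<and> x + 1 \<le> (z + 1) * y"
    using pos_mod_sign[OF y, of x] pos_mod_bound[OF y, of x] by (simp add: distrib_right)
next
  assume y: "0 < y" and z: "z * y \<le> x \<and> x + 1 \<le> (z + 1) * y"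
  then show "x div y = z"
    by (intro int_div_pos_eq[of x y z "x - z * y"]) (auto simp: algebra_simps)
qed

lemma dyadic_cube_mono:
  assumes "subcube D Q"
  shows "dyadic_cube D \<subseteq> dyadic_cube Q"
proof
  fix x assume x: "x \<in> dyadic_cube D"
  define e where "e = fst D - fst Q"
  have e: "fst D = fst Q + e" and z: "\<And>i. snd D i div 2 ^ e = snd Q i"
    using assms by (auto simp: subcube_def e_def)
  have "of_int (snd Q i) \<le> 2 ^ fst Q * x $ i \<and> 2 ^ fst Q * x $ i \<le> of_int (snd Q i) + 1" for i
  proof -
    have "snd Q i * 2 ^ e \<le> snd D i" "snd D i + 1 \<le> (snd Q i + 1) * 2 ^ e"
      using z[of i] int_div_eq_iff[of "2 ^ e" "snd D i" "snd Q i"] by simp_all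
    then have "real_of_int (snd Q i * 2 ^ e) \<le> real_of_int (snd D i)"
      "real_of_int (snd D i + 1) \<le> real_of_int ((snd Q i + 1) * 2 ^ e)" by (simp_all only: of_int_le_iff)
    then have "of_int (snd Q i) * 2 ^ e \<le> 2 ^ fst D * x $ i" "2 ^ fst D * x $ i \<le> (of_int (snd Q i) + 1) * 2 ^ e"
      using x by (auto simp: dyadic_cube_def intro: order_trans)
    then have "of_int (snd Q i) * 2 ^ e \<le> (2 ^ fst Q * x $ i) * 2 ^ e" "(2 ^ fst Q * x $ i) * 2 ^ e \<le> (of_int (snd Q i) + 1) * 2 ^ e"
      by (simp_all add: e power_add mult_ac)
    then show ?thesis by simp
  qed
  then show "x \<in> dyadic_cube Q" by (simp add: dyadic_cube_def)
qed

lemma compact_dyadic_cube: "compact (dyadic_cube Q)" and dyadic_cube_nonempty: "dyadic_cube Q \<noteq> {}"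
proof -
  have "dyadic_cube Q = cbox (\<chi> i. of_int (snd Q i) / 2 ^ fst Q) (\<chi> i. (of_int (snd Q i) + 1) / 2 ^ fst Q)"
    by (auto simp: dyadic_cube_def mem_box_cart field_simps)
  then show "compact (dyadic_cube Q)" by simp
  have "(\<chi> i. of_int (snd Q i) / 2 ^ fst Q) \<in> dyadic_cube Q" by (simp add: dyadic_cube_def)
  then show "dyadic_cube Q \<noteq> {}" by blast
qed

lemma subcubes_at_level:
  fixes Q :: "nat \<times> ('i::finite \<Rightarrow> int)"
  assumes "fst Q \<le> t"
  shows "finite {z. subcube (t, z) Q}" "card {z. subcube (t, z) Q} = (2 ^ (t - fst Q)) ^ CARD('i)"
proof -
  let ?e = "t - fst Q"
  have eq: "{z. subcube (t, z) Q} = {z. \<forall>i. z i \<in> {snd Q i * 2 ^ ?e..<(snd Q i + 1) * 2 ^ ?e}}"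
    using assms by (simp add: subcube_def int_div_eq_iff add1_zle_eq)
  show "finite {z. subcube (t, z) Q}" unfolding eq by (rule card_fun_constraints(2)) simp
  have c: "card {snd Q i * 2 ^ ?e..<(snd Q i + 1) * 2 ^ ?e} = 2 ^ ?e" for i
  proof -
    have "(snd Q i + 1) * 2 ^ ?e - snd Q i * 2 ^ ?e = int (2 ^ ?e)" by (simp add: algebra_simps)
    then show ?thesis by (simp only: card_atLeastLessThan_int nat_int)
  qed
  show "card {z. subcube (t, z) Q} = (2 ^ ?e) ^ CARD('i)"
    unfolding eq card_fun_constraints(1) c by simp
qed

lemma sum_infsum_disjoint_le:
  fixes g :: "'a \<Rightarrow> real"
  assumes "finite I" "g summable_on B" "\<And>x. x \<in> B \<Longrightarrow> 0 \<le> g x" "\<And>i. i \<in> I \<Longrightarrow> A i \<subseteq> B" "disjoint_family_on A I"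
  shows "(\<Sum>i\<in>I. infsum g (A i)) \<le> infsum g B"
proof -
  have "(\<Sum>i\<in>I. infsum g (A i)) = infsum g (\<Union>i\<in>I. A i)"
    using assms(1,4,5)
  proof (induction I rule: finite_induct)
    case (insert j I)
    have sub: "A j \<subseteq> B" "(\<Union>i\<in>I. A i) \<subseteq> B" using insert.prems by auto
    have "A j \<inter> (\<Union>i\<in>I. A i) = {}" using insert.prems insert.hyps by (fastforce simp: disjoint_family_on_def)
    then have "infsum g (A j \<union> (\<Union>i\<in>I. A i)) = infsum g (A j) + infsum g (\<Union>i\<in>I. A i)"
      using sub assms(2) by (intro infsum_Un_disjoint summable_on_subset_banach[OF assms(2)]) auto
    then show ?case using insert by (simp add: disjoint_family_on_def)
  qed simp
  also have "\<dots> \<le> infsum g B"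
    using assms by (intro infsum_mono2 summable_on_subset_banach[OF assms(2)]) auto
  finally show ?thesis .
qed

lemma infsum_tail_small:
  fixes g :: "'a \<Rightarrow> real" and l :: "'a \<Rightarrow> nat"
  assumes "g summable_on A" "\<And>x. x \<in> A \<Longrightarrow> 0 \<le> g x" "0 < e"
  shows "\<exists>s\<ge>s1. infsum g {x\<in>A. s < l x} < e"
proof -
  obtain F where F: "finite F" "F \<subseteq> A" "dist (sum g F) (infsum g A) \<le> e / 2"
    using infsum_finite_approximation[OF assms(1), of "e / 2"] assms(3) by auto
  define s where "s = max s1 (Max (insert 0 (l ` F)))"
  have sF: "l x \<le> s" if "x \<in> F" for x
    using that F(1) by (auto simp: s_def intro!: max.coboundedI2 Max_ge)
  have "infsum g F + infsum g {x\<in>A. s < l x} = infsum g (F \<union> {x\<in>A. s < l x})"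
    using F(2) sF by (intro infsum_Un_disjoint[symmetric] summable_on_subset_banach[OF assms(1)]) (auto simp: leD)
  also have "\<dots> \<le> infsum g A"
    using F(2) assms(2) by (intro infsum_mono2 summable_on_subset_banach[OF assms(1)] assms(1)) auto
  finally have "infsum g {x\<in>A. s < l x} \<le> infsum g A - sum g F" using F(1) by simp
  then have "infsum g {x\<in>A. s < l x} < e" using F(3) assms(3) unfolding dist_real_def by linarith
  then show ?thesis by (intro exI[of _ s]) (simp add: s_def)
qed

text \<open>The cost of a cube depends only on its level and is given by \<open>w\<close>. The first condition
  excludes that \<open>D\<close> is covered by a single member of the family.\<close>

definition deficient :: "(nat \<Rightarrow> real) \<Rightarrow> (nat \<times> ('i \<Rightarrow> int)) set \<Rightarrow> nat \<times> ('i \<Rightarrow> int) \<Rightarrow> bool" where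
  "deficient w \<Q> D \<longleftrightarrow> (\<forall>Q\<in>\<Q>. \<not> subcube D Q) \<and> infsum (\<lambda>Q. w (fst Q)) {Q\<in>\<Q>. subcube Q D} < w (fst D)"

text \<open>Here the cost of the family is compared with the volume of \<open>P\<close>. When the cost
  \<open>w\<close> per volume does not decrease with the level, this is more restrictive than deficiency for
  small \<open>\<epsilon>\<close>.\<close>

definition sparse :: "(nat \<Rightarrow> real) \<Rightarrow> real \<Rightarrow> (nat \<times> ('i::finite \<Rightarrow> int)) set \<Rightarrow> nat \<times> ('i \<Rightarrow> int) \<Rightarrow> bool" where
  "sparse w \<epsilon> \<Q> P \<longleftrightarrow> (\<forall>Q\<in>\<Q>. \<not> subcube P Q) \<and>
     infsum (\<lambda>Q. w (fst Q)) {Q\<in>\<Q>. subcube Q P} * (2 ^ fst P) ^ CARD('i) < \<epsilon>"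

text \<open>Let \<open>\<theta> < 1\<close> be the cost inside \<open>D\<close> relative to the cost of
  \<open>D\<close>. As cost per volume increases with the level, the members of level at most \<open>s\<close>
  occupy at most the proportion \<open>\<theta>\<close> of the volume of \<open>D\<close>; the cubes of level
  \<open>s\<close> outside of them keep the proportion \<open>1 - \<theta>\<close>, for every
  \<open>s\<close>. But the members of level above \<open>s\<close> form the tail of a convergent sum. So for
  large \<open>s\<close> they are cheap on average over these cubes.\<close>

lemma deficient_contains_sparse:
  fixes \<Q> :: "(nat \<times> ('i::finite \<Rightarrow> int)) set" and w :: "nat \<Rightarrow> real"
  assumes wpos: "\<And>s. 0 < w s"
    and wmono: "\<And>s t. s \<le> t \<Longrightarrow> w s * (2 ^ s) ^ CARD('i) \<le> w t * (2 ^ t) ^ CARD('i)"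
    and sum: "(\<lambda>Q. w (fst Q)) summable_on \<Q>"
    and D: "deficient w \<Q> D" and \<epsilon>: "0 < \<epsilon>"
  shows "\<exists>P. subcube P D \<and> s1 \<le> fst P \<and> sparse w \<epsilon> \<Q> P"
proof -
  let ?d = "CARD('i)"
  let ?W = "infsum (\<lambda>Q. w (fst Q))"
  define s0 where "s0 = fst D"
  define A where "A = {Q\<in>\<Q>. subcube Q D}"
  have sumA: "(\<lambda>Q. w (fst Q)) summable_on A" using sum unfolding A_def by (rule summable_on_subset_banach) auto
  define \<theta> where "\<theta> = ?W A / w s0"
  have \<theta>: "0 \<le> \<theta>" "\<theta> < 1" using D wpos[of s0]
    by (auto simp: \<theta>_def A_def s0_def deficient_def intro!: divide_nonneg_pos infsum_nonneg less_imp_le[OF wpos])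
  (* Distributed over the proportion 1 - \<theta> of the volume of D, a tail below e costs \<epsilon> per volume. *)
  define e where "e = \<epsilon> * (1 - \<theta>) / (2 ^ s0) ^ ?d"
  have e: "0 < e" using \<epsilon> \<theta> by (simp add: e_def)
  obtain s where s: "max s1 s0 \<le> s" "?W {Q\<in>A. s < fst Q} < e"
    using infsum_tail_small[OF sumA _ e, of "max s1 s0" fst] less_imp_le[OF wpos] by auto
  define L where "L = {z. subcube (s, z) D}"
  have L: "finite L" "card L = (2 ^ (s - s0)) ^ ?d"
    using subcubes_at_level[of D s] s(1) by (auto simp: L_def s0_def)
  define J where "J = {Q\<in>A. fst Q \<le> s}"
  have "J \<subseteq> (\<Union>t\<in>{s0..s}. Pair t ` {z. subcube (t, z) D})"
    by (force simp: J_def A_def s0_def subcube_def)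
  moreover have "finite (\<Union>t\<in>{s0..s}. Pair t ` {z. subcube (t, z) D})"
    by (intro finite_UN_I finite_imageI subcubes_at_level) (auto simp: s0_def)
  ultimately have finJ: "finite J" using finite_subset by blast
  define Cov where "Cov = (\<Union>Q\<in>J. {z. subcube (s, z) Q})"
  have "real (card Cov) \<le> (\<Sum>Q\<in>J. real (card {z. subcube (s, z) Q}))"
    unfolding Cov_def of_nat_sum[symmetric] of_nat_le_iff using finJ by (rule card_UN_le)
  also have "\<dots> = (\<Sum>Q\<in>J. (2 ^ (s - fst Q)) ^ ?d)"
    by (intro sum.cong refl) (simp add: subcubes_at_level J_def)
  also have "\<dots> \<le> (\<Sum>Q\<in>J. (2 ^ (s - s0)) ^ ?d * (w (fst Q) / w s0))"
  proof (rule sum_mono)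
    fix Q assume Q: "Q \<in> J"
    then have lev: "s0 \<le> fst Q" "fst Q \<le> s" by (auto simp: J_def A_def s0_def subcube_def)
    have "w s0 * (2 ^ s0) ^ ?d \<le> w (fst Q) * (2 ^ fst Q) ^ ?d" by (rule wmono[OF lev(1)])
    then have le: "w s0 * (2 ^ s0) ^ ?d * (2 ^ (s - s0)) ^ ?d * (2 ^ (s - fst Q)) ^ ?d
        \<le> w (fst Q) * (2 ^ fst Q) ^ ?d * (2 ^ (s - s0)) ^ ?d * (2 ^ (s - fst Q)) ^ ?d"
      by (intro mult_right_mono) auto
    have eq: "((2::real) ^ s) ^ ?d = (2 ^ s0) ^ ?d * (2 ^ (s - s0)) ^ ?d"
      "((2::real) ^ s) ^ ?d = (2 ^ fst Q) ^ ?d * (2 ^ (s - fst Q)) ^ ?d"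
      using lev by (simp_all flip: power_mult_distrib power_add)
    have "(w s0 * (2 ^ (s - fst Q)) ^ ?d) * (2 ^ s) ^ ?d = w s0 * (2 ^ s0) ^ ?d * (2 ^ (s - s0)) ^ ?d * (2 ^ (s - fst Q)) ^ ?d"
      by (simp only: eq(1) mult_ac)
    also note le
    also have "w (fst Q) * (2 ^ fst Q) ^ ?d * (2 ^ (s - s0)) ^ ?d * (2 ^ (s - fst Q)) ^ ?d = (w (fst Q) * (2 ^ (s - s0)) ^ ?d) * (2 ^ s) ^ ?d"
      by (simp only: eq(2) mult_ac)
    finally have "(w s0 * (2 ^ (s - fst Q)) ^ ?d) * (2 ^ s) ^ ?d \<le> (w (fst Q) * (2 ^ (s - s0)) ^ ?d) * (2 ^ s) ^ ?d" .
    then have "w s0 * (2 ^ (s - fst Q)) ^ ?d \<le> w (fst Q) * (2 ^ (s - s0)) ^ ?d" by simp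
    then show "(2 ^ (s - fst Q)) ^ ?d \<le> (2 ^ (s - s0)) ^ ?d * (w (fst Q) / w s0)"
      using wpos[of s0] by (simp add: field_simps)
  qed
  also have "\<dots> = (2 ^ (s - s0)) ^ ?d * ((\<Sum>Q\<in>J. w (fst Q)) / w s0)"
    by (simp add: sum_distrib_left sum_divide_distrib)
  also have "\<dots> \<le> (2 ^ (s - s0)) ^ ?d * \<theta>"
    unfolding \<theta>_def using finJ sumA wpos
    by (intro mult_left_mono divide_right_mono finite_sum_le_infsum) (auto simp: J_def less_imp_le)
  finally have cardCov: "real (card Cov) \<le> (2 ^ (s - s0)) ^ ?d * \<theta>" .
  define R where "R = L - Cov"
  have finCov: "finite Cov" unfolding Cov_def using finJ by (intro finite_UN_I subcubes_at_level) (auto simp: J_def)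
  have "real (card R) \<ge> real (card L) - real (card Cov)"
    unfolding R_def using diff_card_le_card_Diff[OF finCov, of L] by linarith
  then have cardR: "(2 ^ (s - s0)) ^ ?d * (1 - \<theta>) \<le> card R" using cardCov L(2) by (simp add: algebra_simps)
  have finR: "finite R" using L by (simp add: R_def)
  have uncovered: "\<not> subcube (s, z) Q" if z: "z \<in> R" and Q: "Q \<in> \<Q>" for z Q
  proof
    assume sz: "subcube (s, z) Q"
    have zD: "subcube (s, z) D" using z by (simp add: R_def L_def)
    show False
    proof (cases "s0 \<le> fst Q")
      case True
      then have "subcube Q D" using subcube_nested[OF sz zD] by (simp add: s0_def)
      then have "Q \<in> J" using sz Q by (simp add: J_def A_def subcube_def)
      then show False using sz z by (auto simp: R_def Cov_def)
    next
      case False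
      then have "subcube D Q" using subcube_nested[OF zD sz] by (simp add: s0_def)
      then show False using D Q by (auto simp: deficient_def)
    qed
  qed
  have "(\<Sum>z\<in>R. ?W {Q\<in>\<Q>. subcube Q (s, z)}) \<le> ?W {Q\<in>A. s < fst Q}"
  proof (rule sum_infsum_disjoint_le[OF finR])
    show "(\<lambda>Q. w (fst Q)) summable_on {Q\<in>A. s < fst Q}"
      using sumA by (rule summable_on_subset_banach) auto
    show "{Q\<in>\<Q>. subcube Q (s, z)} \<subseteq> {Q\<in>A. s < fst Q}" if z: "z \<in> R" for z
    proof safe
      fix t y assume Q: "(t, y) \<in> \<Q>" "subcube (t, y) (s, z)"
      have "subcube (s, z) D" using z by (simp add: R_def L_def)
      with Q(2) have "subcube (t, y) D" by (rule subcube_trans)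
      then show "(t, y) \<in> A" using Q by (simp add: A_def)
      have "t \<noteq> s"
      proof
        assume "t = s"
        then have "(t, y) = (s, z)" using subcube_same_level[OF Q(2)] by simp
        then show False using uncovered[OF z Q(1)] subcube_refl by metis
      qed
      moreover have "s \<le> t" using Q(2) by (simp add: subcube_def)
      ultimately show "s < fst (t, y)" by simp
    qed
    show "disjoint_family_on (\<lambda>z. {Q\<in>\<Q>. subcube Q (s, z)}) R"
      by (auto simp: disjoint_family_on_def subcube_def)
  qed (auto intro: less_imp_le[OF wpos])
  also have "\<dots> < e" by (rule s(2))
  also have "e = \<epsilon> / (2 ^ s) ^ ?d * ((2 ^ (s - s0)) ^ ?d * (1 - \<theta>))"
  proof -
    have "(2 ^ s0) ^ ?d * (2 ^ (s - s0)) ^ ?d = ((2::real) ^ s) ^ ?d"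
      using s(1) by (simp flip: power_mult_distrib power_add)
    then have "((2::real) ^ s) ^ ?d = (2 ^ s0) ^ ?d * (2 ^ (s - s0)) ^ ?d" by simp
    then show ?thesis unfolding e_def by simp
  qed
  also have "\<dots> \<le> \<epsilon> / (2 ^ s) ^ ?d * card R"
    using cardR \<epsilon> by (intro mult_left_mono) auto
  also have "\<dots> = (\<Sum>z\<in>R. \<epsilon> / (2 ^ s) ^ ?d)" by simp
  finally have "(\<Sum>z\<in>R. ?W {Q\<in>\<Q>. subcube Q (s, z)}) < (\<Sum>z\<in>R. \<epsilon> / (2 ^ s) ^ ?d)" .
  moreover define v where "v z = ?W {Q\<in>\<Q>. subcube Q (s, z)}" for z
  ultimately have "(\<Sum>z\<in>R. v z) < (\<Sum>z\<in>R. \<epsilon> / (2 ^ s) ^ ?d)" by simp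
  then have "\<exists>z\<in>R. v z < \<epsilon> / (2 ^ s) ^ ?d" using sum_mono[of R "\<lambda>z. \<epsilon> / (2 ^ s) ^ ?d" v] by (auto simp: not_le[symmetric])
  then obtain z where z: "z \<in> R" "?W {Q\<in>\<Q>. subcube Q (s, z)} < \<epsilon> / (2 ^ s) ^ ?d"
    unfolding v_def by blast
  then have "sparse w \<epsilon> \<Q> (s, z)"
    using uncovered[OF z(1)] by (simp add: sparse_def pos_less_divide_eq)
  then show ?thesis using z(1) s(1) by (intro exI[of _ "(s, z)"]) (auto simp: R_def L_def)
qed

text \<open>Alternating the two kinds of steps gives a sequence of deficient cubes whose levels tend to
  infinity and which shrink to \<open>x\<close>. A deficient cube lies in no member of the family; applied to
  a cube of the sequence of level at least \<open>s\<close>, this gives the last conclusion.\<close>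

theorem nested_deficient_cubes:
  fixes \<Q> :: "(nat \<times> ('i::finite \<Rightarrow> int)) set" and w :: "nat \<Rightarrow> real" and U :: "nat \<Rightarrow> (real ^ 'i) set"
  assumes wpos: "\<And>s. 0 < w s"
    and wmono: "\<And>s t. s \<le> t \<Longrightarrow> w s * (2 ^ s) ^ CARD('i) \<le> w t * (2 ^ t) ^ CARD('i)"
    and sum: "(\<lambda>Q. w (fst Q)) summable_on \<Q>"
    and D0: "deficient w \<Q> D0" and \<epsilon>: "0 < \<epsilon>"
    and step: "\<And>n P. subcube P D0 \<Longrightarrow> sparse w \<epsilon> \<Q> P \<Longrightarrow> \<exists>D. subcube D P \<and> deficient w \<Q> D \<and> dyadic_cube D \<subseteq> U n"
  shows "\<exists>x\<in>dyadic_cube D0. (\<forall>n. x \<in> U n) \<and> (\<forall>s. \<exists>z. x \<in> dyadic_cube (s, z) \<and> (s, z) \<notin> \<Q>)"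
proof -
  let ?P = "\<lambda>n D. subcube D D0 \<and> deficient w \<Q> D \<and> n \<le> fst D"
  let ?R = "\<lambda>n D D'. subcube D' D \<and> dyadic_cube D' \<subseteq> U n"
  have "\<exists>f. \<forall>n. ?P n (f n) \<and> ?R n (f n) (f (Suc n))"
  proof (rule dependent_nat_choice)
    show "\<exists>D. ?P 0 D" using D0 subcube_refl by blast
    fix D n assume D: "?P n D"
    then obtain P where P: "subcube P D" "Suc n \<le> fst P" "sparse w \<epsilon> \<Q> P"
      using deficient_contains_sparse[OF wpos wmono sum _ \<epsilon>] by blast
    then obtain D' where D': "subcube D' P" "deficient w \<Q> D'" "dyadic_cube D' \<subseteq> U n"
      using step[of P n] D subcube_trans by blast
    have "Suc n \<le> fst D'" using D'(1) P(2) by (simp add: subcube_def)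
    then show "\<exists>D'. ?P (Suc n) D' \<and> ?R n D D'"
      using D D' P subcube_trans by blast
  qed
  then obtain f where f: "\<And>n. subcube (f n) D0" "\<And>n. deficient w \<Q> (f n)" "\<And>n. n \<le> fst (f n)"
    "\<And>n. subcube (f (Suc n)) (f n)" "\<And>n. dyadic_cube (f (Suc n)) \<subseteq> U n" by blast
  have dec: "dyadic_cube (f n) \<subseteq> dyadic_cube (f m)" if "m \<le> n" for m n
    by (rule lift_Suc_antimono_le[OF _ that]) (rule dyadic_cube_mono[OF f(4)])
  have "(\<Inter>n. dyadic_cube (f n)) \<noteq> {}"
    by (rule compact_nest) (auto simp: compact_dyadic_cube dyadic_cube_nonempty dec)
  then obtain x where x: "\<And>n. x \<in> dyadic_cube (f n)" by auto
  have "x \<in> dyadic_cube D0" using x[of 0] f(1)[of 0] dyadic_cube_mono by blast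
  moreover have "x \<in> U n" for n using x[of "Suc n"] f(5)[of n] by blast
  moreover have "\<exists>z. x \<in> dyadic_cube (s, z) \<and> (s, z) \<notin> \<Q>" for s
  proof -
    have "subcube (f s) (s, \<lambda>i. snd (f s) i div 2 ^ (fst (f s) - s))" by (rule subcube_ancestor[OF f(3)])
    then show ?thesis using x[of s] f(2)[of s] dyadic_cube_mono unfolding deficient_def by blast
  qed
  ultimately show ?thesis by blast
qed

section \<open>Mass transference for planks\<close>

text \<open>The factor \<open>4\<close> leaves room for a closed dyadic cube of level \<open>t\<close> in each
  cube of radius \<open>r\<close> whose centre it contains.\<close>

lemma exists_dyadic_scale:
  assumes "0 < (r::real)" "r \<le> 1"
  shows "\<exists>t::nat. 4 / 2 ^ t \<le> r \<and> r < 8 / 2 ^ t"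
proof -
  obtain n :: nat where "4 / r < 2 ^ n" using real_arch_pow[of 2 "4 / r"] by auto
  then have n: "4 / 2 ^ n \<le> r" using assms by (simp add: field_simps)
  define t where "t = (LEAST t::nat. 4 / 2 ^ t \<le> r)"
  have t: "4 / 2 ^ t \<le> r" unfolding t_def by (rule LeastI[of "\<lambda>t. 4 / 2 ^ t \<le> r", OF n])
  then have "t \<noteq> 0" using assms by (intro notI) simp
  then obtain t' where t': "t = Suc t'" by (cases t) auto
  then have "\<not> 4 / 2 ^ t' \<le> r" using not_less_Least[of t' "\<lambda>t. 4 / 2 ^ t \<le> r"] by (simp add: t_def)
  then show ?thesis using t t' by (intro exI[of _ t]) simp
qed

lemma sup_ball_subset_imp_le:
  fixes c :: "real ^ 'k"
  assumes "sup_ball c r \<subseteq> sup_ball C R" "0 \<le> r" "0 \<le> R"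
  shows "r \<le> R"
proof -
  have "(\<Sum>a\<in>{()}. (2 * r) ^ CARD('k)) \<le> (2 * R) ^ CARD('k)"
    using assms by (intro sum_volumes_le_of_disjoint[where c = "\<lambda>_. c" and C = C]) (auto simp: disjoint_family_on_def)
  then show ?thesis using assms power_mono_iff[of "2 * r" "2 * R" "CARD('k)"] by simp
qed

text \<open>The coordinates \<open>Inl\<close> are those of the approximated point; the coordinates
  \<open>Inr\<close> are free.\<close>

definition plank :: "(real \<Rightarrow> real) \<Rightarrow> nat \<Rightarrow> (real ^ ('k::finite + 'l::finite)) set" where
  "plank \<Theta> n = {x. \<exists>a :: ('k \<Rightarrow> int) \<times> nat. n \<le> snd a \<and> 0 < snd a \<and>
     (\<forall>i. \<bar>x $ Inl i - rational_point a $ i\<bar> < \<Theta> (real (snd a)))}"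

lemma CARD_sum: "CARD('k::finite + 'l::finite) = CARD('k) + CARD('l)"
  by (metis UNIV_Plus_UNIV card_Plus finite)

lemma floor_div_power2: "\<lfloor>2 ^ (s + e) * (x::real)\<rfloor> div 2 ^ e = \<lfloor>2 ^ s * x\<rfloor>"
proof -
  have "\<lfloor>2 ^ s * x\<rfloor> = \<lfloor>(2 ^ (s + e) * x) / real_of_int (2 ^ e)\<rfloor>"
    by (simp add: power_add)
  also have "\<dots> = \<lfloor>2 ^ (s + e) * x\<rfloor> div 2 ^ e" by (rule floor_divide_real_eq_div) simp
  finally show ?thesis by simp
qed

lemma abs_diff_divide_le:
  assumes "0 < p" "y \<le> x * p" "x * p \<le> y + 1"
  shows "\<bar>x - y / p\<bar> \<le> 1 / (p :: real)"
proof -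
  have "x - y / p = (x * p - y) / p" using assms(1) by (simp add: diff_divide_distrib)
  then have "\<bar>x - y / p\<bar> = \<bar>x * p - y\<bar> / p" using assms(1) by (simp add: abs_divide)
  also have "\<dots> \<le> 1 / p" using assms by (intro divide_right_mono) auto
  finally show ?thesis .
qed

text \<open>Pack the base of \<open>P\<close> with disjoint cubes of radius \<open>\<theta> a\<close> around
  rational points \<open>a\<close>, where \<open>\<theta> a ^ k\<close> is at most about \<open>F (r
  a)\<close> for a radius \<open>r a \<le> \<Theta>\<close>. In the cube of radius \<open>r a\<close> choose a
  dyadic cube of comparable side, and consider the column of cubes \<open>D (a, y)\<close> above it. Weigh
  each of them with \<open>u\<close>, its share of the volume above the larger cube of radius \<open>\<theta>
  a\<close>; the total weight is at least \<open>\<kappa>\<close> times the volume of \<open>P\<close>.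
  Suppose that none of these cubes is deficient. Those that contain members of the family of cost at least
  \<open>w\<close> (the set \<open>T1\<close>) have weight at most a multiple of that cost. The others
  (\<open>T2\<close>) lie in members \<open>Q\<close> of the family. The packed cubes whose centres lie below
  one such \<open>Q\<close> are disjoint and have radius at most about \<open>F\<close> of the side of
  \<open>Q\<close> to the power \<open>1 / k\<close>; as this exceeds a multiple of the side, their volume is
  at most a multiple of \<open>F\<close> of the side. So the total weight is at most a constant times the cost
  of the family in \<open>P\<close>, contrary to sparseness.\<close>

lemma sparse_cube_contains_deficient:
  fixes F \<Theta> :: "real \<Rightarrow> real" and \<Q> :: "(nat \<times> ('k::finite + 'l::finite \<Rightarrow> int)) set"
  assumes Fpos: "\<And>r. 0 < r \<Longrightarrow> 0 < F r" and Fmono: "mono_on {0<..} F"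
    and Fk: "antimono_on {0<..} (\<lambda>r. F r / r ^ CARD('k))"
    and \<Theta>pos: "\<And>r. 0 < r \<Longrightarrow> 0 < \<Theta> r"
    and \<kappa>: "0 < \<kappa>"
    and balls: "\<And>(c::real ^ 'k) h T. 0 < h \<Longrightarrow> h \<le> 1 \<Longrightarrow> \<exists>S \<theta>. rational_packing (\<lambda>r. F (\<Theta> r)) T c h S \<theta> \<and>
       \<kappa> * (2 * h) ^ CARD('k) \<le> (\<Sum>a\<in>S. (2 * \<theta> a) ^ CARD('k))"
    and w: "\<And>s. w s = F (1 / 2 ^ s) / (2 ^ s) ^ CARD('l)"
    and sum: "(\<lambda>Q. w (fst Q)) summable_on \<Q>"
    and \<epsilon>: "\<epsilon> = \<kappa> / (16 ^ CARD('k) * max 1 (1 / F 1) + 4 ^ CARD('k) * (max 1 (1 / F 1) * (1 + 8 ^ CARD('k))))"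
    and P: "sparse w \<epsilon> \<Q> P"
  shows "\<exists>D. subcube D P \<and> deficient w \<Q> D \<and> dyadic_cube D \<subseteq> plank \<Theta> n"
proof (rule ccontr)
  let ?k = "CARD('k)" and ?l = "CARD('l)"
  let ?W = "infsum (\<lambda>Q. w (fst Q))"
  assume neg: "\<not> ?thesis"
  have wpos: "0 < w s" for s by (simp add: w Fpos)
  define s0 where "s0 = fst P"
  define h :: real where "h = 1 / 2 / 2 ^ s0"
  have "(1::real) \<le> 2 ^ s0" by (rule one_le_power) simp
  then have "(1::real) \<le> 2 * 2 ^ s0" by linarith
  then have h: "0 < h" "h \<le> 1" "2 * h = 1 / 2 ^ s0"
    by (simp_all add: h_def divide_le_eq)
  define c :: "real ^ 'k" where "c = (\<chi> i. (of_int (snd P (Inl i)) + 1 / 2) / 2 ^ s0)"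
  obtain S \<theta> where "rational_packing (\<lambda>r. F (\<Theta> r)) n c h S \<theta>"
    "\<kappa> * (2 * h) ^ ?k \<le> (\<Sum>a\<in>S. (2 * \<theta> a) ^ ?k)"
    using balls[OF h(1,2), of n c] by blast
  then have S: "finite S"
    "\<And>a. a \<in> S \<Longrightarrow> n \<le> snd a \<and> 0 < snd a \<and> 0 < \<theta> a \<and> \<theta> a ^ ?k \<le> F (\<Theta> (real (snd a))) \<and>
          sup_ball (rational_point a) (\<theta> a) \<subseteq> sup_ball c h"
    "disjoint_family_on (\<lambda>a. sup_ball (rational_point a) (\<theta> a)) S"
    "\<kappa> * (2 * h) ^ ?k \<le> (\<Sum>a\<in>S. (2 * \<theta> a) ^ ?k)"
    unfolding rational_packing_def by blast+
  (* \<theta> a may exceed \<Theta>, and conversely; the minimum keeps the small cube in the plank and in the packing. *)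
  define r where "r a = min (\<Theta> (real (snd a))) (\<theta> a)" for a :: "('k \<Rightarrow> int) \<times> nat"
  have \<theta>h: "0 < \<theta> a" "\<theta> a \<le> h" if "a \<in> S" for a
    using S(2)[OF that] h by (auto intro: sup_ball_subset_imp_le[of _ _ c] less_imp_le)
  have r: "0 < r a" "r a \<le> \<theta> a" "r a \<le> \<Theta> (real (snd a))" if "a \<in> S" for a
    using S(2)[OF that] \<Theta>pos by (auto simp: r_def)
  have "\<exists>t. \<forall>a\<in>S. 4 / 2 ^ t a \<le> r a \<and> r a < 8 / 2 ^ t a"
  proof (rule bchoice, rule ballI)
    fix a assume "a \<in> S"
    then have "0 < r a" "r a \<le> 1" using r[of a] \<theta>h[of a] h by auto
    then show "\<exists>t::nat. 4 / 2 ^ t \<le> r a \<and> r a < 8 / 2 ^ t" by (rule exists_dyadic_scale)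
  qed
  then obtain t :: "('k \<Rightarrow> int) \<times> nat \<Rightarrow> nat" where t: "\<And>a. a \<in> S \<Longrightarrow> 4 / 2 ^ t a \<le> r a" "\<And>a. a \<in> S \<Longrightarrow> r a < 8 / 2 ^ t a"
    by blast
  have ts0: "s0 \<le> t a" if "a \<in> S" for a
  proof -
    have "4 / 2 ^ t a \<le> 1 / 2 / (2::real) ^ s0" using t(1)[OF that] r(2)[OF that] \<theta>h(2)[OF that] by (simp add: h_def)
    then have "8 * (2::real) ^ s0 \<le> 2 ^ t a" by (simp add: field_simps)
    then have "(2::real) ^ s0 \<le> 2 ^ t a" by (smt (verit) zero_le_power)
    then show ?thesis by simp
  qed
  define z where "z a i = \<lfloor>2 ^ t a * rational_point a $ i\<rfloor>" for a :: "('k \<Rightarrow> int) \<times> nat" and i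
  define C0 where "C0 = max 1 (1 / F 1)"
  have C0: "1 \<le> C0" "1 / F 1 \<le> C0" by (auto simp: C0_def)
  have Flow: "x ^ ?k \<le> C0 * F x" if "0 < x" "x \<le> 1" for x
  proof -
    have "F 1 / 1 ^ ?k \<le> F x / x ^ ?k" using that by (intro monotone_onD[OF Fk]) auto
    then have "x ^ ?k \<le> 1 / F 1 * F x" using that Fpos[of 1] by (simp add: field_simps)
    also have "\<dots> \<le> C0 * F x" using C0(2) Fpos[OF that(1)] by (intro mult_right_mono) auto
    finally show ?thesis .
  qed
  have Fscale: "F (y * x) \<le> y ^ ?k * F x" if "0 < x" "1 \<le> y" for x y
  proof -
    have "F (y * x) / (y * x) ^ ?k \<le> F x / x ^ ?k" using that by (intro monotone_onD[OF Fk]) auto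
    then show ?thesis using that by (simp add: field_simps power_mult_distrib)
  qed
  (* The cost of the small cube, up to constants, still dominates the volume of the packed one. *)
  have \<theta>F: "\<theta> a ^ ?k \<le> C0 * 8 ^ ?k * F (1 / 2 ^ t a)" if a: "a \<in> S" for a
  proof -
    have "\<theta> a ^ ?k \<le> C0 * F (r a)"
    proof (cases "\<Theta> (real (snd a)) \<le> \<theta> a")
      case True
      then have "\<theta> a ^ ?k \<le> 1 * F (r a)" using S(2)[OF a] by (simp add: r_def min_absorb1)
      also have "\<dots> \<le> C0 * F (r a)" using C0 Fpos[OF r(1)[OF a]] by (intro mult_right_mono) auto
      finally show ?thesis .
    next
      case False
      then have "r a = \<theta> a" by (simp add: r_def)
      then show ?thesis using Flow[of "\<theta> a"] \<theta>h[OF a] h(2) by simp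
    qed
    also have "F (r a) \<le> F (8 * (1 / 2 ^ t a))"
      using r(1)[OF a] t(2)[OF a] by (intro mono_onD[OF Fmono]) auto
    also have "\<dots> \<le> 8 ^ ?k * F (1 / 2 ^ t a)" by (rule Fscale) auto
    finally show ?thesis using C0 by (simp add: mult_ac mult_left_mono)
  qed
  have centre: "rational_point a $ i * 2 ^ s \<le> of_int y + 1" "of_int y \<le> rational_point a $ i * 2 ^ s"
    if "\<lfloor>2 ^ s * rational_point a $ i\<rfloor> = y" for a :: "('k \<Rightarrow> int) \<times> nat" and s i y
    using that by (auto simp: mult.commute)
  have near: "\<bar>rational_point a $ i - of_int y / 2 ^ s\<bar> \<le> 1 / 2 ^ s"
    if "\<lfloor>2 ^ s * rational_point a $ i\<rfloor> = y" for a :: "('k \<Rightarrow> int) \<times> nat" and s i y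
    using centre[OF that] by (intro abs_diff_divide_le) auto
  have zfloor: "z a i div 2 ^ (t a - s) = \<lfloor>2 ^ s * rational_point a $ i\<rfloor>" if "s \<le> t a" for a s i
    using floor_div_power2[of s "t a - s" "rational_point a $ i"] that by (simp add: z_def)
  define T where "T = (SIGMA a:S. {y. subcube (t a, y) (s0, \<lambda>i. snd P (Inr i))})"
  define D where "D p = (t (fst p), case_sum (z (fst p)) (snd p))" for p :: "(('k \<Rightarrow> int) \<times> nat) \<times> ('l \<Rightarrow> int)"
  have finT: "finite T" unfolding T_def using S(1) ts0 by (intro finite_SigmaI subcubes_at_level) auto
  have DP: "subcube (D p) P" if p: "p \<in> T" for p
  proof -
    obtain a y where [simp]: "p = (a, y)" by (cases p)
    have a: "a \<in> S" and y: "subcube (t a, y) (s0, \<lambda>i. snd P (Inr i))" using p by (auto simp: T_def)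
    have "\<lfloor>2 ^ s0 * rational_point a $ i\<rfloor> = snd P (Inl i)" for i
    proof -
      have "rational_point a \<in> sup_ball (rational_point a) (\<theta> a)" using S(2)[OF a] by (simp add: sup_ball_def)
      then have "rational_point a \<in> sup_ball c h" using S(2)[OF a] by blast
      then have "\<bar>rational_point a $ i - (of_int (snd P (Inl i)) + 1 / 2) / 2 ^ s0\<bar> < 1 / 2 / 2 ^ s0"
        by (simp add: sup_ball_def c_def h_def)
      moreover have "\<bar>p * x - v\<bar> < 1 / 2" if "\<bar>x - v / p\<bar> < 1 / 2 / p" "0 < p" for x v p :: real
      proof -
        have "p * x - v = (x - v / p) * p" using that(2) by (simp add: left_diff_distrib)
        then have "\<bar>p * x - v\<bar> = \<bar>x - v / p\<bar> * p" using that(2) by (simp add: abs_mult)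
        then show ?thesis using that by (simp add: pos_less_divide_eq)
      qed
      ultimately have "\<bar>2 ^ s0 * rational_point a $ i - (of_int (snd P (Inl i)) + 1 / 2)\<bar> < 1 / 2"
        by simp
      then show ?thesis by linarith
    qed
    then have "z a i div 2 ^ (t a - s0) = snd P (Inl i)" for i using zfloor[OF ts0[OF a]] by simp
    then show ?thesis using y ts0[OF a] by (auto simp: subcube_def D_def s0_def split: sum.split)
  qed
  have D_plank: "dyadic_cube (D p) \<subseteq> plank \<Theta> n" if p: "p \<in> T" for p
  proof
    fix x assume x: "x \<in> dyadic_cube (D p)"
    define a where "a = fst p"
    have a: "a \<in> S" using p by (auto simp: T_def a_def)
    have "\<bar>x $ Inl i - rational_point a $ i\<bar> < \<Theta> (real (snd a))" for i
    proof -
      have "of_int (z a i) \<le> 2 ^ t a * x $ Inl i \<and> 2 ^ t a * x $ Inl i \<le> of_int (z a i) + 1"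
        using x by (auto simp: dyadic_cube_def D_def a_def dest!: spec[of _ "Inl i"])
      then have "\<bar>x $ Inl i - of_int (z a i) / 2 ^ t a\<bar> \<le> 1 / 2 ^ t a"
        by (intro abs_diff_divide_le) (auto simp: mult.commute)
      moreover have "\<bar>rational_point a $ i - of_int (z a i) / 2 ^ t a\<bar> \<le> 1 / 2 ^ t a"
        by (rule near) (simp add: z_def)
      ultimately have "\<bar>x $ Inl i - rational_point a $ i\<bar> \<le> 2 * (1 / 2 ^ t a)" by linarith
      also have "\<dots> < 4 / 2 ^ t a" by (simp add: divide_strict_right_mono)
      also have "\<dots> \<le> \<Theta> (real (snd a))" using t(1)[OF a] r(3)[OF a] by linarith
      finally show ?thesis .
    qed
    then show "x \<in> plank \<Theta> n" using S(2)[OF a] unfolding plank_def by blast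
  qed
  (* Cubes attached to different members of the family are disjoint. *)
  have same: "a = b" if a: "a \<in> S" and b: "b \<in> S" and tab: "t b \<le> t a"
    and eq: "\<And>i. z a i div 2 ^ (t a - t b) = z b i" for a b
  proof (rule ccontr)
    assume "a \<noteq> b"
    have "\<bar>rational_point a $ i - rational_point b $ i\<bar> < \<theta> b" for i
    proof -
      have "\<lfloor>2 ^ t b * rational_point a $ i\<rfloor> = z b i" using eq[of i] zfloor[OF tab] by simp
      then have "\<bar>rational_point a $ i - of_int (z b i) / 2 ^ t b\<bar> \<le> 1 / 2 ^ t b" by (rule near)
      moreover have "\<bar>rational_point b $ i - of_int (z b i) / 2 ^ t b\<bar> \<le> 1 / 2 ^ t b"
        by (rule near) (simp add: z_def)
      ultimately have "\<bar>rational_point a $ i - rational_point b $ i\<bar> \<le> 2 * (1 / 2 ^ t b)" by linarith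
      also have "\<dots> < 4 / 2 ^ t b" by (simp add: divide_strict_right_mono)
      also have "\<dots> \<le> \<theta> b" using t(1)[OF b] r(2)[OF b] by linarith
      finally show ?thesis .
    qed
    then have "rational_point a \<in> sup_ball (rational_point b) (\<theta> b)" by (simp add: sup_ball_def)
    moreover have "rational_point a \<in> sup_ball (rational_point a) (\<theta> a)" using \<theta>h(1)[OF a] by (simp add: sup_ball_def)
    ultimately show False using disjoint_family_onD[OF S(3) a b \<open>a \<noteq> b\<close>] by blast
  qed
  have D_inj: "p = p'" if p: "p \<in> T" "p' \<in> T" "subcube (D p) (D p')" for p p'
  proof -
    have "z (fst p) i div 2 ^ (t (fst p) - t (fst p')) = z (fst p') i" for i
      using p(3) by (auto simp: subcube_def D_def dest!: spec[of _ "Inl i"])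
    moreover have "t (fst p') \<le> t (fst p)" using p(3) by (simp add: subcube_def D_def)
    ultimately have "fst p = fst p'" using p(1,2) by (intro same) (auto simp: T_def)
    then have "D p = D p'" using p(3) by (intro subcube_same_level) (auto simp: D_def)
    then have "case_sum (z (fst p)) (snd p) (Inr i) = case_sum (z (fst p')) (snd p') (Inr i)" for i
      unfolding D_def by (metis snd_conv)
    then have "snd p = snd p'" by auto
    then show ?thesis using \<open>fst p = fst p'\<close> by (simp add: prod_eq_iff)
  qed
  define u where "u p = (2 * \<theta> (fst p)) ^ ?k / (2 ^ t (fst p)) ^ ?l" for p :: "(('k \<Rightarrow> int) \<times> nat) \<times> ('l \<Rightarrow> int)"
  have unit_sum: "(\<Sum>y | subcube (t a, y) (s, v). u (a, y)) = (2 * \<theta> a) ^ ?k / (2 ^ s) ^ ?l"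
    if "s \<le> t a" for a s and v :: "'l \<Rightarrow> int"
  proof -
    have "((2::real) ^ t a) ^ ?l = (2 ^ s) ^ ?l * (2 ^ (t a - s)) ^ ?l"
      using that by (simp flip: power_mult_distrib power_add)
    then show ?thesis using that by (simp add: u_def subcubes_at_level)
  qed
  have "\<kappa> / (2 ^ s0) ^ ?k / (2 ^ s0) ^ ?l \<le> (\<Sum>a\<in>S. (2 * \<theta> a) ^ ?k) / (2 ^ s0) ^ ?l"
    using S(4) unfolding h(3) by (intro divide_right_mono) (simp_all add: power_divide)
  also have "\<dots> = (\<Sum>a\<in>S. \<Sum>y | subcube (t a, y) (s0, \<lambda>i. snd P (Inr i)). u (a, y))"
    unfolding sum_divide_distrib by (intro sum.cong refl unit_sum[symmetric] ts0)
  also have "\<dots> = (\<Sum>p\<in>T. u p)"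
    unfolding T_def using S(1) ts0 by (subst sum.Sigma) (auto intro!: subcubes_at_level simp: split_def)
  finally have total: "\<kappa> / (2 ^ s0) ^ ?k / (2 ^ s0) ^ ?l \<le> (\<Sum>p\<in>T. u p)" .
  define B where "B = {Q\<in>\<Q>. subcube Q P}"
  have sumB: "(\<lambda>Q. w (fst Q)) summable_on B" using sum unfolding B_def by (rule summable_on_subset_banach) auto
  define T2 where "T2 = {p\<in>T. \<exists>Q\<in>\<Q>. subcube (D p) Q}"
  define T1 where "T1 = T - T2"
  have heavy: "w (t (fst p)) \<le> ?W {Q\<in>\<Q>. subcube Q (D p)}" if "p \<in> T1" for p
  proof -
    have "p \<in> T" "\<forall>Q\<in>\<Q>. \<not> subcube (D p) Q" using that by (auto simp: T1_def T2_def)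
    moreover have "\<not> deficient w \<Q> (D p)" using neg DP D_plank \<open>p \<in> T\<close> by blast
    ultimately show ?thesis by (simp add: deficient_def D_def)
  qed
  define K1 where "K1 = 16 ^ ?k * C0"
  have K1: "0 \<le> K1" using C0 by (simp add: K1_def)
  have "(\<Sum>p\<in>T1. u p) \<le> (\<Sum>p\<in>T1. K1 * ?W {Q\<in>\<Q>. subcube Q (D p)})"
  proof (rule sum_mono)
    fix p assume p: "p \<in> T1"
    define a where "a = fst p"
    have a: "a \<in> S" using p by (auto simp: T1_def T_def a_def)
    have "(2 * \<theta> a) ^ ?k = 2 ^ ?k * \<theta> a ^ ?k" by (rule power_mult_distrib)
    also have "\<dots> \<le> 2 ^ ?k * (C0 * 8 ^ ?k * F (1 / 2 ^ t a))" using \<theta>F[OF a] by simp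
    also have "\<dots> = (2 * 8) ^ ?k * C0 * F (1 / 2 ^ t a)" by (simp only: power_mult_distrib mult_ac)
    finally have "(2 * \<theta> a) ^ ?k \<le> K1 * F (1 / 2 ^ t a)" by (simp add: K1_def)
    then have "u p \<le> K1 * w (t a)" unfolding u_def w a_def[symmetric] by (simp add: divide_right_mono)
    also have "\<dots> \<le> K1 * ?W {Q\<in>\<Q>. subcube Q (D p)}"
      using heavy[OF p] K1 by (intro mult_left_mono) (auto simp: a_def)
    finally show "u p \<le> K1 * ?W {Q\<in>\<Q>. subcube Q (D p)}" .
  qed
  also have "\<dots> = K1 * (\<Sum>p\<in>T1. ?W {Q\<in>\<Q>. subcube Q (D p)})" by (simp add: sum_distrib_left)
  also have "\<dots> \<le> K1 * ?W B"
  proof (rule mult_left_mono[OF sum_infsum_disjoint_le K1])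
    show "finite T1" using finT by (simp add: T1_def)
    show "{Q\<in>\<Q>. subcube Q (D p)} \<subseteq> B" if "p \<in> T1" for p
      using DP[of p] that subcube_trans unfolding B_def T1_def by blast
    show "disjoint_family_on (\<lambda>p. {Q\<in>\<Q>. subcube Q (D p)}) T1"
    proof (unfold disjoint_family_on_def, intro ballI impI equals0I)
      fix p p' Q assume p: "p \<in> T1" "p' \<in> T1" "p \<noteq> p'" and Q: "Q \<in> {Q\<in>\<Q>. subcube Q (D p)} \<inter> {Q\<in>\<Q>. subcube Q (D p')}"
      then have "subcube (D p) (D p') \<or> subcube (D p') (D p)"
        using subcube_nested[of Q "D p" "D p'"] subcube_nested[of Q "D p'" "D p"] linear by blast
      then show False using D_inj p unfolding T1_def by blast
    qed
  qed (use sumB wpos in \<open>auto intro: less_imp_le\<close>)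
  finally have part1: "(\<Sum>p\<in>T1. u p) \<le> K1 * ?W B" .
  have "\<exists>q. \<forall>p\<in>T2. q p \<in> \<Q> \<and> subcube (D p) (q p)" by (rule bchoice) (auto simp: T2_def)
  then obtain q where q: "\<And>p. p \<in> T2 \<Longrightarrow> q p \<in> \<Q>" "\<And>p. p \<in> T2 \<Longrightarrow> subcube (D p) (q p)" by blast
  have finT2: "finite T2" using finT by (simp add: T2_def)
  have qB: "q ` T2 \<subseteq> B"
  proof
    fix Q assume "Q \<in> q ` T2"
    then obtain p where p: "p \<in> T2" "Q = q p" by blast
    have nPQ: "\<not> subcube P Q" using P q(1)[OF p(1)] p(2) by (auto simp: sparse_def)
    have "subcube (D p) P" "subcube (D p) Q" using DP q(2) p by (auto simp: T2_def)
    then have "subcube Q P" using nPQ subcube_nested[of "D p" Q P] subcube_nested[of "D p" P Q] linear by blast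
    then show "Q \<in> B" using q(1) p by (simp add: B_def)
  qed
  define K2 where "K2 = 4 ^ ?k * (C0 * (1 + 8 ^ ?k))"
  have K2: "0 \<le> K2" using C0 by (simp add: K2_def)
  have fibre: "(\<Sum>p | p \<in> T2 \<and> q p = Q. u p) \<le> K2 * w (fst Q)" for Q
  proof -
    define s where "s = fst Q"
    define SQ where "SQ = {a\<in>S. s \<le> t a \<and> (\<forall>i. z a i div 2 ^ (t a - s) = snd Q (Inl i))}"
    let ?Y = "\<lambda>a. {y. subcube (t a, y) (s, \<lambda>i. snd Q (Inr i))}"
    have finSQ: "finite SQ" using S(1) by (simp add: SQ_def)
    have upos: "0 \<le> u (a, y)" if "a \<in> S" for a y using \<theta>h(1)[OF that] by (simp add: u_def)
    have "(\<Sum>p | p \<in> T2 \<and> q p = Q. u p) \<le> (\<Sum>p\<in>Sigma SQ ?Y. u p)"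
    proof (rule sum_mono2)
      show "finite (Sigma SQ ?Y)" using finSQ by (intro finite_SigmaI subcubes_at_level) (auto simp: SQ_def)
      show "{p. p \<in> T2 \<and> q p = Q} \<subseteq> Sigma SQ ?Y"
      proof
        fix p assume p: "p \<in> {p. p \<in> T2 \<and> q p = Q}"
        then have sub: "subcube (D p) Q" using q(2)[of p] by auto
        have "fst p \<in> S" using p by (auto simp: T2_def T_def)
        moreover have "s \<le> t (fst p)" using sub by (simp add: subcube_def D_def s_def)
        moreover have "z (fst p) i div 2 ^ (t (fst p) - s) = snd Q (Inl i)" for i
          using sub by (auto simp: subcube_def D_def s_def dest!: spec[of _ "Inl i"])
        moreover have "snd p i div 2 ^ (t (fst p) - s) = snd Q (Inr i)" for i
          using sub by (auto simp: subcube_def D_def s_def dest!: spec[of _ "Inr i"])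
        ultimately show "p \<in> Sigma SQ ?Y" by (cases p) (simp add: SQ_def subcube_def)
      qed
    qed (auto simp: SQ_def upos)
    also have "\<dots> = (\<Sum>a\<in>SQ. \<Sum>y\<in>?Y a. u (a, y))"
      using finSQ by (subst sum.Sigma) (auto intro!: subcubes_at_level simp: split_def SQ_def)
    also have "\<dots> = (\<Sum>a\<in>SQ. (2 * \<theta> a) ^ ?k / (2 ^ s) ^ ?l)"
      by (intro sum.cong refl unit_sum) (simp add: SQ_def)
    also have "\<dots> = (\<Sum>a\<in>SQ. (2 * \<theta> a) ^ ?k) / (2 ^ s) ^ ?l" by (simp add: sum_divide_distrib)
    finally have 1: "(\<Sum>p | p \<in> T2 \<and> q p = Q. u p) \<le> (\<Sum>a\<in>SQ. (2 * \<theta> a) ^ ?k) / (2 ^ s) ^ ?l" .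
    define f where "f = F (1 / 2 ^ s)"
    have f: "0 < f" by (simp add: f_def Fpos)
    define M where "M = root ?k (C0 * 8 ^ ?k * f)"
    have M: "0 \<le> M" "M ^ ?k = C0 * 8 ^ ?k * f" using C0 f by (simp_all add: M_def)
    have \<theta>M: "\<theta> a \<le> M" if "a \<in> SQ" for a
    proof -
      have a: "a \<in> S" "s \<le> t a" using that by (auto simp: SQ_def)
      have "F (1 / 2 ^ t a) \<le> f"
        unfolding f_def using a(2) by (intro mono_onD[OF Fmono]) (auto intro!: divide_left_mono power_increasing)
      then have "C0 * 8 ^ ?k * F (1 / 2 ^ t a) \<le> C0 * 8 ^ ?k * f" using C0 by (intro mult_left_mono) auto
      with \<theta>F[OF a(1)] have "\<theta> a ^ ?k \<le> M ^ ?k" unfolding M(2) by linarith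
      then show ?thesis using \<theta>h(1)[OF a(1)] M(1) by simp
    qed
    have "(\<Sum>a\<in>SQ. (2 * \<theta> a) ^ ?k) \<le> (2 * (1 / 2 ^ s + M)) ^ ?k"
    proof (rule sum_volumes_le_of_disjoint[where c = rational_point and C = "\<chi> i. of_int (snd Q (Inl i)) / 2 ^ s"])
      show "disjoint_family_on (\<lambda>a. sup_ball (rational_point a) (\<theta> a)) SQ"
        using S(3) by (rule disjoint_family_on_mono[rotated]) (auto simp: SQ_def)
      fix a assume a: "a \<in> SQ"
      then show "0 \<le> \<theta> a" using \<theta>h(1)[of a] by (auto simp: SQ_def)
      show "sup_ball (rational_point a) (\<theta> a) \<subseteq> sup_ball (\<chi> i. of_int (snd Q (Inl i)) / 2 ^ s) (1 / 2 ^ s + M)"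
      proof
        fix x assume x: "x \<in> sup_ball (rational_point a) (\<theta> a)"
        have "\<bar>x $ i - of_int (snd Q (Inl i)) / 2 ^ s\<bar> < 1 / 2 ^ s + M" for i
        proof -
          have "\<lfloor>2 ^ s * rational_point a $ i\<rfloor> = snd Q (Inl i)" using a zfloor[of s a i] by (auto simp: SQ_def)
          then have "\<bar>rational_point a $ i - of_int (snd Q (Inl i)) / 2 ^ s\<bar> \<le> 1 / 2 ^ s" by (rule near)
          moreover have "\<bar>x $ i - rational_point a $ i\<bar> < \<theta> a" using x by (simp add: sup_ball_def)
          ultimately show ?thesis using \<theta>M[OF a] by linarith
        qed
        then show "x \<in> sup_ball (\<chi> i. of_int (snd Q (Inl i)) / 2 ^ s) (1 / 2 ^ s + M)" by (simp add: sup_ball_def)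
      qed
    qed (use finSQ M in auto)
    also have "\<dots> = 2 ^ ?k * (1 / 2 ^ s + M) ^ ?k" by (rule power_mult_distrib)
    also have "\<dots> \<le> 2 ^ ?k * (2 ^ ?k * ((1 / 2 ^ s) ^ ?k + M ^ ?k))"
      using M by (intro mult_left_mono power_add_le) auto
    also have "\<dots> \<le> 2 ^ ?k * (2 ^ ?k * (C0 * f + C0 * 8 ^ ?k * f))"
      unfolding M(2) f_def by (intro mult_left_mono add_right_mono Flow) auto
    also have "\<dots> = (2 * 2) ^ ?k * (C0 * (1 + 8 ^ ?k)) * f"
      unfolding power_mult_distrib by (simp add: algebra_simps)
    finally have "(\<Sum>a\<in>SQ. (2 * \<theta> a) ^ ?k) \<le> K2 * f" by (simp add: K2_def)
    then have "(\<Sum>a\<in>SQ. (2 * \<theta> a) ^ ?k) / (2 ^ s) ^ ?l \<le> K2 * w s"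
      unfolding w f_def by (simp add: divide_right_mono)
    with 1 show ?thesis by (simp add: s_def)
  qed
  have "(\<Sum>p\<in>T2. u p) = (\<Sum>Q\<in>q ` T2. \<Sum>p | p \<in> T2 \<and> q p = Q. u p)"
    by (rule sum.image_gen[OF finT2])
  also have "\<dots> \<le> (\<Sum>Q\<in>q ` T2. K2 * w (fst Q))" by (rule sum_mono[OF fibre])
  also have "\<dots> = K2 * (\<Sum>Q\<in>q ` T2. w (fst Q))" by (simp add: sum_distrib_left)
  also have "\<dots> \<le> K2 * ?W B"
    using finT2 qB sumB wpos K2 by (intro mult_left_mono finite_sum_le_infsum) (auto intro: less_imp_le)
  finally have part2: "(\<Sum>p\<in>T2. u p) \<le> K2 * ?W B" .
  have "(\<Sum>p\<in>T. u p) = (\<Sum>p\<in>T1. u p) + (\<Sum>p\<in>T2. u p)"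
    using finT by (subst sum.union_disjoint[symmetric]) (auto simp: T1_def T2_def intro!: sum.cong)
  then have "\<kappa> / (2 ^ s0) ^ ?k / (2 ^ s0) ^ ?l \<le> (K1 + K2) * ?W B"
    using total part1 part2 by (simp add: distrib_right)
  moreover have Kpos: "0 < K1 + K2"
    using C0 by (auto simp: K1_def K2_def intro!: add_pos_nonneg)
  moreover have "\<kappa> / K \<le> W * (A * B)" if "\<kappa> / A / B \<le> K * W" "0 < K" "0 < A" "0 < B" for A B K W
    using that by (simp add: pos_divide_le_eq mult_ac)
  ultimately have "\<kappa> / (K1 + K2) \<le> ?W B * ((2 ^ s0) ^ ?k * (2 ^ s0) ^ ?l)" by simp
  then have "\<epsilon> \<le> ?W B * (2 ^ s0) ^ CARD('k + 'l)"
    unfolding \<epsilon> K1_def K2_def C0_def CARD_sum power_add .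
  then show False using P by (simp add: sparse_def B_def s0_def)
qed

text \<open>Equivalently, covering the part of the limsup set in a dyadic cube costs at least as much as the
  cube itself.\<close>

theorem limsup_planks_meet_deficient_cube:
  fixes F \<Theta> :: "real \<Rightarrow> real" and \<Q> :: "(nat \<times> ('k::finite + 'l::finite \<Rightarrow> int)) set"
  assumes Fpos: "\<And>r. 0 < r \<Longrightarrow> 0 < F r" and Fmono: "mono_on {0<..} F"
    and Fk: "antimono_on {0<..} (\<lambda>r. F r / r ^ CARD('k))"
    and \<Theta>pos: "\<And>r. 0 < r \<Longrightarrow> 0 < \<Theta> r" and \<Theta>anti: "antimono_on {0<..} \<Theta>"
    and div: "\<not> summable (\<lambda>j. real (Suc j) ^ CARD('k) * F (\<Theta> (real (Suc j))))"
    and w: "\<And>s. w s = F (1 / 2 ^ s) / (2 ^ s) ^ CARD('l)"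
    and sum: "(\<lambda>Q. w (fst Q)) summable_on \<Q>"
    and D0: "deficient w \<Q> D0"
  shows "\<exists>x\<in>dyadic_cube D0. (\<forall>n. x \<in> plank \<Theta> n) \<and> (\<forall>s. \<exists>z. x \<in> dyadic_cube (s, z) \<and> (s, z) \<notin> \<Q>)"
proof -
  have "0 < F (\<Theta> r)" if "0 < r" for r using Fpos \<Theta>pos that by simp
  moreover have "antimono_on {0<..} (\<lambda>r. F (\<Theta> r))"
    using Fmono \<Theta>anti \<Theta>pos by (auto simp: monotone_on_def)
  ultimately obtain \<kappa> where \<kappa>: "0 < \<kappa>"
    "\<And>(c::real ^ 'k) h T. 0 < h \<Longrightarrow> h \<le> 1 \<Longrightarrow> \<exists>S \<theta>. rational_packing (\<lambda>r. F (\<Theta> r)) T c h S \<theta> \<and>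
       \<kappa> * (2 * h) ^ CARD('k) \<le> (\<Sum>a\<in>S. (2 * \<theta> a) ^ CARD('k))"
    using disjoint_rational_balls[of "\<lambda>r. F (\<Theta> r)", where 'k = 'k] div by blast
  define \<epsilon> where "\<epsilon> = \<kappa> / (16 ^ CARD('k) * max 1 (1 / F 1) + 4 ^ CARD('k) * (max 1 (1 / F 1) * (1 + 8 ^ CARD('k))))"
  have "0 < \<epsilon>" unfolding \<epsilon>_def using \<kappa>(1)
    by (intro divide_pos_pos add_pos_pos mult_pos_pos) (auto simp: max_def Fpos)
  show ?thesis
  proof (rule nested_deficient_cubes[OF _ _ sum D0 \<open>0 < \<epsilon>\<close>])
    show "0 < w s" for s by (simp add: w Fpos)
    show "w s * (2 ^ s) ^ CARD('k + 'l) \<le> w t * (2 ^ t) ^ CARD('k + 'l)" if "s \<le> t" for s t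
    proof -
      have "F (1 / 2 ^ s) / (1 / 2 ^ s) ^ CARD('k) \<le> F (1 / 2 ^ t) / (1 / 2 ^ t) ^ CARD('k)"
        using that by (intro monotone_onD[OF Fk]) (auto intro!: divide_left_mono power_increasing)
      then show ?thesis by (simp add: w CARD_sum power_add power_divide mult_ac)
    qed
    show "\<exists>D. subcube D P \<and> deficient w \<Q> D \<and> dyadic_cube D \<subseteq> plank \<Theta> n" if "sparse w \<epsilon> \<Q> P" for n P
      by (rule sparse_cube_contains_deficient[OF Fpos Fmono Fk \<Theta>pos \<kappa>(1) \<kappa>(2) w sum \<epsilon>_def that])
  qed
qed

section \<open>Hausdorff measures\<close>

text \<open>The definition indexes covers by natural numbers; in the applications other countable index sets
  are more natural.\<close>

lemma hausdorff_premeasure_le_infsum: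
  assumes A: "countable A"
    and balls: "\<And>a. a \<in> A \<Longrightarrow> \<exists>c r. 0 < r \<and> B a = ball c r \<and> diameter (B a) \<le> \<rho>"
    and X: "X \<subseteq> (\<Union>a\<in>A. B a)"
  shows "hausdorff_premeasure f \<rho> X \<le> (\<Sum>\<^sub>\<infinity>a\<in>A. ennreal (f (diameter (B a))))"
proof -
  let ?I = "to_nat_on A ` A" and ?B = "\<lambda>i. B (from_nat_into A i)"
  have inv: "from_nat_into A (to_nat_on A a) = a" if "a \<in> A" for a using A that by simp
  have "ball_cover \<rho> X ?I ?B"
    using balls X inv unfolding ball_cover_def by fastforce
  then have "hausdorff_premeasure f \<rho> X \<le> (\<Sum>\<^sub>\<infinity>i\<in>?I. ennreal (f (diameter (?B i))))"
    unfolding hausdorff_premeasure_def by (intro INF_lower2[of "(?I, ?B)"]) auto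
  also have "\<dots> = (\<Sum>\<^sub>\<infinity>a\<in>A. ennreal (f (diameter (?B (to_nat_on A a)))))"
    by (subst infsum_reindex[OF inj_on_to_nat_on[OF A]]) (simp add: o_def)
  also have "\<dots> = (\<Sum>\<^sub>\<infinity>a\<in>A. ennreal (f (diameter (B a))))" by (intro infsum_cong) (simp add: inv)
  finally show ?thesis .
qed

lemma hausdorff_premeasure_mono:
  assumes "X \<subseteq> Y"
  shows "hausdorff_premeasure f \<rho> X \<le> hausdorff_premeasure f \<rho> Y"
  unfolding hausdorff_premeasure_def
  by (rule INF_superset_mono) (use assms in \<open>fastforce simp: ball_cover_def\<close>)+

lemma hausdorff_measure_mono: "X \<subseteq> Y \<Longrightarrow> hausdorff_measure f X \<le> hausdorff_measure f Y"
  unfolding hausdorff_measure_eq_SUP by (intro SUP_mono') (rule hausdorff_premeasure_mono)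

lemma hausdorff_measure_eq_0_iff:
  "hausdorff_measure f X = 0 \<longleftrightarrow> (\<forall>\<rho>>0. hausdorff_premeasure f \<rho> X = 0)"
proof -
  have "hausdorff_measure f X = 0 \<longleftrightarrow> hausdorff_measure f X \<le> 0" by simp
  also have "\<dots> \<longleftrightarrow> (\<forall>\<rho>>0. hausdorff_premeasure f \<rho> X \<le> 0)"
    unfolding hausdorff_measure_eq_SUP SUP_le_iff by auto
  finally show ?thesis by simp
qed

lemma hausdorff_premeasure_Un_null:
  assumes N: "hausdorff_premeasure f \<rho> N = 0"
  shows "hausdorff_premeasure f \<rho> (X \<union> N) \<le> hausdorff_premeasure f \<rho> X"
  unfolding hausdorff_premeasure_def[of f \<rho> X]
proof (rule INF_greatest, clarify)
  fix I B assume cov: "ball_cover \<rho> X I B"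
  show "hausdorff_premeasure f \<rho> (X \<union> N) \<le> (\<Sum>\<^sub>\<infinity>i\<in>I. ennreal (f (diameter (B i))))"
  proof (rule ennreal_le_epsilon)
    fix e :: real assume e: "0 < e"
    have "hausdorff_premeasure f \<rho> N < ennreal e" using N e by simp
    then obtain J B' where J: "ball_cover \<rho> N J B'" "(\<Sum>\<^sub>\<infinity>i\<in>J. ennreal (f (diameter (B' i)))) < ennreal e"
      unfolding hausdorff_premeasure_def by (auto simp: INF_less_iff)
    let ?A = "Inl ` I \<union> Inr ` J" and ?B = "case_sum B B'"
    have "hausdorff_premeasure f \<rho> (X \<union> N) \<le> (\<Sum>\<^sub>\<infinity>a\<in>?A. ennreal (f (diameter (?B a))))"
    proof (rule hausdorff_premeasure_le_infsum)
      show "countable ?A" by (intro countable_Un countable_image countableI_type)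
    qed (use cov J in \<open>auto simp: ball_cover_def\<close>)
    also have "\<dots> = (\<Sum>\<^sub>\<infinity>a\<in>Inl ` I. ennreal (f (diameter (?B a)))) + (\<Sum>\<^sub>\<infinity>a\<in>Inr ` J. ennreal (f (diameter (?B a))))"
      by (rule infsum_Un_disjoint) (auto intro: nonneg_summable_on_complete)
    also have "\<dots> = (\<Sum>\<^sub>\<infinity>i\<in>I. ennreal (f (diameter (B i)))) + (\<Sum>\<^sub>\<infinity>i\<in>J. ennreal (f (diameter (B' i))))"
      by (simp add: infsum_reindex o_def)
    also have "\<dots> \<le> (\<Sum>\<^sub>\<infinity>i\<in>I. ennreal (f (diameter (B i)))) + ennreal e"
      using J(2) by (intro add_left_mono) simp
    finally show "hausdorff_premeasure f \<rho> (X \<union> N) \<le> (\<Sum>\<^sub>\<infinity>i\<in>I. ennreal (f (diameter (B i)))) + ennreal e" .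
  qed
qed

lemma hausdorff_measure_Un_null:
  assumes "hausdorff_measure f N = 0"
  shows "hausdorff_measure f (X \<union> N) \<le> hausdorff_measure f X"
  unfolding hausdorff_measure_eq_SUP
proof (rule SUP_mono)
  fix \<rho> :: real assume \<rho>: "\<rho> \<in> {0<..}"
  then have "hausdorff_premeasure f \<rho> N = 0" using assms by (simp add: hausdorff_measure_eq_0_iff)
  then show "\<exists>\<sigma>\<in>{0<..}. hausdorff_premeasure f \<rho> (X \<union> N) \<le> hausdorff_premeasure f \<sigma> X"
    using \<rho> hausdorff_premeasure_Un_null by blast
qed

lemma hausdorff_null_finite_UN:
  fixes N :: "'b \<Rightarrow> 'a::euclidean_space set"
  assumes "finite A" "\<And>a. a \<in> A \<Longrightarrow> hausdorff_measure f (N a) = 0"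
  shows "hausdorff_measure f (\<Union>a\<in>A. N a) = 0"
  using assms
proof (induction rule: finite_induct)
  case empty
  have "hausdorff_premeasure f \<rho> ({} :: 'a set) \<le> 0" for \<rho>
    using hausdorff_premeasure_le_infsum[of "{}" "\<lambda>_. {}" \<rho> "{}" f] by simp
  then show ?case by (simp add: hausdorff_measure_eq_0_iff)
next
  case (insert a A)
  have "hausdorff_measure f (N a \<union> (\<Union>a\<in>A. N a)) \<le> hausdorff_measure f (N a)"
    using insert by (intro hausdorff_measure_Un_null) auto
  then show ?case using insert by simp
qed

text \<open>Bounding finite partial sums by real numbers avoids sums in the extended reals in the
  applications.\<close>

lemma hausdorff_null_if_small_covers:
  fixes X :: "'a::euclidean_space set"
  assumes "\<And>\<rho> e. 0 < \<rho> \<Longrightarrow> 0 < e \<Longrightarrow> \<exists>(A :: 'b set) c r. countable A \<and> (\<forall>a\<in>A. 0 < r a \<and> 2 * r a \<le> \<rho>) \<and>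
     X \<subseteq> (\<Union>a\<in>A. ball (c a) (r a)) \<and> (\<forall>F. finite F \<and> F \<subseteq> A \<longrightarrow> (\<Sum>a\<in>F. f (2 * r a)) \<le> e)"
    and f: "\<And>r. 0 < r \<Longrightarrow> 0 < f r"
  shows "hausdorff_measure f X = 0"
  unfolding hausdorff_measure_eq_0_iff
proof (intro allI impI)
  fix \<rho> :: real assume \<rho>: "0 < \<rho>"
  have "hausdorff_premeasure f \<rho> X \<le> 0 + ennreal e" if e: "0 < e" for e
  proof -
    obtain A :: "'b set" and c r where "countable A \<and> (\<forall>a\<in>A. 0 < r a \<and> 2 * r a \<le> \<rho>) \<and>
        X \<subseteq> (\<Union>a\<in>A. ball (c a) (r a)) \<and> (\<forall>F. finite F \<and> F \<subseteq> A \<longrightarrow> (\<Sum>a\<in>F. f (2 * r a)) \<le> e)"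
      using assms(1)[OF \<rho> e] by (elim exE) (rule that)
    then have A: "countable A" "\<And>a. a \<in> A \<Longrightarrow> 0 < r a \<and> 2 * r a \<le> \<rho>"
      "X \<subseteq> (\<Union>a\<in>A. ball (c a) (r a))" "\<And>F. finite F \<Longrightarrow> F \<subseteq> A \<Longrightarrow> (\<Sum>a\<in>F. f (2 * r a)) \<le> e"
      by simp_all
    have diam: "diameter (ball (c a) (r a)) = 2 * r a" if "a \<in> A" for a
      using A(2)[OF that] by simp
    have "hausdorff_premeasure f \<rho> X \<le> (\<Sum>\<^sub>\<infinity>a\<in>A. ennreal (f (diameter (ball (c a) (r a)))))"
    proof (rule hausdorff_premeasure_le_infsum[OF A(1) _ A(3)])
      fix a assume a: "a \<in> A"
      show "\<exists>c' r'. 0 < r' \<and> ball (c a) (r a) = ball c' r' \<and> diameter (ball (c a) (r a)) \<le> \<rho>"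
        using A(2)[OF a] diam[OF a] by (intro exI[of _ "c a"] exI[of _ "r a"]) simp
    qed
    also have "\<dots> \<le> ennreal e"
    proof (rule infsum_le_finite_sums)
      fix F assume F: "finite F" "F \<subseteq> A"
      have "(\<Sum>a\<in>F. ennreal (f (diameter (ball (c a) (r a))))) = (\<Sum>a\<in>F. ennreal (f (2 * r a)))"
        by (rule sum.cong[OF refl]) (use F diam in \<open>simp only: subset_iff\<close>)
      also have "\<dots> = ennreal (\<Sum>a\<in>F. f (2 * r a))"
        using F A(2) f by (intro sum_ennreal) (auto intro!: less_imp_le[OF f])
      also have "\<dots> \<le> ennreal e" using A(4)[OF F] by (rule ennreal_leI)
      finally show "(\<Sum>a\<in>F. ennreal (f (diameter (ball (c a) (r a))))) \<le> ennreal e" .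
    qed (intro nonneg_summable_on_complete zero_le)
    finally show ?thesis by simp
  qed
  then have "hausdorff_premeasure f \<rho> X \<le> 0" by (rule ennreal_le_epsilon)
  then show "hausdorff_premeasure f \<rho> X = 0" by simp
qed

lemma hausdorff_cantelli:
  fixes X :: "'a::euclidean_space set" and P :: "nat \<Rightarrow> 'b set"
  assumes f: "\<And>r. 0 < r \<Longrightarrow> 0 < f r"
    and P: "\<And>k. finite (P k)" and d: "\<And>k. 0 < d k" "d \<longlonglongrightarrow> 0"
    and t: "\<And>k. real (card (P k)) * f (d k) \<le> t k" "summable t"
    and cover: "\<And>k0. X \<subseteq> (\<Union>k\<in>{k0..}. \<Union>a\<in>P k. ball (c k a) (d k / 2))"
  shows "hausdorff_measure f X = 0"
proof (rule hausdorff_null_if_small_covers[OF _ f])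
  fix \<rho> e :: real assume \<rho>: "0 < \<rho>" and e: "0 < e"
  have "\<forall>\<^sub>F k in sequentially. d k < \<rho>" using d(2) \<rho> by (rule order_tendstoD)
  then obtain k1 where k1: "\<And>k. k1 \<le> k \<Longrightarrow> d k < \<rho>" by (auto simp: eventually_sequentially)
  have tpos: "0 \<le> t k" for k
    using t(1)[of k] f[OF d(1)[of k]] by (meson mult_nonneg_nonneg of_nat_0_le_iff less_imp_le order_trans)
  obtain k2 where k2: "\<And>n. norm (\<Sum>k<n. t (k + k2)) < e"
  proof -
    have "\<forall>\<^sub>F n in sequentially. (\<Sum>i. t (i + n)) < e"
      using suminf_exist_split2[OF t(2)] e by (rule order_tendstoD)
    then obtain n where n: "(\<Sum>i. t (i + n)) < e" by (auto simp: eventually_sequentially)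
    have "norm (\<Sum>k<N. t (k + n)) < e" for N
    proof -
      have "(\<Sum>k<N. t (k + n)) \<le> (\<Sum>i. t (i + n))"
        using t(2) tpos by (intro sum_le_suminf) (auto simp: summable_iff_shift)
      then show ?thesis using n tpos by (simp add: sum_nonneg abs_of_nonneg)
    qed
    then show thesis using that by blast
  qed
  define k0 where "k0 = max k1 k2"
  define A where "A = (SIGMA k:{k0..}. P k)"
  show "\<exists>(A :: (nat \<times> 'b) set) c r. countable A \<and> (\<forall>a\<in>A. 0 < r a \<and> 2 * r a \<le> \<rho>) \<and>
     X \<subseteq> (\<Union>a\<in>A. ball (c a) (r a)) \<and> (\<forall>F. finite F \<and> F \<subseteq> A \<longrightarrow> (\<Sum>a\<in>F. f (2 * r a)) \<le> e)"
  proof (intro exI[of _ A] exI[of _ "\<lambda>(k, a). c k a"] exI[of _ "\<lambda>(k, a). d k / 2"] conjI ballI allI impI)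
    show "countable A" unfolding A_def using P by (intro countable_SIGMA) (auto intro: countable_finite)
    show "X \<subseteq> (\<Union>a\<in>A. ball ((\<lambda>(k, a). c k a) a) ((\<lambda>(k, a). d k / 2) a))"
      using cover[of k0] by (fastforce simp: A_def)
    fix F assume F: "finite F \<and> F \<subseteq> A"
    define N where "N = Suc (Max (insert k0 (fst ` F)))"
    have FN: "F \<subseteq> (SIGMA k:{k0..<N}. P k)"
    proof
      fix x assume x: "x \<in> F"
      then have "fst x \<le> Max (insert k0 (fst ` F))" using F by (intro Max_ge) auto
      moreover have "x \<in> (SIGMA k:{k0..}. P k)" using x F unfolding A_def by blast
      ultimately show "x \<in> (SIGMA k:{k0..<N}. P k)" by (cases x) (simp add: N_def)
    qed
    have "(\<Sum>a\<in>F. f (2 * (\<lambda>(k, a). d k / 2) a)) \<le> (\<Sum>a\<in>(SIGMA k:{k0..<N}. P k). f (2 * (\<lambda>(k, a). d k / 2) a))"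
      using FN P d(1) by (intro sum_mono2) (auto intro!: less_imp_le[OF f])
    also have "\<dots> = (\<Sum>k\<in>{k0..<N}. \<Sum>a\<in>P k. f (d k))"
      using P by (subst sum.Sigma) (auto simp: split_def)
    also have "\<dots> \<le> (\<Sum>k\<in>{k0..<N}. t k)" using t(1) by (intro sum_mono) simp
    also have "\<dots> \<le> (\<Sum>k\<in>{k2..<N + k2}. t k)" using tpos by (intro sum_mono2) (auto simp: k0_def)
    also have "\<dots> = (\<Sum>k<N. t (k + k2))"
      using sum.shift_bounds_nat_ivl[of t 0 k2 N] by (simp add: lessThan_atLeast0)
    also have "\<dots> \<le> e" using k2[of N] by (simp add: abs_less_iff)
    finally show "(\<Sum>a\<in>F. f (2 * (\<lambda>(k, a). d k / 2) a)) \<le> e" .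
  next
    fix a assume "a \<in> A"
    then show "0 < (\<lambda>(k, a). d k / 2) a" "2 * (\<lambda>(k, a). d k / 2) a \<le> \<rho>"
      using d(1) k1 by (auto simp: A_def k0_def less_imp_le)
  qed
qed

section \<open>The convergence case\<close>

lemma infnorm_attained: "\<exists>i. infnorm (x :: real ^ 'n) = \<bar>x $ i\<bar>"
proof -
  have "Max ((\<lambda>b. \<bar>x \<bullet> b\<bar>) ` Basis) \<in> (\<lambda>b. \<bar>x \<bullet> b\<bar>) ` (Basis :: (real ^ 'n) set)"
    by (rule Max_in) auto
  then obtain b where b: "b \<in> (Basis :: (real ^ 'n) set)" "infnorm x = \<bar>x \<bullet> b\<bar>" unfolding infnorm_Max by blast
  then obtain i where "b = axis i 1" by (auto simp: Basis_vec_def)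
  then show ?thesis using b(2) by (auto simp: inner_axis)
qed

lemma abs_component_le_infnorm: "\<bar>x $ i\<bar> \<le> infnorm (x :: real ^ 'n)"
proof -
  have "\<bar>x \<bullet> axis i 1\<bar> \<le> Max ((\<lambda>b. \<bar>x \<bullet> b\<bar>) ` (Basis :: (real ^ 'n) set))"
    by (rule Max_ge) (auto simp: axis_in_Basis_iff)
  then show ?thesis by (simp add: infnorm_Max inner_axis)
qed

lemma infnorm_less_iff: "infnorm (x :: real ^ 'n) < t \<longleftrightarrow> (\<forall>i. \<bar>x $ i\<bar> < t)"
  by (metis abs_component_le_infnorm infnorm_attained le_less_trans)

lemma finite_bounded_int_vectors: "finite {q :: real ^ 'm. (\<forall>i. q $ i \<in> \<int>) \<and> infnorm q \<le> B}"
proof (cases "0 \<le> B")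
  case True
  have "{q :: real ^ 'm. (\<forall>i. q $ i \<in> \<int>) \<and> infnorm q \<le> B} \<subseteq>
      (\<lambda>p. \<chi> i. of_int (p i)) ` {p::'m \<Rightarrow> int. \<forall>i. \<bar>of_int (p i) - (0::real^'m) $ i\<bar> < B + 1}"
  proof
    fix q :: "real ^ 'm" assume q: "q \<in> {q. (\<forall>i. q $ i \<in> \<int>) \<and> infnorm q \<le> B}"
    then have fl: "of_int \<lfloor>q $ i\<rfloor> = q $ i" for i by simp
    have "\<bar>q $ i\<bar> < B + 1" for i using abs_component_le_infnorm[of q i] q by simp
    then have "(\<lambda>i. \<lfloor>q $ i\<rfloor>) \<in> {p::'m \<Rightarrow> int. \<forall>i. \<bar>of_int (p i) - (0::real^'m) $ i\<bar> < B + 1}"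
      by (simp add: fl)
    from imageI[OF this, of "\<lambda>p. (\<chi> i. of_int (p i)) :: real ^ 'm"]
    show "q \<in> (\<lambda>p. \<chi> i. of_int (p i)) ` {p::'m \<Rightarrow> int. \<forall>i. \<bar>of_int (p i) - (0::real^'m) $ i\<bar> < B + 1}"
      by (simp only: fl vec_nth_inverse)
  qed
  moreover have "finite {p::'m \<Rightarrow> int. \<forall>i. \<bar>of_int (p i) - (0::real^'m) $ i\<bar> < B + 1}"
    using True by (intro card_int_vectors_le) simp
  ultimately show ?thesis using finite_subset by blast
next
  case False
  then have "{q :: real ^ 'm. (\<forall>i. q $ i \<in> \<int>) \<and> infnorm q \<le> B} = {}"
    using infnorm_pos_le by (auto simp: not_le intro: less_le_trans)
  then show ?thesis by (simp only: finite.emptyI)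
qed

text \<open>The Euclidean norm of the definition of Hausdorff measure is compared with the entrywise bounds
  used everywhere else.\<close>

lemma norm_matrix_le:
  fixes X :: "real ^ 'n ^ 'm"
  assumes "\<And>i l. \<bar>X $ i $ l\<bar> \<le> e"
  shows "norm X \<le> real CARD('m) * real CARD('n) * e"
proof -
  have row: "norm (X $ i) \<le> real CARD('n) * e" for i
  proof -
    have "norm (X $ i) \<le> (\<Sum>l\<in>UNIV. \<bar>X $ i $ l\<bar>)" by (rule norm_le_l1_cart)
    also have "\<dots> \<le> (\<Sum>l\<in>(UNIV::'n set). e)" by (intro sum_mono assms)
    finally show ?thesis by simp
  qed
  have "norm X \<le> (\<Sum>i\<in>UNIV. norm (X $ i))" unfolding norm_vec_def by (rule L2_set_le_sum) simp
  also have "\<dots> \<le> (\<Sum>i\<in>(UNIV::'m set). real CARD('n) * e)" by (intro sum_mono row)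
  finally show ?thesis by simp
qed

lemma prod_if_eq_UNIV:
  fixes x y :: real and j :: "'m::finite"
  shows "(\<Prod>i\<in>UNIV. if i = j then x else y) = x * y ^ (CARD('m) - 1)"
proof -
  have "(\<Prod>i\<in>UNIV. if i = j then x else y) = (if j = j then x else y) * (\<Prod>i\<in>UNIV - {j}. if i = j then x else y)"
    by (rule prod.remove) auto
  also have "(\<Prod>i\<in>UNIV - {j}. if i = j then x else y) = (\<Prod>i\<in>UNIV - {j}. y)"
    by (intro prod.cong) auto
  finally show ?thesis by (simp add: card_Diff_singleton)
qed

text \<open>For an integer vector \<open>q\<close> of norm \<open>r\<close>, attained at the entry
  \<open>j\<close>, the condition on \<open>X\<close> determines row \<open>j\<close> up to \<open>\<Psi>
  r\<close> from the other rows. With a grid of mesh \<open>\<eta>\<close>, a small multiple of \<open>\<Psi>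
  r\<close>, the other \<open>m - 1\<close> rows fall into about \<open>\<eta>\<close> to the power \<open>-
  (m - 1) n\<close> cells, and for each of them row \<open>j\<close> falls into boundedly many cells.\<close>

theorem hausdorff_measure_W0_eq_0:
  fixes \<psi> \<Psi> f :: "real \<Rightarrow> real"
  assumes \<psi>: "approximating_function \<psi>"
    and \<Psi>: "\<And>r. 0 < r \<Longrightarrow> \<Psi> r = \<psi> r / r"
    and f: "\<And>r. 0 < r \<Longrightarrow> 0 < f r"
    and sum: "summable (\<lambda>k. f (\<Psi> (real (Suc k))) / \<Psi> (real (Suc k)) ^ ((CARD('m) - 1) * CARD('n)) * real (Suc k) ^ (CARD('m) - 1))"
  shows "hausdorff_measure f (W0 \<psi> :: (real ^ 'n ^ 'm) set) = 0"
proof -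
  let ?m = "CARD('m)" and ?n = "CARD('n)"
  have \<psi>pos: "0 < \<psi> r" if "0 < r" for r using \<psi> that by (auto simp: approximating_function_def)
  define d where "d k = \<Psi> (real (Suc k))" for k
  have d: "d k = \<psi> (real (Suc k)) / real (Suc k)" for k by (simp add: d_def \<Psi>)
  have dpos: "0 < d k" for k using \<psi>pos[of "real (Suc k)"] by (simp add: d)
  have \<psi>1: "\<psi> (real (Suc k)) \<le> \<psi> 1" for k
    using \<psi> unfolding approximating_function_def by (elim conjE, intro monotone_onD[of "{0<..}" "(\<le>)" "(\<ge>)" \<psi>]) auto
  have dle: "d k \<le> \<psi> 1" for k
  proof -
    have "d k \<le> \<psi> (real (Suc k))" unfolding d using \<psi>pos[of "real (Suc k)"] by (simp add: divide_le_eq mult_le_cancel_left1)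
    then show ?thesis using \<psi>1[of k] by linarith
  qed
  have dlim: "d \<longlonglongrightarrow> 0"
  proof (rule tendsto_sandwich[of "\<lambda>_. 0" _ _ "\<lambda>k. \<psi> 1 / real (Suc k)"])
    show "(\<lambda>k. \<psi> 1 / real (Suc k)) \<longlonglongrightarrow> 0"
      using LIMSEQ_Suc[OF lim_const_over_n[of "\<psi> 1"]] .
    show "\<forall>\<^sub>F k in sequentially. d k \<le> \<psi> 1 / real (Suc k)"
      unfolding d by (intro always_eventually allI divide_right_mono \<psi>1) simp
  qed (use dpos in \<open>auto intro!: always_eventually less_imp_le\<close>)
  define K :: real where "K = 2 * real ?m * real ?n"
  have K: "0 < K" by (simp add: K_def)
  define \<eta> where "\<eta> k = d k / K" for k
  have \<eta>: "0 < \<eta> k" "d k = K * \<eta> k" for k using dpos[of k] K by (simp_all add: \<eta>_def)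
  define Q :: "nat \<Rightarrow> 'm \<Rightarrow> ('m \<Rightarrow> int) set" where
    "Q k j = {q. \<forall>i. q i \<in> (if i = j then {int (Suc k), - int (Suc k)} else {- int (Suc k)..int (Suc k)})}" for k j
  define L where "L k i j = (if i = j then K + real ?m + 2 else 1 / (2 * \<eta> k) + 2)" for k and i j :: 'm
  define A :: "nat \<Rightarrow> 'm \<Rightarrow> ('m \<times> 'n \<Rightarrow> int) set" where
    "A k j = {a. \<forall>p. a p \<in> {z. \<bar>of_int z - 0\<bar> < L k (fst p) j}}" for k j
  define P where "P k = (SIGMA j:UNIV. Q k j \<times> A k j)" for k
  define T where "T k j q a l = - (\<Sum>i\<in>UNIV - {j}. of_int (q i) / of_int (q j) * (\<eta> k * of_int (a (i, l))))"
    for k and j :: 'm and q :: "'m \<Rightarrow> int" and a :: "'m \<times> 'n \<Rightarrow> int" and l :: 'n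
  define c :: "nat \<Rightarrow> 'm \<times> ('m \<Rightarrow> int) \<times> ('m \<times> 'n \<Rightarrow> int) \<Rightarrow> real ^ 'n ^ 'm" where
    "c k = (\<lambda>(j, q, a). \<chi> i l. (if i = j then T k j q a l else 0) + \<eta> k * (of_int (a (i, l)) + 1 / 2))" for k
  have Lpos: "0 \<le> L k i j" for k i j using K \<eta>[of k] by (simp add: L_def)
  have finQ: "finite (Q k j)" for k j unfolding Q_def by (rule card_fun_constraints(2)) auto
  have finA: "finite (A k j)" for k j
    unfolding A_def by (rule card_fun_constraints(2)) (rule card_int_interval_le(1)[OF Lpos])
  have finP: "finite (P k)" for k unfolding P_def using finQ finA by auto
  have cardQ: "real (card (Q k j)) \<le> 2 * (3 * real (Suc k)) ^ (?m - 1)" for k j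
  proof -
    have "real (card (Q k j)) = (\<Prod>i\<in>UNIV. real (card (if i = j then {int (Suc k), - int (Suc k)} else {- int (Suc k)..int (Suc k)})))"
      unfolding Q_def card_fun_constraints(1) by simp
    also have "\<dots> = (\<Prod>i\<in>UNIV. if i = j then 2 else 2 * real (Suc k) + 1)"
      by (intro prod.cong refl) auto
    also have "\<dots> = 2 * (2 * real (Suc k) + 1) ^ (?m - 1)" by (rule prod_if_eq_UNIV)
    also have "\<dots> \<le> 2 * (3 * real (Suc k)) ^ (?m - 1)" by (intro mult_left_mono power_mono) auto
    finally show ?thesis .
  qed
  define c1 c2 where "c1 = 2 * (K + real ?m + 2) + 1" and "c2 = K + 5 * \<psi> 1"
  have c12: "0 \<le> c1" "0 \<le> c2" using K \<psi>pos[of 1] by (auto simp: c1_def c2_def)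
  have cardA: "real (card (A k j)) \<le> c1 ^ ?n * (c2 / d k) ^ ((?m - 1) * ?n)" for k j
  proof -
    have "real (card (A k j)) = (\<Prod>p\<in>(UNIV :: ('m \<times> 'n) set). real (card {z::int. \<bar>of_int z - 0\<bar> < L k (fst p) j}))"
      unfolding A_def card_fun_constraints(1) by simp
    also have "\<dots> \<le> (\<Prod>p\<in>(UNIV :: ('m \<times> 'n) set). if fst p = j then c1 else c2 / d k)"
    proof (intro prod_mono conjI)
      fix p :: "'m \<times> 'n"
      have "real (card {z::int. \<bar>of_int z - 0\<bar> < L k (fst p) j}) \<le> 2 * L k (fst p) j + 1"
        by (rule card_int_interval_le(2)[OF Lpos])
      also have "\<dots> \<le> (if fst p = j then c1 else c2 / d k)"
      proof (cases "fst p = j")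
        case False
        have "5 \<le> 5 * \<psi> 1 / d k" using dle[of k] dpos[of k] by (simp add: le_divide_eq)
        then show ?thesis using False dpos[of k] by (simp add: L_def c2_def \<eta>_def add_divide_distrib)
      qed (simp add: L_def c1_def)
      finally show "real (card {z::int. \<bar>of_int z - 0\<bar> < L k (fst p) j}) \<le> (if fst p = j then c1 else c2 / d k)" .
    qed simp
    also have "\<dots> = (\<Prod>i\<in>UNIV. \<Prod>l\<in>(UNIV::'n set). if i = j then c1 else c2 / d k)"
      by (simp only: prod.cartesian_product UNIV_Times_UNIV) (simp only: split_def)
    also have "\<dots> = (\<Prod>i\<in>UNIV. if i = j then c1 ^ ?n else (c2 / d k) ^ ?n)"
      by (intro prod.cong refl) auto
    also have "\<dots> = c1 ^ ?n * ((c2 / d k) ^ ?n) ^ (?m - 1)" by (rule prod_if_eq_UNIV)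
    finally show ?thesis by (simp add: power_mult[symmetric] mult.commute)
  qed
  define C where "C = real ?m * (2 * 3 ^ (?m - 1)) * (c1 ^ ?n * c2 ^ ((?m - 1) * ?n))"
  define t where "t k = C * (f (d k) / d k ^ ((?m - 1) * ?n) * real (Suc k) ^ (?m - 1))" for k
  have sumt: "summable t" unfolding t_def d_def by (intro summable_mult sum)
  have count: "real (card (P k)) * f (d k) \<le> t k" for k
  proof -
    have "real (card (P k)) = (\<Sum>j\<in>UNIV. real (card (Q k j)) * real (card (A k j)))"
      unfolding P_def using finQ finA by (subst card_SigmaI) auto
    also have "\<dots> \<le> (\<Sum>j\<in>(UNIV::'m set). (2 * (3 * real (Suc k)) ^ (?m - 1)) * (c1 ^ ?n * (c2 / d k) ^ ((?m - 1) * ?n)))"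
      by (intro sum_mono mult_mono cardQ cardA) auto
    also have "\<dots> = C / d k ^ ((?m - 1) * ?n) * real (Suc k) ^ (?m - 1)"
      unfolding C_def power_divide power_mult_distrib by simp
    finally have "real (card (P k)) * f (d k) \<le> C / d k ^ ((?m - 1) * ?n) * real (Suc k) ^ (?m - 1) * f (d k)"
      using f[OF dpos[of k]] by (intro mult_right_mono) auto
    then show ?thesis by (simp add: t_def mult_ac)
  qed
  show ?thesis
  proof (rule hausdorff_cantelli[OF f finP dpos dlim count sumt])
    fix k0
    show "(W0 \<psi> :: (real ^ 'n ^ 'm) set) \<subseteq> (\<Union>k\<in>{k0..}. \<Union>a\<in>P k. ball (c k a) (d k / 2))"
    proof
      fix X :: "real ^ 'n ^ 'm" assume X: "X \<in> W0 \<psi>"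
      have Xcube: "\<bar>X $ i $ l\<bar> \<le> 1 / 2" for i l
      proof -
        have "X $ i $ l \<in> {- 1 / 2..1 / 2}" using X by (simp add: W0_def unit_cube_def)
        then show ?thesis unfolding atLeastAtMost_iff by linarith
      qed
      have "infinite ({q :: real ^ 'm. (\<forall>i. q $ i \<in> \<int>) \<and> q \<noteq> 0 \<and> infnorm (q v* X) < \<psi> (infnorm q)}
          - {q. (\<forall>i. q $ i \<in> \<int>) \<and> infnorm q \<le> real k0})"
        using X finite_bounded_int_vectors by (intro Diff_infinite_finite) (auto simp: W0_def)
      then obtain q where q: "\<And>i. q $ i \<in> \<int>" "infnorm (q v* X) < \<psi> (infnorm q)" "real k0 < infnorm q"
        by (metis (no_types, lifting) DiffE equals0I finite.emptyI mem_Collect_eq not_le)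
      obtain j where j: "infnorm q = \<bar>q $ j\<bar>" using infnorm_attained by blast
      define p where "p i = \<lfloor>q $ i\<rfloor>" for i
      have p: "of_int (p i) = q $ i" for i using q(1) by (simp add: p_def)
      have pj: "infnorm q = of_int \<bar>p j\<bar>" using j p[of j] by simp
      then have "int k0 < \<bar>p j\<bar>" using q(3) by linarith
      define k where "k = nat (\<bar>p j\<bar> - 1)"
      have k: "k0 \<le> k" "int (Suc k) = \<bar>p j\<bar>" using \<open>int k0 < \<bar>p j\<bar>\<close> by (auto simp: k_def)
      have rk: "infnorm q = real (Suc k)" using pj k(2) by (metis of_int_of_nat_eq)
      have qj: "q $ j \<noteq> 0" using rk j by auto
      have ple: "\<bar>p i\<bar> \<le> int (Suc k)" for i
      proof -
        have "\<bar>of_int (p i)\<bar> \<le> real (Suc k)" using abs_component_le_infnorm[of q i] rk p[of i] by simp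
        then show ?thesis by linarith
      qed
      have pQ: "p \<in> Q k j"
      proof -
        have "p j \<in> {int (Suc k), - int (Suc k)}" using k(2) by auto
        moreover have "p i \<in> {- int (Suc k)..int (Suc k)}" for i using ple[of i] by auto
        ultimately show ?thesis unfolding Q_def by auto
      qed
      (* Rows other than j are located on the grid of mesh \<eta>; row j is located relative to the value that they predict. *)
      define a0 where "a0 = (\<lambda>(i, l). \<lfloor>X $ i $ l / \<eta> k\<rfloor>)"
      define S where "S l = T k j p a0 l" for l
      define a where "a = (\<lambda>(i, l). if i = j then \<lfloor>(X $ j $ l - S l) / \<eta> k\<rfloor> else a0 (i, l))"
      have Ta: "T k j p a l = S l" for l unfolding S_def T_def by (intro arg_cong[where f = uminus] sum.cong) (auto simp: a_def)
      have grid: "\<bar>x - \<eta> k * of_int \<lfloor>x / \<eta> k\<rfloor>\<bar> \<le> \<eta> k" "\<bar>x - \<eta> k * (of_int \<lfloor>x / \<eta> k\<rfloor> + 1 / 2)\<bar> \<le> \<eta> k / 2" for x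
      proof -
        have x: "\<eta> k * (x / \<eta> k) = x" using \<eta>(1)[of k] by simp
        have "\<eta> k * of_int \<lfloor>x / \<eta> k\<rfloor> \<le> \<eta> k * (x / \<eta> k)" using \<eta>(1)[of k] by (intro mult_left_mono of_int_floor_le) simp
        moreover have "\<eta> k * (x / \<eta> k) \<le> \<eta> k * (of_int \<lfloor>x / \<eta> k\<rfloor> + 1)"
          using \<eta>(1)[of k] by (intro mult_left_mono) linarith+
        ultimately have *: "\<eta> k * of_int \<lfloor>x / \<eta> k\<rfloor> \<le> x" "x \<le> \<eta> k * of_int \<lfloor>x / \<eta> k\<rfloor> + \<eta> k"
          unfolding x distrib_left by simp_all
        show "\<bar>x - \<eta> k * of_int \<lfloor>x / \<eta> k\<rfloor>\<bar> \<le> \<eta> k" using * by linarith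
        show "\<bar>x - \<eta> k * (of_int \<lfloor>x / \<eta> k\<rfloor> + 1 / 2)\<bar> \<le> \<eta> k / 2" unfolding distrib_left using * by linarith
      qed
      have rowj: "\<bar>X $ j $ l - S l\<bar> < (K + real ?m) * \<eta> k" for l
      proof -
        have "\<bar>(q v* X) $ l\<bar> < \<psi> (real (Suc k))" using q(2) rk infnorm_less_iff by metis
        then have "\<bar>\<Sum>i\<in>UNIV. q $ i * X $ i $ l\<bar> < \<psi> (real (Suc k))" by (simp add: vector_matrix_mult_def)
        moreover have "(\<Sum>i\<in>UNIV. q $ i * X $ i $ l) = q $ j * (X $ j $ l + (\<Sum>i\<in>UNIV - {j}. q $ i / q $ j * X $ i $ l))"
          using qj by (subst sum.remove[of _ j]) (auto simp: distrib_left sum_distrib_left)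
        ultimately have "real (Suc k) * \<bar>X $ j $ l + (\<Sum>i\<in>UNIV - {j}. q $ i / q $ j * X $ i $ l)\<bar> < \<psi> (real (Suc k))"
          using rk j by (simp add: abs_mult)
        then have 1: "\<bar>X $ j $ l + (\<Sum>i\<in>UNIV - {j}. q $ i / q $ j * X $ i $ l)\<bar> < K * \<eta> k"
          unfolding \<eta>(2)[symmetric] d by (simp add: pos_less_divide_eq mult.commute)
        have "\<bar>(\<Sum>i\<in>UNIV - {j}. q $ i / q $ j * X $ i $ l) - (\<Sum>i\<in>UNIV - {j}. q $ i / q $ j * (\<eta> k * of_int (a0 (i, l))))\<bar>
            = \<bar>\<Sum>i\<in>UNIV - {j}. q $ i / q $ j * (X $ i $ l - \<eta> k * of_int (a0 (i, l)))\<bar>"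
          by (simp add: sum_subtractf right_diff_distrib)
        also have "\<dots> \<le> (\<Sum>i\<in>UNIV - {j}. \<bar>q $ i / q $ j * (X $ i $ l - \<eta> k * of_int (a0 (i, l)))\<bar>)" by (rule sum_abs)
        also have "\<dots> \<le> (\<Sum>i\<in>UNIV - {j}. 1 * \<eta> k)"
        proof (intro sum_mono)
          fix i
          have "\<bar>q $ i / q $ j\<bar> \<le> 1" using abs_component_le_infnorm[of q i] j qj by (simp add: abs_divide divide_le_eq)
          then show "\<bar>q $ i / q $ j * (X $ i $ l - \<eta> k * of_int (a0 (i, l)))\<bar> \<le> 1 * \<eta> k"
            unfolding abs_mult using grid(1)[of "X $ i $ l"] by (intro mult_mono) (auto simp: a0_def)
        qed
        also have "\<dots> = real (?m - 1) * \<eta> k" by (simp add: card_Diff_singleton)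
        also have "\<dots> \<le> real ?m * \<eta> k" using \<eta>(1)[of k] by (intro mult_right_mono) auto
        finally have 2: "\<bar>(\<Sum>i\<in>UNIV - {j}. q $ i / q $ j * X $ i $ l) - (\<Sum>i\<in>UNIV - {j}. q $ i / q $ j * (\<eta> k * of_int (a0 (i, l))))\<bar> \<le> real ?m * \<eta> k" .
        have "S l = - (\<Sum>i\<in>UNIV - {j}. q $ i / q $ j * (\<eta> k * of_int (a0 (i, l))))" by (simp add: S_def T_def p)
        then show ?thesis using 1 2 unfolding distrib_right by linarith
      qed
      have aA: "a \<in> A k j"
      proof -
        have "\<bar>of_int (a (i, l)) - 0\<bar> < L k i j" for i l
        proof (cases "i = j")
          case True
          have "\<bar>X $ j $ l - S l\<bar> / \<eta> k < K + real ?m" using rowj[of l] \<eta>(1)[of k] by (simp add: pos_divide_less_eq)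
          then have "\<bar>(X $ j $ l - S l) / \<eta> k\<bar> < K + real ?m" using \<eta>(1)[of k] by (simp add: abs_divide)
          then have "\<bar>real_of_int \<lfloor>(X $ j $ l - S l) / \<eta> k\<rfloor>\<bar> < K + real ?m + 2" by linarith
          then show ?thesis using True by (simp add: a_def L_def)
        next
          case False
          have "\<bar>X $ i $ l\<bar> / \<eta> k \<le> (1 / 2) / \<eta> k" using Xcube[of i l] \<eta>(1)[of k] by (intro divide_right_mono) auto
          then have "\<bar>X $ i $ l / \<eta> k\<bar> \<le> 1 / (2 * \<eta> k)" using \<eta>(1)[of k] by (simp add: abs_divide)
          then have "\<bar>real_of_int \<lfloor>X $ i $ l / \<eta> k\<rfloor>\<bar> < 1 / (2 * \<eta> k) + 2" by linarith
          then show ?thesis using False by (simp add: a_def a0_def L_def)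
        qed
        then show ?thesis by (auto simp: A_def)
      qed
      have "\<bar>(c k (j, p, a) - X) $ i $ l\<bar> \<le> \<eta> k / 2" for i l
      proof (cases "i = j")
        case True
        have "(c k (j, p, a) - X) $ j $ l = S l + \<eta> k * (of_int (a (j, l)) + 1 / 2) - X $ j $ l" by (simp add: c_def Ta)
        moreover have "a (j, l) = \<lfloor>(X $ j $ l - S l) / \<eta> k\<rfloor>" by (simp add: a_def)
        ultimately show ?thesis using grid(2)[of "X $ j $ l - S l"] True by (simp only:)
      next
        case False
        have "(c k (j, p, a) - X) $ i $ l = \<eta> k * (of_int (a (i, l)) + 1 / 2) - X $ i $ l" using False by (simp add: c_def)
        moreover have "a (i, l) = \<lfloor>X $ i $ l / \<eta> k\<rfloor>" using False by (simp add: a_def a0_def)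
        ultimately show ?thesis using grid(2)[of "X $ i $ l"] by (simp only:)
      qed
      then have "norm (c k (j, p, a) - X) \<le> real ?m * real ?n * (\<eta> k / 2)" by (rule norm_matrix_le)
      also have "\<dots> = d k / 4" by (simp add: \<eta>_def K_def)
      also have "\<dots> < d k / 2" using dpos[of k] by simp
      finally have "X \<in> ball (c k (j, p, a)) (d k / 2)" by (simp add: dist_norm)
      moreover have "(j, p, a) \<in> P k" using pQ aA by (simp add: P_def)
      ultimately show "X \<in> (\<Union>k\<in>{k0..}. \<Union>a\<in>P k. ball (c k a) (d k / 2))" using k(1) by blast
    qed
  qed
qed

section \<open>Matrices with a prescribed left kernel vector\<close>

text \<open>The map \<open>\<tau>\<close> tells which row is the dependent one (\<open>None\<close>) and how
  the other rows are numbered.\<close>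

definition kernel_param :: "('m \<Rightarrow> 'k option) \<Rightarrow> real ^ 'k \<Rightarrow> real ^ 'n ^ 'k \<Rightarrow> real ^ 'n ^ 'm" where
  "kernel_param \<tau> v Y = (\<chi> i l. case \<tau> i of None \<Rightarrow> - (\<Sum>a\<in>UNIV. v $ a * Y $ a $ l) | Some a \<Rightarrow> Y $ a $ l)"

lemma sum_option_bij:
  fixes \<tau> :: "'m::finite \<Rightarrow> 'k::finite option"
  assumes "bij \<tau>"
  shows "(\<Sum>i\<in>UNIV. g (\<tau> i)) = g None + (\<Sum>a\<in>UNIV. g (Some a))"
proof -
  have "(\<Sum>i\<in>UNIV. g (\<tau> i)) = (\<Sum>x\<in>UNIV. g x)"
    by (rule sum.reindex_bij_betw[OF assms])
  also have "\<dots> = g None + (\<Sum>x\<in>range Some. g x)"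
    by (simp add: UNIV_option_conv)
  also have "(\<Sum>x\<in>range Some. g x) = (\<Sum>a\<in>UNIV. g (Some a))"
    by (subst sum.reindex) (auto simp: o_def)
  finally show ?thesis .
qed

text \<open>If \<open>v\<close> is within \<open>\<psi> q / (k q)\<close> of \<open>p / q\<close>, the integer
  vector with the entries \<open>p\<close> and \<open>q\<close> is a witness. Its norm is \<open>q\<close>,
  since the entries of \<open>v\<close> are at most \<open>1\<close> and \<open>\<psi> q < 1\<close> for large
  \<open>q\<close>; and the entries of \<open>Y\<close>, at most \<open>1 / 2\<close>, leave a factor \<open>1
  / 2\<close> to spare.\<close>

lemma kernel_param_mem_W0:
  fixes \<tau> :: "'m::finite \<Rightarrow> 'k::finite option" and v :: "real ^ 'k" and Y :: "real ^ 'n ^ 'k"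
  assumes \<psi>: "approximating_function \<psi>" and \<tau>: "bij \<tau>"
    and cube: "kernel_param \<tau> v Y \<in> unit_cube"
    and v: "\<And>a. \<bar>v $ a\<bar> \<le> 1"
    and approx: "\<And>T. \<exists>a. T \<le> snd a \<and> 0 < snd a \<and> v \<in> sup_ball (rational_point a) (\<psi> (real (snd a)) / (real CARD('k) * real (snd a)))"
  shows "kernel_param \<tau> v Y \<in> W0 \<psi>"
proof -
  let ?X = "kernel_param \<tau> v Y"
  let ?S = "{q :: real ^ 'm. (\<forall>i. q $ i \<in> \<int>) \<and> q \<noteq> 0 \<and> infnorm (q v* ?X) < \<psi> (infnorm q)}"
  have \<psi>pos: "0 < \<psi> r" if "0 < r" for r using \<psi> that by (auto simp: approximating_function_def)
  have Y: "\<bar>Y $ a $ l\<bar> \<le> 1 / 2" for a l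
  proof -
    obtain i where "\<tau> i = Some a" using bij_pointE[OF \<tau>] by metis
    then have "?X $ i $ l = Y $ a $ l" by (simp add: kernel_param_def)
    moreover have "?X $ i $ l \<in> {- 1 / 2..1 / 2}" using cube by (simp add: unit_cube_def)
    ultimately show ?thesis unfolding atLeastAtMost_iff by linarith
  qed
  have "\<forall>\<^sub>F r in at_top. \<psi> r < 1"
    using \<psi> by (intro order_tendstoD(2)[of \<psi> 0]) (auto simp: approximating_function_def)
  then obtain T1 where T1: "\<And>r. T1 \<le> r \<Longrightarrow> \<psi> r < 1" by (auto simp: eventually_at_top_linorder)
  have large: "\<exists>q\<in>?S. B < infnorm q" for B
  proof -
    obtain T :: nat where T: "max B T1 < real T" using reals_Archimedean2 by blast
    obtain p q where pq: "T \<le> q" "0 < q" "v \<in> sup_ball (rational_point (p, q)) (\<psi> (real q) / (real CARD('k) * real q))"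
      using approx[of T] by auto
    have Tq: "real T \<le> real q" using pq(1) by simp
    define e where "e a = of_int (p a) - real q * v $ a" for a
    have e: "\<bar>e a\<bar> < \<psi> (real q) / real CARD('k)" for a
    proof -
      have "\<bar>v $ a - of_int (p a) / real q\<bar> < \<psi> (real q) / (real CARD('k) * real q)"
        using pq(3) by (simp add: sup_ball_def rational_point_def)
      then have "\<bar>v $ a - of_int (p a) / real q\<bar> * real q < \<psi> (real q) / (real CARD('k) * real q) * real q"
        using pq(2) by (intro mult_strict_right_mono) auto
      moreover have "\<bar>e a\<bar> = \<bar>v $ a - of_int (p a) / real q\<bar> * real q"
      proof -
        have "e a = - (v $ a - of_int (p a) / real q) * real q" using pq(2) by (simp add: e_def field_simps)
        then show ?thesis by (simp only: abs_mult abs_minus_cancel abs_of_nat)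
      qed
      ultimately show ?thesis using pq(2) by simp
    qed
    have p_le: "\<bar>p a\<bar> \<le> int q" for a
    proof -
      have k1: "1 \<le> real CARD('k)" by (simp add: Suc_leI)
      have "\<psi> (real q) / real CARD('k) \<le> \<psi> (real q)"
        using k1 \<psi>pos[of "real q"] pq(2) by (simp add: divide_le_eq mult_le_cancel_left1)
      then have "\<bar>e a\<bar> < 1" using e[of a] T1[of "real q"] T Tq by linarith
      moreover have "real q * \<bar>v $ a\<bar> \<le> real q * 1" using v by (intro mult_left_mono) auto
      then have "\<bar>real q * v $ a\<bar> \<le> real q" by (simp add: abs_mult)
      ultimately have "\<bar>of_int (p a)\<bar> < real q + 1" unfolding e_def by linarith
      then show ?thesis by linarith
    qed
    define Q :: "real ^ 'm" where "Q = (\<chi> i. case \<tau> i of None \<Rightarrow> real q | Some a \<Rightarrow> of_int (p a))"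
    have Qint: "Q $ i \<in> \<int>" for i by (simp add: Q_def split: option.split)
    have Qle: "\<bar>Q $ i\<bar> \<le> real q" for i
      using p_le by (auto simp: Q_def split: option.split) (metis of_int_abs of_int_le_iff of_int_of_nat_eq)
    obtain i0 where i0: "\<tau> i0 = None" using bij_pointE[OF \<tau>] by metis
    have Qnorm: "infnorm Q = real q"
    proof (rule antisym)
      show "infnorm Q \<le> real q" using Qle infnorm_attained[of Q] by metis
      show "real q \<le> infnorm Q" using abs_component_le_infnorm[of Q i0] i0 by (simp add: Q_def)
    qed
    have "\<bar>(Q v* ?X) $ l\<bar> < \<psi> (real q)" for l
    proof -
      let ?g = "\<lambda>x. case x of None \<Rightarrow> real q * - (\<Sum>a\<in>UNIV. v $ a * Y $ a $ l) | Some a \<Rightarrow> of_int (p a) * Y $ a $ l"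
      have "(Q v* ?X) $ l = (\<Sum>i\<in>UNIV. Q $ i * ?X $ i $ l)" by (simp add: vector_matrix_mult_def)
      also have "\<dots> = (\<Sum>i\<in>UNIV. ?g (\<tau> i))"
        by (intro sum.cong refl) (simp add: Q_def kernel_param_def split: option.split)
      also have "\<dots> = ?g None + (\<Sum>a\<in>UNIV. ?g (Some a))" by (rule sum_option_bij[OF \<tau>])
      also have "\<dots> = (\<Sum>a\<in>UNIV. e a * Y $ a $ l)"
        by (simp add: e_def left_diff_distrib sum_subtractf sum_distrib_left mult.assoc)
      finally have "\<bar>(Q v* ?X) $ l\<bar> \<le> (\<Sum>a\<in>UNIV. \<bar>e a * Y $ a $ l\<bar>)" by simp
      also have "\<dots> \<le> (\<Sum>a\<in>(UNIV::'k set). \<psi> (real q) / real CARD('k) * (1 / 2))"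
        unfolding abs_mult using e Y \<psi>pos[of "real q"] pq(2) by (intro sum_mono mult_mono) (auto intro: less_imp_le)
      also have "\<dots> = \<psi> (real q) / 2" by simp
      also have "\<dots> < \<psi> (real q)" using \<psi>pos[of "real q"] pq(2) by simp
      finally show ?thesis .
    qed
    then have "infnorm (Q v* ?X) < \<psi> (infnorm Q)" unfolding Qnorm infnorm_less_iff by blast
    moreover have "Q \<noteq> 0" using Qnorm pq(2) by (auto simp: infnorm_0)
    ultimately have "Q \<in> ?S" using Qint by simp
    then show ?thesis using Qnorm T Tq by (intro bexI[of _ Q]) auto
  qed
  have "infinite ?S"
  proof
    assume fin: "finite ?S"
    obtain q where q: "q \<in> ?S" "Max (infnorm ` ?S) < infnorm q" using large by blast
    have "infnorm q \<le> Max (infnorm ` ?S)" using fin q(1) by (intro Max_ge) auto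
    then show False using q(2) by simp
  qed
  then show ?thesis using cube by (simp add: W0_def)
qed

lemma vector_matrix_mult_inj_iff:
  fixes X :: "real ^ 'n ^ 'm"
  shows "rank X = CARD('m) \<longleftrightarrow> inj (\<lambda>q. q v* X)"
proof -
  have "rank X = rank (transpose X)" by (simp add: rank_transpose)
  also have "\<dots> = CARD('m) \<longleftrightarrow> inj ((*v) (transpose X))" by (rule full_rank_injective)
  also have "(*v) (transpose X) = (\<lambda>q. q v* X)" by (simp add: fun_eq_iff)
  finally show ?thesis .
qed

text \<open>For full rank, the norm of \<open>q v* X\<close> is at least a multiple of that of
  \<open>q\<close>, whereas \<open>\<psi>\<close> tends to \<open>0\<close>.\<close>

lemma W0_subset_low_rank:
  assumes \<psi>: "approximating_function \<psi>"
  shows "(W0 \<psi> :: (real ^ 'n ^ 'm) set) \<subseteq> low_rank"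
proof
  fix X :: "real ^ 'n ^ 'm" assume X: "X \<in> W0 \<psi>"
  let ?S = "{q :: real ^ 'm. (\<forall>i. q $ i \<in> \<int>) \<and> q \<noteq> 0 \<and> infnorm (q v* X) < \<psi> (infnorm q)}"
  have "rank X \<noteq> CARD('m)"
  proof
    assume "rank X = CARD('m)"
    then have inj: "inj (\<lambda>q. q v* X)" by (simp add: vector_matrix_mult_inj_iff)
    have "linear (\<lambda>q. q v* X)" using matrix_vector_mul_linear[of "transpose X"] by simp
    then obtain B where B: "B > 0" "\<And>q. B * norm q \<le> norm (q v* X)"
      using linear_inj_bounded_below_pos[OF _ inj] by blast
    define D where "D = B / sqrt (real DIM(real ^ 'n))"
    have "0 < D" using B by (simp add: D_def)
    then have "\<forall>\<^sub>F r in at_top. \<psi> r < D"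
      using \<psi> by (intro order_tendstoD(2)[of \<psi> 0]) (auto simp: approximating_function_def)
    then obtain T where T: "\<And>r. T \<le> r \<Longrightarrow> \<psi> r < D" by (auto simp: eventually_at_top_linorder)
    have "?S \<subseteq> {q. (\<forall>i. q $ i \<in> \<int>) \<and> infnorm q \<le> T}"
    proof
      fix q assume q: "q \<in> ?S"
      have q1: "1 \<le> infnorm q"
      proof -
        obtain i where i: "infnorm q = \<bar>q $ i\<bar>" using infnorm_attained by blast
        have "q $ i \<in> \<int>" "infnorm q \<noteq> 0" using q by (auto simp: infnorm_eq_0)
        then show ?thesis using i Ints_nonzero_abs_ge1[of "q $ i"] by auto
      qed
      have "B * infnorm q \<le> B * norm q" using B infnorm_le_norm by (intro mult_left_mono) auto
      also have "\<dots> \<le> norm (q v* X)" by (rule B)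
      also have "\<dots> \<le> sqrt (real DIM(real ^ 'n)) * infnorm (q v* X)" by (rule norm_le_infnorm)
      also have "\<dots> < sqrt (real DIM(real ^ 'n)) * \<psi> (infnorm q)"
        using q by (intro mult_strict_left_mono) auto
      finally have "B * infnorm q < sqrt (real DIM(real ^ 'n)) * \<psi> (infnorm q)" .
      moreover have "B * 1 \<le> B * infnorm q" using q1 B by (intro mult_left_mono) auto
      ultimately have "B < sqrt (real DIM(real ^ 'n)) * \<psi> (infnorm q)" by linarith
      then have "D < \<psi> (infnorm q)" by (simp add: D_def pos_divide_less_eq mult.commute)
      then have "infnorm q \<le> T" using T[of "infnorm q"] by linarith
      then show "q \<in> {q. (\<forall>i. q $ i \<in> \<int>) \<and> infnorm q \<le> T}" using q by simp
    qed
    then show False using X finite_subset[OF _ finite_bounded_int_vectors] by (auto simp: W0_def)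
  qed
  moreover have "rank X \<le> CARD('m)" using rank_bound[of X] by simp
  ultimately show "X \<in> low_rank" using X by (auto simp: low_rank_def W0_def)
qed

text \<open>Normalise a kernel vector by its largest entry \<open>j\<close>. This is why all choices of the
  dependent row are needed.\<close>

lemma low_rank_kernel_param:
  fixes X :: "real ^ 'n ^ 'm" and \<tau> :: "'m \<Rightarrow> 'm \<Rightarrow> 'k::finite option"
  assumes X: "X \<in> low_rank"
    and \<tau>: "\<And>j. bij (\<tau> j)" "\<And>j. \<tau> j j = None"
  shows "\<exists>j v Y. (\<forall>a. \<bar>v $ a\<bar> \<le> 1) \<and> (\<forall>a l. \<bar>Y $ a $ l\<bar> \<le> 1 / 2) \<and> X = kernel_param (\<tau> j) v Y"
proof -
  have "rank X \<le> CARD('m) - 1" using X by (simp add: low_rank_def)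
  then have "rank X \<noteq> CARD('m)" using zero_less_card_finite[where 'a = 'm] by linarith
  then have ninj: "\<not> inj (\<lambda>q. q v* X)" by (simp add: vector_matrix_mult_inj_iff)
  have "linear (\<lambda>q. q v* X)" using matrix_vector_mul_linear[of "transpose X"] by simp
  then have "\<not> (\<forall>u. u v* X = 0 \<longrightarrow> u = 0)" using ninj linear_injective_0[of "\<lambda>q. q v* X"] by simp
  then obtain u where u: "u v* X = 0" "u \<noteq> 0" by blast
  obtain j where j: "infnorm u = \<bar>u $ j\<bar>" using infnorm_attained by blast
  have uj: "u $ j \<noteq> 0" using u(2) j infnorm_eq_0[of u] by auto
  define \<sigma> where "\<sigma> a = inv (\<tau> j) (Some a)" for a
  have \<sigma>: "\<tau> j (\<sigma> a) = Some a" for a unfolding \<sigma>_def by (rule surj_f_inv_f[OF bij_is_surj[OF \<tau>(1)]])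
  have \<sigma>': "\<sigma> a = i" if "\<tau> j i = Some a" for a i
    using that \<tau>(1)[of j] by (simp add: \<sigma>_def inv_f_f[OF bij_is_inj[OF \<tau>(1)]] flip: that)
  have jN: "i = j" if "\<tau> j i = None" for i using that \<tau>(2)[of j] injD[OF bij_is_inj[OF \<tau>(1)[of j]]] by metis
  define v :: "real ^ 'k" where "v = (\<chi> a. u $ \<sigma> a / u $ j)"
  define Y :: "real ^ 'n ^ 'k" where "Y = (\<chi> a. X $ \<sigma> a)"
  have "\<bar>v $ a\<bar> \<le> 1" for a
    using abs_component_le_infnorm[of u "\<sigma> a"] j uj by (simp add: v_def abs_divide divide_le_eq)
  moreover have "\<bar>Y $ a $ l\<bar> \<le> 1 / 2" for a l
  proof -
    have "X $ \<sigma> a $ l \<in> {- 1 / 2..1 / 2}" using X by (simp add: low_rank_def unit_cube_def)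
    then show ?thesis unfolding Y_def atLeastAtMost_iff vec_lambda_beta by linarith
  qed
  moreover have "X = kernel_param (\<tau> j) v Y"
  proof -
    have "X $ i $ l = kernel_param (\<tau> j) v Y $ i $ l" for i l
    proof (cases "\<tau> j i")
      case (Some a)
      then show ?thesis using \<sigma>' by (simp add: kernel_param_def Y_def)
    next
      case None
      let ?g = "\<lambda>x. case x of None \<Rightarrow> u $ j * X $ j $ l | Some a \<Rightarrow> u $ \<sigma> a * X $ \<sigma> a $ l"
      have "0 = (\<Sum>i\<in>UNIV. u $ i * X $ i $ l)"
        using u(1) by (simp add: vec_eq_iff vector_matrix_mult_def)
      also have "\<dots> = (\<Sum>i\<in>UNIV. ?g (\<tau> j i))"
        using jN \<sigma>' by (intro sum.cong refl) (auto split: option.split)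
      also have "\<dots> = ?g None + (\<Sum>a\<in>UNIV. ?g (Some a))" by (rule sum_option_bij[OF \<tau>(1)])
      also have "\<dots> = u $ j * (X $ j $ l + (\<Sum>a\<in>UNIV. v $ a * Y $ a $ l))"
        using uj by (simp add: distrib_left sum_distrib_left v_def Y_def)
      finally have "X $ j $ l = - (\<Sum>a\<in>UNIV. v $ a * Y $ a $ l)" using uj by simp
      then show ?thesis using None jN[OF None] by (simp add: kernel_param_def)
    qed
    then show ?thesis by (simp add: vec_eq_iff)
  qed
  ultimately show ?thesis by blast
qed

lemma kernel_param_lipschitz:
  fixes v c :: "real ^ 'k" and Y Z :: "real ^ 'n ^ 'k" and \<tau> :: "'m::finite \<Rightarrow> 'k option"
  assumes "0 \<le> h" and v: "\<And>a. \<bar>v $ a\<bar> \<le> 1" "\<And>a. \<bar>v $ a - c $ a\<bar> \<le> h"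
    and Y: "\<And>a l. \<bar>Y $ a $ l - Z $ a $ l\<bar> \<le> h" "\<And>a l. \<bar>Z $ a $ l\<bar> \<le> 1"
  shows "norm (kernel_param \<tau> v Y - kernel_param \<tau> c Z) \<le> real CARD('m) * real CARD('n) * (2 * real CARD('k) * h)"
proof (rule norm_matrix_le)
  fix i :: 'm and l :: 'n
  have k1: "1 \<le> real CARD('k)" by (simp add: Suc_leI)
  show "\<bar>(kernel_param \<tau> v Y - kernel_param \<tau> c Z) $ i $ l\<bar> \<le> 2 * real CARD('k) * h"
  proof (cases "\<tau> i")
    case None
    then have "\<bar>(kernel_param \<tau> v Y - kernel_param \<tau> c Z) $ i $ l\<bar> = \<bar>\<Sum>a\<in>UNIV. v $ a * Y $ a $ l - c $ a * Z $ a $ l\<bar>"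
      by (simp add: kernel_param_def sum_subtractf abs_minus_commute)
    also have "\<dots> \<le> (\<Sum>a\<in>UNIV. \<bar>v $ a * Y $ a $ l - c $ a * Z $ a $ l\<bar>)" by (rule sum_abs)
    also have "\<dots> \<le> (\<Sum>a\<in>(UNIV::'k set). 2 * h)"
    proof (rule sum_mono)
      fix a
      have "v $ a * Y $ a $ l - c $ a * Z $ a $ l = v $ a * (Y $ a $ l - Z $ a $ l) + (v $ a - c $ a) * Z $ a $ l"
        by (simp add: algebra_simps)
      then have "\<bar>v $ a * Y $ a $ l - c $ a * Z $ a $ l\<bar> \<le> \<bar>v $ a\<bar> * \<bar>Y $ a $ l - Z $ a $ l\<bar> + \<bar>v $ a - c $ a\<bar> * \<bar>Z $ a $ l\<bar>"
        by (metis abs_mult abs_triangle_ineq)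
      also have "\<dots> \<le> 1 * h + h * 1" using assms by (intro add_mono mult_mono) auto
      finally show "\<bar>v $ a * Y $ a $ l - c $ a * Z $ a $ l\<bar> \<le> 2 * h" by simp
    qed
    finally show ?thesis by simp
  next
    case (Some a)
    then have "\<bar>(kernel_param \<tau> v Y - kernel_param \<tau> c Z) $ i $ l\<bar> \<le> h" using Y(1) by (simp add: kernel_param_def)
    also have "1 \<le> 2 * real CARD('k)" using k1 by linarith
    then have "h \<le> 2 * real CARD('k) * h" using assms(1) mult_right_mono[of 1 "2 * real CARD('k)" h] by linarith
    finally show ?thesis .
  qed
qed

text \<open>Cover \<open>N\<close> by cubes of small total volume. Above a cube of radius \<open>h\<close>,
  split the cube of the \<open>Y\<close> into about \<open>h\<close> to the power \<open>- k n\<close> cells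
  of size \<open>h\<close>. The parametrisation is Lipschitz, so the image of each cell lies in a ball of
  radius \<open>\<Lambda> h\<close>, and the costs above the cube add up to a multiple of its volume.\<close>

lemma hausdorff_null_kernel_param_image:
  fixes N :: "(real ^ 'k) set" and \<tau> :: "'m::finite \<Rightarrow> 'k option" and f :: "real \<Rightarrow> real"
  assumes N: "negligible N" "\<And>v a. v \<in> N \<Longrightarrow> \<bar>v $ a\<bar> \<le> 1"
    and f: "\<And>r. 0 < r \<Longrightarrow> 0 < f r" and C: "0 < C"
    and r0: "0 < r0" "\<And>r. 0 < r \<Longrightarrow> r \<le> r0 \<Longrightarrow> f r \<le> C * r ^ (CARD('k) * (CARD('n) + 1))"
  shows "hausdorff_measure f {kernel_param \<tau> v Y | v (Y :: real ^ 'n ^ 'k). v \<in> N \<and> (\<forall>a l. \<bar>Y $ a $ l\<bar> \<le> 1 / 2)} = 0"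
    (is "hausdorff_measure f ?X = 0")
proof (rule hausdorff_null_if_small_covers[OF _ f])
  fix \<rho> e :: real assume \<rho>: "0 < \<rho>" and e: "0 < e"
  let ?k = "CARD('k)" and ?n = "CARD('n)"
  define \<Lambda> where "\<Lambda> = 2 * real CARD('m) * real ?n * real ?k + 1"
  have \<Lambda>: "0 < \<Lambda>" by (simp add: \<Lambda>_def add_nonneg_pos)
  define \<rho>1 where "\<rho>1 = min 1 (min \<rho> r0 / (2 * \<Lambda>))"
  have \<rho>1: "0 < \<rho>1" "\<rho>1 \<le> 1" "2 * \<Lambda> * \<rho>1 \<le> \<rho>" "2 * \<Lambda> * \<rho>1 \<le> r0"
  proof -
    have "2 * \<Lambda> * \<rho>1 \<le> 2 * \<Lambda> * (min \<rho> r0 / (2 * \<Lambda>))" using \<Lambda> by (intro mult_left_mono) (auto simp: \<rho>1_def)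
    then have "2 * \<Lambda> * \<rho>1 \<le> min \<rho> r0" using \<Lambda> by simp
    then show "0 < \<rho>1" "\<rho>1 \<le> 1" "2 * \<Lambda> * \<rho>1 \<le> \<rho>" "2 * \<Lambda> * \<rho>1 \<le> r0" using \<Lambda> \<rho> r0(1) by (auto simp: \<rho>1_def)
  qed
  define C1 where "C1 = 6 ^ (?k * ?n) * (C * (2 * \<Lambda>) ^ (?k * (?n + 1)))"
  have C1: "0 < C1" using C \<Lambda> by (simp add: C1_def)
  have "N \<in> sets lebesgue" using N(1) by (rule negligible_imp_sets)
  moreover have "0 < e / C1" using e C1 by simp
  ultimately obtain U where U: "open U" "N \<subseteq> U" "U - N \<in> lmeasurable" "emeasure lebesgue (U - N) < ennreal (e / C1)"
    by (rule sets_lebesgue_outer_open)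
  have Um: "U \<in> lmeasurable" "measure lebesgue U \<le> e / C1"
  proof -
    have UN: "U = N \<union> (U - N)" using U(2) by auto
    have Nm: "N \<in> lmeasurable" "measure lebesgue N = 0" using N(1) negligible_imp_measurable negligible_imp_measure0 by auto
    show Um: "U \<in> lmeasurable" by (subst UN) (intro fmeasurable.Un Nm U(3))
    have "measure lebesgue U \<le> measure lebesgue N + measure lebesgue (U - N)"
      by (subst UN) (rule measure_Un_le, use Nm U(3) in \<open>auto simp: fmeasurableD\<close>)
    moreover have "measure lebesgue (U - N) < e / C1"
      using U(3,4) \<open>0 < e / C1\<close> by (simp add: emeasure_eq_measure2 ennreal_less_iff)
    ultimately show "measure lebesgue U \<le> e / C1" using Nm by simp
  qed
  have Nbox: "N \<subseteq> cbox (\<chi> i. - 1) (\<chi> i. (\<chi> i. (- 1 :: real)) $ i + 2)"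
    using N(2) by (force simp: mem_box_cart abs_le_iff)
  obtain \<D> :: "((real ^ 'k) \<times> real) set" where D: "countable \<D>"
    "\<And>c h. (c, h) \<in> \<D> \<Longrightarrow> 0 < h \<and> h \<le> 2 \<and> h \<le> \<rho>1 \<and> sup_ball c h \<subseteq> U \<and> c \<in> cbox (\<chi> i. - 1) (\<chi> i. (\<chi> i. (- 1 :: real)) $ i + 2)"
    "disjoint_family_on (\<lambda>K. sup_ball (fst K) (snd K)) \<D>"
    "N \<subseteq> (\<Union>K\<in>\<D>. {x. \<forall>i. \<bar>x $ i - fst K $ i\<bar> \<le> snd K})"
    using cube_decomposition[OF U(2) Nbox U(1) \<rho>1(1)] by auto
  have hpos: "0 < snd K" "snd K \<le> \<rho>1" "snd K \<le> 1" if "K \<in> \<D>" for K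
    using D(2)[of "fst K" "snd K"] that \<rho>1(2) by auto
  define Z where "Z K = {a :: 'k \<times> 'n \<Rightarrow> int. \<forall>p. a p \<in> {z. \<bar>of_int z - 0\<bar> < 1 / (2 * snd K) + 2}}" for K :: "(real ^ 'k) \<times> real"
  define cen where "cen = (\<lambda>(K :: (real ^ 'k) \<times> real, a :: 'k \<times> 'n \<Rightarrow> int).
    kernel_param \<tau> (fst K) ((\<chi> b l. snd K * (of_int (a (b, l)) + 1 / 2)) :: real ^ 'n ^ 'k))"
  define A where "A = (SIGMA K:\<D>. Z K)"
  have finZ: "finite (Z K)" if "K \<in> \<D>" for K
    unfolding Z_def using hpos(1)[OF that] by (intro card_fun_constraints(2) card_int_interval_le(1)) simp
  have cardZ: "real (card (Z K)) \<le> (6 / snd K) ^ (?k * ?n)" if K: "K \<in> \<D>" for K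
  proof -
    have "real (card (Z K)) = (\<Prod>p\<in>(UNIV :: ('k \<times> 'n) set). real (card {z::int. \<bar>of_int z - 0\<bar> < 1 / (2 * snd K) + 2}))"
      unfolding Z_def card_fun_constraints(1) by simp
    also have "\<dots> \<le> (\<Prod>p\<in>(UNIV :: ('k \<times> 'n) set). 6 / snd K)"
    proof (intro prod_mono conjI)
      have "real (card {z::int. \<bar>of_int z - 0\<bar> < 1 / (2 * snd K) + 2}) \<le> 2 * (1 / (2 * snd K) + 2) + 1"
        using hpos(1)[OF K] by (intro card_int_interval_le(2)) simp
      also have "\<dots> = 1 / snd K + 5" by simp
      also have "5 \<le> 5 / snd K" using hpos(1,3)[OF K] by (simp add: le_divide_eq)
      then have "1 / snd K + 5 \<le> 6 / snd K" by (simp add: add_divide_distrib[symmetric] flip: add_divide_distrib) 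
      finally show "real (card {z::int. \<bar>of_int z - 0\<bar> < 1 / (2 * snd K) + 2}) \<le> 6 / snd K" .
    qed simp
    finally show ?thesis by (simp add: card_prod)
  qed
  show "\<exists>(A :: (((real ^ 'k) \<times> real) \<times> ('k \<times> 'n \<Rightarrow> int)) set) c r. countable A \<and> (\<forall>a\<in>A. 0 < r a \<and> 2 * r a \<le> \<rho>) \<and>
     ?X \<subseteq> (\<Union>a\<in>A. ball (c a) (r a)) \<and> (\<forall>F. finite F \<and> F \<subseteq> A \<longrightarrow> (\<Sum>a\<in>F. f (2 * r a)) \<le> e)"
  proof (intro exI[of _ A] exI[of _ cen] exI[of _ "\<lambda>a. \<Lambda> * snd (fst a)"] conjI ballI allI impI)
    show "countable A" unfolding A_def using D(1) finZ by (intro countable_SIGMA) (auto intro: countable_finite)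
  next
    fix a assume "a \<in> A"
    then have K: "fst a \<in> \<D>" by (auto simp: A_def)
    show "0 < \<Lambda> * snd (fst a)" using hpos(1)[OF K] \<Lambda> by simp
    have "2 * \<Lambda> * snd (fst a) \<le> 2 * \<Lambda> * \<rho>1" using hpos(2)[OF K] \<Lambda> by (intro mult_left_mono) auto
    then show "2 * (\<Lambda> * snd (fst a)) \<le> \<rho>" using \<rho>1(3) by simp
  next
    show "?X \<subseteq> (\<Union>a\<in>A. ball (cen a) (\<Lambda> * snd (fst a)))"
    proof
      fix X assume "X \<in> ?X"
      then obtain v and Y :: "real ^ 'n ^ 'k" where X: "X = kernel_param \<tau> v Y" "v \<in> N" "\<And>a l. \<bar>Y $ a $ l\<bar> \<le> 1 / 2" by blast
      obtain K where K: "K \<in> \<D>" "\<And>i. \<bar>v $ i - fst K $ i\<bar> \<le> snd K" using X(2) D(4) by blast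
      define h where "h = snd K"
      have h: "0 < h" "h \<le> 1" using hpos[OF K(1)] by (auto simp: h_def)
      define a where "a = (\<lambda>(b, l). \<lfloor>Y $ b $ l / h\<rfloor>)"
      let ?W = "(\<chi> b l. h * (of_int (a (b, l)) + 1 / 2)) :: real ^ 'n ^ 'k"
      have fl: "\<bar>x - h * (of_int \<lfloor>x / h\<rfloor> + 1 / 2)\<bar> \<le> h / 2" for x
      proof -
        have x: "h * (x / h) = x" using h by simp
        have "h * of_int \<lfloor>x / h\<rfloor> \<le> h * (x / h)" using h by (intro mult_left_mono of_int_floor_le) simp
        moreover have "h * (x / h) \<le> h * (of_int \<lfloor>x / h\<rfloor> + 1)" using h by (intro mult_left_mono) linarith+
        ultimately show ?thesis unfolding x distrib_left by linarith
      qed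
      have W: "\<bar>Y $ b $ l - ?W $ b $ l\<bar> \<le> h / 2" for b l using fl[of "Y $ b $ l"] by (simp add: a_def)
      have W1: "\<bar>?W $ b $ l\<bar> \<le> 1" for b l using W[of b l] X(3)[of b l] h(2) by linarith
      have W2: "\<bar>Y $ b $ l - ?W $ b $ l\<bar> \<le> h" for b l using W[of b l] h(1) by linarith
      have "norm (kernel_param \<tau> v Y - kernel_param \<tau> (fst K) ?W :: real ^ 'n ^ 'm) \<le> real CARD('m) * real ?n * (2 * real ?k * h)"
        by (rule kernel_param_lipschitz[OF _ _ _ W2 W1]) (use h K(2) N(2)[OF X(2)] in \<open>auto simp: h_def\<close>)
      then have "norm (X - cen (K, a)) \<le> real CARD('m) * real ?n * (2 * real ?k * h)"
        unfolding X(1) cen_def by (simp add: h_def)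
      also have "\<dots> < \<Lambda> * h" using h by (simp add: \<Lambda>_def distrib_right mult_ac)
      finally have "X \<in> ball (cen (K, a)) (\<Lambda> * snd (fst (K, a)))" by (simp add: dist_norm norm_minus_commute h_def)
      moreover have "a \<in> Z K"
      proof -
        have "\<bar>of_int (a (b, l)) - 0\<bar> < 1 / (2 * snd K) + 2" for b l
        proof -
          have "\<bar>Y $ b $ l\<bar> / h \<le> (1 / 2) / h" using X(3)[of b l] h by (intro divide_right_mono) auto
          then have "\<bar>Y $ b $ l / h\<bar> \<le> 1 / (2 * h)" using h by (simp add: abs_divide)
          then have "\<bar>real_of_int \<lfloor>Y $ b $ l / h\<rfloor>\<bar> < 1 / (2 * h) + 2" by linarith
          then show ?thesis by (simp add: a_def h_def)
        qed
        then show ?thesis by (auto simp: Z_def)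
      qed
      ultimately show "X \<in> (\<Union>a\<in>A. ball (cen a) (\<Lambda> * snd (fst a)))" using K(1) unfolding A_def by blast
    qed
  next
    fix F assume F: "finite F \<and> F \<subseteq> A"
    define \<K> where "\<K> = fst ` F"
    have \<K>: "finite \<K>" "\<K> \<subseteq> \<D>" using F by (auto simp: \<K>_def A_def)
    have "(\<Sum>a\<in>F. f (2 * (\<Lambda> * snd (fst a)))) \<le> (\<Sum>a\<in>Sigma \<K> Z. f (2 * (\<Lambda> * snd (fst a))))"
    proof (rule sum_mono2)
      show "finite (Sigma \<K> Z)" using \<K> finZ by (intro finite_SigmaI) auto
      show "F \<subseteq> Sigma \<K> Z" using F by (force simp: \<K>_def A_def)
      show "0 \<le> f (2 * (\<Lambda> * snd (fst a)))" if "a \<in> Sigma \<K> Z - F" for a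
        using that \<K> hpos(1)[of "fst a"] \<Lambda> by (intro less_imp_le[OF f]) auto
    qed
    also have "\<dots> = (\<Sum>K\<in>\<K>. \<Sum>a\<in>Z K. f (2 * (\<Lambda> * snd K)))"
      using \<K> finZ by (subst sum.Sigma) (auto simp: split_def)
    also have "\<dots> \<le> (\<Sum>K\<in>\<K>. C1 * (2 * snd K) ^ ?k)"
    proof (rule sum_mono)
      fix K assume "K \<in> \<K>"
      then have K: "K \<in> \<D>" using \<K> by auto
      define h where "h = snd K"
      have h: "0 < h" "h \<le> \<rho>1" using hpos[OF K] by (auto simp: h_def)
      have "2 * (\<Lambda> * h) \<le> 2 * \<Lambda> * \<rho>1" using h \<Lambda> by simp
      then have "2 * (\<Lambda> * h) \<le> r0" using \<rho>1(4) by linarith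
      then have fh: "f (2 * (\<Lambda> * h)) \<le> C * (2 * (\<Lambda> * h)) ^ (?k * (?n + 1))"
        using h \<Lambda> by (intro r0) auto
      have "(\<Sum>a\<in>Z K. f (2 * (\<Lambda> * snd K))) = real (card (Z K)) * f (2 * (\<Lambda> * h))" by (simp add: h_def)
      also have "\<dots> \<le> (6 / h) ^ (?k * ?n) * (C * (2 * (\<Lambda> * h)) ^ (?k * (?n + 1)))"
        using cardZ[OF K] fh h \<Lambda> f[of "2 * (\<Lambda> * h)"] by (intro mult_mono) (auto simp: h_def)
      also have "\<dots> = C1 * (h ^ (?k * (?n + 1)) / h ^ (?k * ?n))"
        unfolding C1_def power_divide mult.assoc[symmetric, of 2] power_mult_distrib by simp
      also have "h ^ (?k * (?n + 1)) / h ^ (?k * ?n) = h ^ ?k" using h by (simp add: power_add distrib_left)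
      also have "\<dots> \<le> (2 * h) ^ ?k" using h by (intro power_mono) auto
      finally show "(\<Sum>a\<in>Z K. f (2 * (\<Lambda> * snd K))) \<le> C1 * (2 * snd K) ^ ?k" using C1 by (simp add: h_def)
    qed
    also have "\<dots> = C1 * (\<Sum>K\<in>\<K>. (2 * snd K) ^ ?k)" by (simp add: sum_distrib_left)
    also have "(\<Sum>K\<in>\<K>. (2 * snd K) ^ ?k) = (\<Sum>K\<in>\<K>. measure lebesgue (sup_ball (fst K) (snd K)))"
    proof (rule sum.cong[OF refl])
      fix K assume "K \<in> \<K>"
      then have "0 \<le> snd K" using \<K> hpos(1)[of K] by auto
      then show "(2 * snd K) ^ ?k = measure lebesgue (sup_ball (fst K) (snd K))" by (simp add: measure_sup_ball)
    qed
    also have "\<dots> = measure lebesgue (\<Union>K\<in>\<K>. sup_ball (fst K) (snd K))"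
      using \<K> disjoint_family_on_mono[OF \<K>(2) D(3)]
      by (subst measure_finite_Union) (auto simp: lmeasurable_sup_ball fmeasurableD emeasure_eq_measure2)
    also have "\<dots> \<le> measure lebesgue U"
    proof (rule measure_mono_fmeasurable[OF _ _ Um(1)])
      show "(\<Union>K\<in>\<K>. sup_ball (fst K) (snd K)) \<subseteq> U" using D(2) \<K>(2) by (force)
      show "(\<Union>K\<in>\<K>. sup_ball (fst K) (snd K)) \<in> sets lebesgue"
        using \<K>(1) by (intro sets.finite_UN) (auto simp: lmeasurable_sup_ball fmeasurableD)
    qed
    also have "C1 * measure lebesgue U \<le> C1 * (e / C1)" using Um(2) C1 by (intro mult_left_mono) auto
    also have "\<dots> = e" using C1 by simp
    finally show "(\<Sum>a\<in>F. f (2 * (\<Lambda> * snd (fst a)))) \<le> e" using C1 by (simp add: mult_left_mono)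
  qed
qed

section \<open>The critical case\<close>

text \<open>By Khintchine's theorem, a matrix of low rank outside \<open>W0 \<psi>\<close> has its parameter
  \<open>v\<close> in a null set, for some choice of the dependent row.\<close>

theorem hausdorff_measure_W0_eq_low_rank:
  fixes \<psi> f :: "real \<Rightarrow> real" and \<tau> :: "'m::finite \<Rightarrow> 'm \<Rightarrow> 'k::finite option"
  assumes \<psi>: "approximating_function \<psi>" and f: "\<And>r. 0 < r \<Longrightarrow> 0 < f r"
    and \<tau>: "\<And>j. bij (\<tau> j)" "\<And>j. \<tau> j j = None"
    and C: "0 < C" and lim: "((\<lambda>r. f r / r ^ (CARD('k) * (CARD('n) + 1))) \<longlongrightarrow> C) (at_right 0)"
    and div: "\<not> summable (\<lambda>j. \<psi> (real (Suc j)) ^ CARD('k))"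
  shows "hausdorff_measure f (W0 \<psi> :: (real ^ 'n ^ 'm) set) = hausdorff_measure f (low_rank :: (real ^ 'n ^ 'm) set)"
proof (rule antisym)
  show "hausdorff_measure f (W0 \<psi> :: (real ^ 'n ^ 'm) set) \<le> hausdorff_measure f (low_rank :: (real ^ 'n ^ 'm) set)"
    by (rule hausdorff_measure_mono[OF W0_subset_low_rank[OF \<psi>]])
  have \<psi>pos: "0 < \<psi> r" if "0 < r" for r using \<psi> that by (auto simp: approximating_function_def)
  have \<psi>anti: "antimono_on {0<..} \<psi>" using \<psi> by (simp add: approximating_function_def)
  define \<Theta> where "\<Theta> r = \<psi> r / (real CARD('k) * r)" for r
  have \<Theta>anti: "antimono_on {0<..} \<Theta>"
    using \<psi>anti \<psi>pos unfolding \<Theta>_def monotone_on_def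
    by (auto intro!: frac_le less_imp_le[OF \<psi>pos])
  have "\<not> summable (\<lambda>j. (real (Suc j) * \<Theta> (real (Suc j))) ^ CARD('k))"
  proof
    assume "summable (\<lambda>j. (real (Suc j) * \<Theta> (real (Suc j))) ^ CARD('k))"
    then have "summable (\<lambda>j. real CARD('k) ^ CARD('k) * (real (Suc j) * \<Theta> (real (Suc j))) ^ CARD('k))" by (rule summable_mult)
    also have "(\<lambda>j. real CARD('k) ^ CARD('k) * (real (Suc j) * \<Theta> (real (Suc j))) ^ CARD('k)) = (\<lambda>j. \<psi> (real (Suc j)) ^ CARD('k))"
      unfolding power_mult_distrib[symmetric] by (simp add: \<Theta>_def)
    finally show False using div by simp
  qed
  then have null: "negligible {x :: real ^ 'k. \<exists>T. \<forall>a. T \<le> snd a \<and> 0 < snd a \<longrightarrow> x \<notin> sup_ball (rational_point a) (\<Theta> (real (snd a)))}"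
    (is "negligible ?Bad")
    using \<psi>pos by (intro khintchine_simultaneous \<Theta>anti) (auto simp: \<Theta>_def)
  define N where "N = ?Bad \<inter> {v. \<forall>a. \<bar>v $ a\<bar> \<le> 1}"
  have N: "negligible N" unfolding N_def using null by (rule negligible_subset) auto
  have "\<forall>\<^sub>F r in at_right 0. f r / r ^ (CARD('k) * (CARD('n) + 1)) < 2 * C"
    using lim C by (intro order_tendstoD(2)) auto
  then obtain r0 where r0: "0 < r0" "\<And>r. 0 < r \<Longrightarrow> r < r0 \<Longrightarrow> f r / r ^ (CARD('k) * (CARD('n) + 1)) < 2 * C"
    unfolding eventually_at_right_field by auto
  have flow: "f r \<le> 2 * C * r ^ (CARD('k) * (CARD('n) + 1))" if "0 < r" "r \<le> r0 / 2" for r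
  proof -
    have "f r / r ^ (CARD('k) * (CARD('n) + 1)) < 2 * C" using r0 that by simp
    then show ?thesis using that(1) by (simp only: pos_divide_less_eq zero_less_power less_imp_le)
  qed
  let ?Im = "\<lambda>j. {kernel_param (\<tau> j) v Y | v (Y :: real ^ 'n ^ 'k). v \<in> N \<and> (\<forall>a l. \<bar>Y $ a $ l\<bar> \<le> 1 / 2)}"
  have Im: "hausdorff_measure f (?Im j) = 0" for j
    using C r0(1) by (intro hausdorff_null_kernel_param_image[OF N _ f, where C = "2 * C" and ?r0.0 = "r0 / 2"] flow) (auto simp: N_def)
  have "(low_rank :: (real ^ 'n ^ 'm) set) \<subseteq> W0 \<psi> \<union> (\<Union>j\<in>UNIV. ?Im j)"
  proof
    fix X :: "real ^ 'n ^ 'm" assume X: "X \<in> low_rank"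
    obtain j v and Y :: "real ^ 'n ^ 'k" where jvY: "\<And>a. \<bar>v $ a\<bar> \<le> 1" "\<And>a l. \<bar>Y $ a $ l\<bar> \<le> 1 / 2" "X = kernel_param (\<tau> j) v Y"
      using low_rank_kernel_param[OF X \<tau>] by blast
    show "X \<in> W0 \<psi> \<union> (\<Union>j\<in>UNIV. ?Im j)"
    proof (cases "v \<in> N")
      case True
      then have "X \<in> ?Im j" using jvY(2,3) by blast
      then show ?thesis by blast
    next
      case False
      then have "v \<notin> ?Bad" using jvY(1) by (simp add: N_def)
      then have approx: "\<exists>a. T \<le> snd a \<and> 0 < snd a \<and> v \<in> sup_ball (rational_point a) (\<psi> (real (snd a)) / (real CARD('k) * real (snd a)))" for T
        unfolding \<Theta>_def by blast
      have "kernel_param (\<tau> j) v Y \<in> unit_cube" using X jvY(3) by (simp add: low_rank_def)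
      then have "X \<in> W0 \<psi>" unfolding jvY(3) by (rule kernel_param_mem_W0[OF \<psi> \<tau>(1) _ jvY(1) approx])
      then show ?thesis by blast
    qed
  qed
  then have "hausdorff_measure f (low_rank :: (real ^ 'n ^ 'm) set) \<le> hausdorff_measure f (W0 \<psi> \<union> (\<Union>j\<in>UNIV. ?Im j))"
    by (rule hausdorff_measure_mono)
  also have "\<dots> \<le> hausdorff_measure f (W0 \<psi> :: (real ^ 'n ^ 'm) set)"
    using Im by (intro hausdorff_measure_Un_null hausdorff_null_finite_UN) auto
  finally show "hausdorff_measure f (low_rank :: (real ^ 'n ^ 'm) set) \<le> hausdorff_measure f (W0 \<psi> :: (real ^ 'n ^ 'm) set)" .
qed

section \<open>The case of infinite measure\<close>

text \<open>All parameters in one vector, so that dyadic cubes and planks apply.\<close>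

definition kernel_embedding :: "('m::finite \<Rightarrow> 'k::finite option) \<Rightarrow> real ^ ('k + 'k \<times> 'n::finite) \<Rightarrow> real ^ 'n ^ 'm" where
  "kernel_embedding \<tau> x = kernel_param \<tau> (\<chi> a. x $ Inl a) (\<chi> a l. x $ Inr (a, l))"

text \<open>A cube of parameters on which \<open>v\<close> is close to \<open>0\<close> and the rows of
  \<open>Y\<close> are close to \<open>1 / 4\<close> times distinct unit vectors, the one for row
  \<open>a\<close> at the coordinate \<open>\<iota> a\<close>. The level is \<open>e + 2\<close> because
  \<open>1 / 4\<close> is then the multiple \<open>2 ^ e\<close> of the side.\<close>

definition base_cube :: "('k::finite \<Rightarrow> 'n::finite) \<Rightarrow> nat \<Rightarrow> nat \<times> ('k + 'k \<times> 'n \<Rightarrow> int)" where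
  "base_cube \<iota> e = (e + 2, \<lambda>x. case x of Inl a \<Rightarrow> 0 | Inr (a, l) \<Rightarrow> if l = \<iota> a then 2 ^ e else 0)"

lemma base_cube_bounds:
  fixes x :: "real ^ ('k::finite + 'k \<times> 'n::finite)"
  assumes x: "x \<in> dyadic_cube (base_cube \<iota> e)" and e: "2 * real CARD('k) \<le> 2 ^ e"
  shows "0 \<le> x $ Inl a" "real CARD('k) * x $ Inl a \<le> 1 / 8"
    "0 \<le> x $ Inr (a, l)" "l \<noteq> \<iota> a \<Longrightarrow> real CARD('k) * x $ Inr (a, l) \<le> 1 / 8"
    "1 / 4 \<le> x $ Inr (a, \<iota> a)" "x $ Inr (a, l) \<le> 1 / 2"
proof -
  let ?k = "real CARD('k)" and ?p = "(2::real) ^ e"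
  have k: "1 \<le> ?k" by (simp add: Suc_leI)
  have p: "1 < ?p" using k e by linarith
  have Inl: "0 \<le> 4 * ?p * x $ Inl a" "4 * ?p * x $ Inl a \<le> 1"
    using x by (auto simp: dyadic_cube_def base_cube_def mult_ac dest!: spec[of _ "Inl a"])
  have Inr: "of_int (if l = \<iota> a then 2 ^ e else 0) \<le> 4 * ?p * x $ Inr (a, l)"
    "4 * ?p * x $ Inr (a, l) \<le> of_int (if l = \<iota> a then 2 ^ e else 0) + 1" for l
    using x by (auto simp: dyadic_cube_def base_cube_def mult_ac dest!: spec[of _ "Inr (a, l)"] split: if_splits)
  have small: "0 \<le> y \<and> ?k * y \<le> 1 / 8" if "0 \<le> 4 * ?p * y" "4 * ?p * y \<le> 1" for y
  proof -
    have y: "0 \<le> y" using that(1) p by (simp add: zero_le_mult_iff)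
    then have "2 * ?k * y \<le> ?p * y" using e by (intro mult_right_mono) auto
    then show ?thesis using that(2) y by simp
  qed
  show "0 \<le> x $ Inl a" "?k * x $ Inl a \<le> 1 / 8" using small[OF Inl] by auto
  show s: "?k * x $ Inr (a, l) \<le> 1 / 8" if "l \<noteq> \<iota> a" using small[of "x $ Inr (a, l)"] Inr[of l] that by auto
  have "?p * 1 \<le> ?p * (4 * x $ Inr (a, \<iota> a))" using Inr(1)[of "\<iota> a"] by (simp add: mult_ac)
  then have "1 \<le> 4 * x $ Inr (a, \<iota> a)" by (rule mult_left_le_imp_le) (use p in simp)
  then show big: "1 / 4 \<le> x $ Inr (a, \<iota> a)" by simp
  have "?p * (4 * x $ Inr (a, \<iota> a)) = 4 * ?p * x $ Inr (a, \<iota> a)" by simp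
  also have "\<dots> \<le> ?p + 1" using Inr(2)[of "\<iota> a"] by simp
  also have "\<dots> \<le> ?p * 2" using p by simp
  finally have "?p * (4 * x $ Inr (a, \<iota> a)) \<le> ?p * 2" .
  then have "4 * x $ Inr (a, \<iota> a) \<le> 2" by (rule mult_left_le_imp_le) (use p in simp)
  then have big2: "x $ Inr (a, \<iota> a) \<le> 1 / 2" by simp
  have s0: "0 \<le> x $ Inr (a, l)" if "l \<noteq> \<iota> a" using small[of "x $ Inr (a, l)"] Inr[of l] that by auto
  show "0 \<le> x $ Inr (a, l)" using s0 big by (cases "l = \<iota> a") auto
  show "x $ Inr (a, l) \<le> 1 / 2"
  proof (cases "l = \<iota> a")
    case False
    have "1 * x $ Inr (a, l) \<le> ?k * x $ Inr (a, l)" using k s0[OF False] by (intro mult_right_mono) auto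
    then show ?thesis using s[OF False] by simp
  qed (use big2 in simp)
qed

lemma kernel_embedding_mem_unit_cube:
  fixes x :: "real ^ ('k::finite + 'k \<times> 'n::finite)" and \<tau> :: "'m::finite \<Rightarrow> 'k option"
  assumes x: "x \<in> dyadic_cube (base_cube \<iota> e)" and e: "2 * real CARD('k) \<le> 2 ^ e"
  shows "kernel_embedding \<tau> x \<in> unit_cube"
proof -
  note b = base_cube_bounds[OF x e]
  have "kernel_embedding \<tau> x $ i $ l \<in> {- 1 / 2..1 / 2}" for i l
  proof (cases "\<tau> i")
    case None
    have "(\<Sum>a\<in>UNIV. x $ Inl a * x $ Inr (a, l)) \<le> (\<Sum>a\<in>(UNIV::'k set). 1 / 8 / real CARD('k) * (1 / 2))"
      using b by (intro sum_mono mult_mono) (auto simp: pos_le_divide_eq mult_ac)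
    moreover have "0 \<le> (\<Sum>a\<in>UNIV. x $ Inl a * x $ Inr (a, l))" using b by (intro sum_nonneg mult_nonneg_nonneg) auto
    ultimately show ?thesis using None by (simp add: kernel_embedding_def kernel_param_def)
  next
    case (Some a)
    then show ?thesis using b(3)[of a l] b(6)[of a l] by (simp add: kernel_embedding_def kernel_param_def)
  qed
  then show ?thesis by (simp add: unit_cube_def)
qed

text \<open>The rows \<open>Y\<close> are entries of the matrix. For \<open>v\<close>, compare the dependent
  rows at the coordinate \<open>\<iota> b\<close>, where \<open>b\<close> is the index at which
  \<open>v\<close> changes most: the contribution of \<open>b\<close> dominates those of all other
  indices.\<close>

lemma kernel_embedding_inverse_lipschitz:
  fixes x y :: "real ^ ('k::finite + 'k \<times> 'n::finite)" and \<tau> :: "'m::finite \<Rightarrow> 'k option"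
  assumes \<tau>: "bij \<tau>" and \<iota>: "inj \<iota>" and e: "2 * real CARD('k) \<le> 2 ^ e"
    and x: "x \<in> dyadic_cube (base_cube \<iota> e)" and y: "y \<in> dyadic_cube (base_cube \<iota> e)"
    and d: "\<And>i l. \<bar>kernel_embedding \<tau> x $ i $ l - kernel_embedding \<tau> y $ i $ l\<bar> \<le> \<delta>"
  shows "\<bar>x $ p - y $ p\<bar> \<le> 16 * \<delta>"
proof -
  let ?k = "real CARD('k)"
  have k: "0 < ?k" by simp
  note bx = base_cube_bounds[OF x e] and by' = base_cube_bounds[OF y e]
  have Inr: "\<bar>x $ Inr (a, l) - y $ Inr (a, l)\<bar> \<le> \<delta>" for a l
  proof -
    obtain i where "\<tau> i = Some a" using bij_pointE[OF \<tau>] by metis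
    then show ?thesis using d[of i l] by (simp add: kernel_embedding_def kernel_param_def)
  qed
  have \<delta>: "0 \<le> \<delta>" using Inr[of undefined undefined] by linarith
  define w where "w a = x $ Inl a - y $ Inl a" for a
  have row: "\<bar>\<Sum>a\<in>UNIV. w a * x $ Inr (a, l)\<bar> \<le> 2 * \<delta>" for l
  proof -
    obtain i where "\<tau> i = None" using bij_pointE[OF \<tau>] by metis
    then have 1: "\<bar>(\<Sum>a\<in>UNIV. y $ Inl a * y $ Inr (a, l)) - (\<Sum>a\<in>UNIV. x $ Inl a * x $ Inr (a, l))\<bar> \<le> \<delta>"
      using d[of i l] by (simp add: kernel_embedding_def kernel_param_def)
    have "\<bar>\<Sum>a\<in>UNIV. y $ Inl a * (x $ Inr (a, l) - y $ Inr (a, l))\<bar> \<le> (\<Sum>a\<in>UNIV. \<bar>y $ Inl a * (x $ Inr (a, l) - y $ Inr (a, l))\<bar>)"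
      by (rule sum_abs)
    also have "\<dots> \<le> (\<Sum>a\<in>(UNIV::'k set). 1 / 8 / ?k * \<delta>)"
      unfolding abs_mult using by' Inr by (intro sum_mono mult_mono) (auto simp: pos_le_divide_eq mult_ac)
    also have "\<dots> \<le> \<delta>" using \<delta> by simp
    finally have 2: "\<bar>\<Sum>a\<in>UNIV. y $ Inl a * (x $ Inr (a, l) - y $ Inr (a, l))\<bar> \<le> \<delta>" .
    have "(\<Sum>a\<in>UNIV. w a * x $ Inr (a, l)) = (\<Sum>a\<in>UNIV. x $ Inl a * x $ Inr (a, l)) - (\<Sum>a\<in>UNIV. y $ Inl a * y $ Inr (a, l))
        - (\<Sum>a\<in>UNIV. y $ Inl a * (x $ Inr (a, l) - y $ Inr (a, l)))"
      unfolding sum_subtractf[symmetric] by (intro sum.cong refl) (simp add: w_def algebra_simps)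
    then show ?thesis using 1 2 by linarith
  qed
  have Inl: "\<bar>w a\<bar> \<le> 16 * \<delta>" for a
  proof -
    have "Max ((\<lambda>b. \<bar>w b\<bar>) ` UNIV) \<in> (\<lambda>b. \<bar>w b\<bar>) ` UNIV" by (intro Max_in) auto
    then obtain b where "Max ((\<lambda>b. \<bar>w b\<bar>) ` UNIV) = \<bar>w b\<bar>" by (elim imageE)
    then have b: "\<bar>w c\<bar> \<le> \<bar>w b\<bar>" for c by (metis Max_ge finite finite_imageI rangeI)
    have "(\<Sum>c\<in>UNIV. w c * x $ Inr (c, \<iota> b)) = w b * x $ Inr (b, \<iota> b) + (\<Sum>c\<in>UNIV - {b}. w c * x $ Inr (c, \<iota> b))"
      by (rule sum.remove) auto
    then have "\<bar>w b * x $ Inr (b, \<iota> b)\<bar> \<le> 2 * \<delta> + \<bar>\<Sum>c\<in>UNIV - {b}. w c * x $ Inr (c, \<iota> b)\<bar>"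
      using row[of "\<iota> b"] by linarith
    also have "\<bar>\<Sum>c\<in>UNIV - {b}. w c * x $ Inr (c, \<iota> b)\<bar> \<le> (\<Sum>c\<in>UNIV - {b}. \<bar>w c * x $ Inr (c, \<iota> b)\<bar>)" by (rule sum_abs)
    also have "\<dots> \<le> (\<Sum>c\<in>UNIV - {b}. \<bar>w b\<bar> * (1 / 8 / ?k))"
    proof (rule sum_mono)
      fix c assume "c \<in> UNIV - {b}"
      then have "\<iota> b \<noteq> \<iota> c" using \<iota> by (auto dest: injD)
      then have "x $ Inr (c, \<iota> b) \<le> 1 / 8 / ?k" using bx(4)[of "\<iota> b" c] k by (simp add: pos_le_divide_eq mult_ac)
      then show "\<bar>w c * x $ Inr (c, \<iota> b)\<bar> \<le> \<bar>w b\<bar> * (1 / 8 / ?k)"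
        unfolding abs_mult using b[of c] bx(3)[of c "\<iota> b"] by (intro mult_mono) auto
    qed
    also have "\<dots> \<le> (\<Sum>c\<in>(UNIV::'k set). \<bar>w b\<bar> * (1 / 8 / ?k))" by (intro sum_mono2) auto
    also have "\<dots> = \<bar>w b\<bar> / 8" by simp
    finally have "\<bar>w b * x $ Inr (b, \<iota> b)\<bar> \<le> 2 * \<delta> + \<bar>w b\<bar> / 8" by simp
    moreover have "\<bar>w b\<bar> * (1 / 4) \<le> \<bar>w b * x $ Inr (b, \<iota> b)\<bar>"
      unfolding abs_mult using bx(5)[of b] by (intro mult_left_mono) auto
    ultimately have "\<bar>w b\<bar> \<le> 16 * \<delta>" by linarith
    then show ?thesis using b[of a] by linarith
  qed
  show ?thesis
  proof (cases p)
    case (Inl a)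
    then show ?thesis using \<open>\<And>a. \<bar>w a\<bar> \<le> 16 * \<delta>\<close>[of a] by (simp add: w_def)
  next
    case (Inr q)
    then show ?thesis using \<open>\<And>a l. \<bar>x $ Inr (a, l) - y $ Inr (a, l)\<bar> \<le> \<delta>\<close>[of "fst q" "snd q"] \<delta> by simp
  qed
qed

text \<open>Used for passing from a cover by balls, indexed by \<open>i\<close>, to the family of all the
  dyadic cubes \<open>A i\<close> that replace these balls; the sets \<open>A i\<close> may overlap.\<close>

lemma infsum_le_of_cover:
  fixes g :: "'b \<Rightarrow> real" and h :: "'a \<Rightarrow> real"
  assumes gI: "g summable_on I" "\<And>i. i \<in> I \<Longrightarrow> 0 \<le> g i" and K: "0 \<le> K"
    and A: "\<And>i. i \<in> I \<Longrightarrow> finite (A i)" "\<And>i. i \<in> I \<Longrightarrow> real (card (A i)) \<le> K"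
    and h: "\<And>i a. i \<in> I \<Longrightarrow> a \<in> A i \<Longrightarrow> 0 \<le> h a \<and> h a \<le> g i"
  shows "h summable_on (\<Union>i\<in>I. A i)" "infsum h (\<Union>i\<in>I. A i) \<le> K * infsum g I"
proof -
  have bound: "sum h F \<le> K * infsum g I" if F: "finite F" "F \<subseteq> (\<Union>i\<in>I. A i)" for F
  proof -
    have "\<forall>a\<in>F. \<exists>i. i \<in> I \<and> a \<in> A i" using F(2) by blast
    from bchoice[OF this] obtain q where q: "\<And>a. a \<in> F \<Longrightarrow> q a \<in> I \<and> a \<in> A (q a)" by blast
    have "sum h F = (\<Sum>i\<in>q ` F. \<Sum>a | a \<in> F \<and> q a = i. h a)" by (rule sum.image_gen[OF F(1)])
    also have "\<dots> \<le> (\<Sum>i\<in>q ` F. K * g i)"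
    proof (rule sum_mono)
      fix i assume "i \<in> q ` F"
      then have i: "i \<in> I" using q by auto
      have sub: "{a. a \<in> F \<and> q a = i} \<subseteq> A i" using q by auto
      have "(\<Sum>a | a \<in> F \<and> q a = i. h a) \<le> (\<Sum>a | a \<in> F \<and> q a = i. g i)"
        using sub h[OF i] by (intro sum_mono) auto
      also have "\<dots> = real (card {a. a \<in> F \<and> q a = i}) * g i" by simp
      also have "\<dots> \<le> real (card (A i)) * g i"
        using card_mono[OF A(1)[OF i] sub] gI(2)[OF i] by (intro mult_right_mono) auto
      also have "\<dots> \<le> K * g i" using A(2)[OF i] gI(2)[OF i] by (intro mult_right_mono)
      finally show "(\<Sum>a | a \<in> F \<and> q a = i. h a) \<le> K * g i" .
    qed
    also have "\<dots> = K * sum g (q ` F)" by (simp add: sum_distrib_left)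
    also have "\<dots> \<le> K * infsum g I"
      using F(1) q gI K by (intro mult_left_mono finite_sum_le_infsum) auto
    finally show ?thesis .
  qed
  have nonneg: "0 \<le> h a" if "a \<in> (\<Union>i\<in>I. A i)" for a using that h by blast
  show "h summable_on (\<Union>i\<in>I. A i)"
    using bound by (intro nonneg_bdd_above_summable_on nonneg bdd_aboveI[of _ "K * infsum g I"]) auto
  then show "infsum h (\<Union>i\<in>I. A i) \<le> K * infsum g I" by (rule infsum_le_finite_sums) (rule bound)
qed

text \<open>Replace each ball of a cover of \<open>W0 \<psi>\<close> by the boundedly many dyadic cubes of
  comparable side that meet its preimage in the base cube. If their total cost were less than the number of
  cubes of level \<open>N\<close> in the base cube times the cost of one of them, one of these cubes would be
  deficient and would contain a point whose image is in \<open>W0 \<psi>\<close> but in no ball of the cover.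
  As \<open>f r / r ^ (k (n + 1))\<close> tends to infinity, so does this lower bound.\<close>

theorem hausdorff_measure_W0_eq_infinity:
  fixes \<psi> f :: "real \<Rightarrow> real" and \<tau> :: "'m::finite \<Rightarrow> 'k::finite option" and \<iota> :: "'k \<Rightarrow> 'n::finite"
  assumes \<psi>: "approximating_function \<psi>" and f: "\<And>r. 0 < r \<Longrightarrow> 0 < f r" and fmono: "mono_on {0<..} f"
    and \<tau>: "bij \<tau>" and \<iota>: "inj \<iota>"
    and incr: "mono_on {0<..} (\<lambda>r. f r / r ^ (CARD('k) * CARD('n)))"
    and decr: "antimono_on {0<..} (\<lambda>r. f r / r ^ (CARD('k) * (CARD('n) + 1)))"
    and lim: "filterlim (\<lambda>r. f r / r ^ (CARD('k) * (CARD('n) + 1))) at_top (at_right 0)"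
    and div: "\<not> summable (\<lambda>j. let r = real (Suc j) in f (\<psi> r / r) / (\<psi> r / r) ^ (CARD('k) * CARD('n)) * r ^ CARD('k))"
  shows "hausdorff_measure f (W0 \<psi> :: (real ^ 'n ^ 'm) set) = \<infinity>"
proof -
  let ?k = "CARD('k)" and ?n = "CARD('n)"
  define d where "d = CARD('k + 'k \<times> 'n)"
  have d: "d = ?k * (?n + 1)" "d = ?k + ?k * ?n" by (simp_all add: d_def CARD_sum card_prod)
  have \<psi>pos: "0 < \<psi> r" if "0 < r" for r using \<psi> that by (auto simp: approximating_function_def)
  have \<psi>anti: "antimono_on {0<..} \<psi>" using \<psi> by (simp add: approximating_function_def)
  define F where "F r = f r / r ^ (?k * ?n)" for r
  have Fpos: "0 < F r" if "0 < r" for r using f that by (simp add: F_def)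
  have Fmono: "mono_on {0<..} F" using incr by (simp add: F_def[abs_def])
  have Fk: "antimono_on {0<..} (\<lambda>r. F r / r ^ ?k)"
    using decr by (simp add: F_def power_add mult_ac)
  define \<Theta> where "\<Theta> r = \<psi> r / (real ?k * r)" for r
  have \<Theta>pos: "0 < \<Theta> r" if "0 < r" for r using \<psi>pos that by (simp add: \<Theta>_def)
  have \<Theta>anti: "antimono_on {0<..} \<Theta>"
    using \<psi>anti \<psi>pos unfolding \<Theta>_def monotone_on_def
    by (auto intro!: frac_le less_imp_le[OF \<psi>pos])
  have k1: "1 \<le> real ?k" by (simp add: Suc_leI)
  have div': "\<not> summable (\<lambda>j. real (Suc j) ^ ?k * F (\<Theta> (real (Suc j))))"
  proof
    assume s: "summable (\<lambda>j. real (Suc j) ^ ?k * F (\<Theta> (real (Suc j))))"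
    have "summable (\<lambda>j. real (Suc j) ^ ?k * F (\<psi> (real (Suc j)) / real (Suc j)))"
    proof (rule summable_comparison_test'[OF summable_mult[OF s, of "real ?k ^ ?k"]])
      fix j :: nat
      define r where "r = real (Suc j)"
      have r: "0 < r" by (simp add: r_def)
      let ?y = "\<psi> r / r"
      have y: "0 < ?y" using \<psi>pos r by simp
      have \<Theta>y: "\<Theta> r = ?y / real ?k" by (simp add: \<Theta>_def)
      have "?y / real ?k \<le> ?y" using k1 y mult_left_mono[of 1 "real ?k" ?y] by (simp only: pos_divide_le_eq) simp
      then have "F ?y / ?y ^ ?k \<le> F (\<Theta> r) / \<Theta> r ^ ?k"
        using y \<Theta>pos[OF r] by (intro monotone_onD[OF Fk]) (auto simp: \<Theta>y)
      then have "F ?y \<le> real ?k ^ ?k * F (\<Theta> r)"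
      proof -
        have "u \<le> c ^ n * v" if "u / y ^ n \<le> v / (y / c) ^ n" "0 < y" "0 < c" for u v y c :: real and n
          using that by (simp add: power_divide divide_le_cancel mult.commute)
        from this[OF \<open>F ?y / ?y ^ ?k \<le> F (\<Theta> r) / \<Theta> r ^ ?k\<close>[unfolded \<Theta>y] y] show ?thesis
          unfolding \<Theta>y using k1 by simp
      qed
      then have "r ^ ?k * F ?y \<le> r ^ ?k * (real ?k ^ ?k * F (\<Theta> r))" using r by (intro mult_left_mono) auto
      then show "norm (real (Suc j) ^ ?k * F (\<psi> (real (Suc j)) / real (Suc j))) \<le> real ?k ^ ?k * (real (Suc j) ^ ?k * F (\<Theta> (real (Suc j))))"
        using r Fpos[OF y] unfolding r_def[symmetric] by (simp add: abs_mult mult_ac)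
    qed
    then show False using div by (simp add: F_def Let_def mult.commute)
  qed
  define w where "w s = F (1 / 2 ^ s) / (2 ^ s) ^ CARD('k \<times> 'n)" for s :: nat
  have wf: "w s = f (1 / 2 ^ s)" for s by (simp add: w_def F_def card_prod power_divide)
  have wpos: "0 < w s" for s by (simp add: wf f)
  obtain e :: nat where e: "2 * real ?k \<le> 2 ^ e"
    using real_arch_pow[of 2 "2 * real ?k"] by (auto intro: less_imp_le)
  define Q0 :: "nat \<times> ('k + 'k \<times> 'n \<Rightarrow> int)" where "Q0 = base_cube \<iota> e"
  (* If a matrix moves by at most \<delta> < 2 / 2 ^ s, its parameters move by at most 16 * \<delta>; in units of the
     side 1 / 2 ^ s this is less than 32, and the corners of the cubes vary by less than 34. *)
  define K where "K = (2 * 34 + 1 :: real) ^ d"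
  have K: "0 < K" by (simp add: K_def)
  (* The factor 2 makes the final comparison strict. *)
  define M where "M N = (2 ^ (N - fst Q0)) ^ d * w N / (2 * K)" for N
  have key: "ennreal (M N) \<le> hausdorff_premeasure f (1 / 2 ^ N) (W0 \<psi> :: (real ^ 'n ^ 'm) set)" if N: "fst Q0 \<le> N" for N
    unfolding hausdorff_premeasure_def
  proof (rule INF_greatest, clarify, rule ccontr)
    fix I and B :: "nat \<Rightarrow> (real ^ 'n ^ 'm) set"
    assume cov: "ball_cover (1 / 2 ^ N) (W0 \<psi>) I B"
      and "\<not> ennreal (M N) \<le> (\<Sum>\<^sub>\<infinity>i\<in>I. ennreal (f (diameter (B i))))"
    then have less: "(\<Sum>\<^sub>\<infinity>i\<in>I. ennreal (f (diameter (B i)))) < ennreal (M N)" by simp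
    define \<delta> where "\<delta> i = diameter (B i)" for i
    have ballB: "\<exists>c r. 0 < r \<and> B i = ball c r \<and> \<delta> i = 2 * r \<and> \<delta> i \<le> 1 / 2 ^ N" if "i \<in> I" for i
      using cov that unfolding ball_cover_def \<delta>_def by fastforce
    have \<delta>: "0 < \<delta> i" "\<delta> i \<le> 1 / 2 ^ N" if "i \<in> I" for i using ballB[OF that] by auto
    define g where "g i = f (\<delta> i)" for i
    have gpos: "0 \<le> g i" if "i \<in> I" for i using f[OF \<delta>(1)[OF that]] by (simp add: g_def)
    have Mpos: "0 \<le> M N" using wpos[of N] K by (simp add: M_def)
    have gfin: "sum g G < M N" if G: "finite G" "G \<subseteq> I" for G
    proof -
      have "ennreal (sum g G) = (\<Sum>i\<in>G. ennreal (g i))" using G gpos by (intro sum_ennreal[symmetric]) auto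
      also have "\<dots> = (\<Sum>\<^sub>\<infinity>i\<in>G. ennreal (g i))" using G by simp
      also have "\<dots> \<le> (\<Sum>\<^sub>\<infinity>i\<in>I. ennreal (g i))"
        using G by (intro infsum_mono_neutral nonneg_summable_on_complete) auto
      also have "\<dots> < ennreal (M N)" using less by (simp add: g_def \<delta>_def)
      finally show ?thesis using G gpos by (subst (asm) ennreal_less_iff) (auto intro!: sum_nonneg)
    qed
    have gsum: "g summable_on I"
      using gfin gpos by (intro nonneg_bdd_above_summable_on bdd_aboveI[of _ "M N"]) (auto intro: less_imp_le)
    have gM: "infsum g I \<le> M N" by (rule infsum_le_finite_sums[OF gsum less_imp_le[OF gfin]])
    have "\<forall>i\<in>I. \<exists>s::nat. 1 / 2 ^ s \<le> \<delta> i \<and> \<delta> i < 2 / 2 ^ s"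
    proof
      fix i assume i: "i \<in> I"
      have "1 / 2 ^ N \<le> (1::real)" by simp
      then have "\<delta> i \<le> 1" using \<delta>(2)[OF i] by linarith
      then obtain t :: nat where t: "4 / 2 ^ t \<le> \<delta> i" "\<delta> i < 8 / 2 ^ t" using exists_dyadic_scale[OF \<delta>(1)[OF i]] by blast
      have "4 / 2 ^ t \<le> (1::real)" using t(1) \<open>\<delta> i \<le> 1\<close> by linarith
      then have "(2::real) ^ 2 \<le> 2 ^ t" by (simp add: divide_le_eq)
      then have "2 \<le> t" by (simp only: power_increasing_iff)
      then obtain s where "t = s + 2" by (metis le_add_diff_inverse2)
      then show "\<exists>s::nat. 1 / 2 ^ s \<le> \<delta> i \<and> \<delta> i < 2 / 2 ^ s" using t by (intro exI[of _ s]) (simp add: power_add)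
    qed
    from bchoice[OF this] obtain s where s: "\<And>i. i \<in> I \<Longrightarrow> 1 / 2 ^ s i \<le> \<delta> i" "\<And>i. i \<in> I \<Longrightarrow> \<delta> i < 2 / 2 ^ s i" by blast
    have sN: "N \<le> s i" if i: "i \<in> I" for i
    proof -
      have "1 / 2 ^ s i \<le> 1 / (2::real) ^ N" using s(1)[OF i] \<delta>(2)[OF i] by linarith
      then have "(2::real) ^ N \<le> 2 ^ s i" by (simp add: field_simps)
      then show ?thesis by simp
    qed
    (* The dyadic cubes that replace the ball B i: those of comparable size that meet its preimage. *)
    define A where "A i = {(s i, z) | z. \<exists>x. x \<in> dyadic_cube (s i, z) \<and> x \<in> dyadic_cube Q0 \<and> kernel_embedding \<tau> x \<in> B i}" for i
    have Afin: "finite (A i) \<and> real (card (A i)) \<le> K" if i: "i \<in> I" for i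
    proof (cases "\<exists>x. x \<in> dyadic_cube Q0 \<and> kernel_embedding \<tau> x \<in> B i")
      case True
      then obtain x0 where x0: "x0 \<in> dyadic_cube Q0" "kernel_embedding \<tau> x0 \<in> B i" by blast
      let ?Z = "{z :: 'k + 'k \<times> 'n \<Rightarrow> int. \<forall>p. \<bar>of_int (z p) - (2 ^ s i *\<^sub>R x0) $ p\<bar> < 34}"
      have AZ: "A i \<subseteq> Pair (s i) ` ?Z"
      proof
        fix Q assume "Q \<in> A i"
        then obtain z x where Q: "Q = (s i, z)" "x \<in> dyadic_cube (s i, z)" "x \<in> dyadic_cube Q0" "kernel_embedding \<tau> x \<in> B i"
          unfolding A_def by blast
        obtain c r where cr: "B i = ball c r" "\<delta> i = 2 * r" using ballB[OF i] by blast
        have "dist (kernel_embedding \<tau> x) (kernel_embedding \<tau> x0) \<le> \<delta> i"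
          using Q(4) x0(2) dist_triangle3[of "kernel_embedding \<tau> x" "kernel_embedding \<tau> x0" c] by (simp add: cr)
        then have nrm: "norm (kernel_embedding \<tau> x - kernel_embedding \<tau> x0) \<le> \<delta> i" by (simp add: dist_norm)
        have "\<bar>kernel_embedding \<tau> x $ a $ l - kernel_embedding \<tau> x0 $ a $ l\<bar> \<le> \<delta> i" for a l
        proof -
          have "\<bar>(kernel_embedding \<tau> x - kernel_embedding \<tau> x0) $ a $ l\<bar> \<le> norm ((kernel_embedding \<tau> x - kernel_embedding \<tau> x0) $ a)" by (rule component_le_norm_cart)
          also have "\<dots> \<le> norm (kernel_embedding \<tau> x - kernel_embedding \<tau> x0)" by (rule Finite_Cartesian_Product.norm_nth_le)
          finally show ?thesis using nrm by simp
        qed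
        then have close: "\<bar>x $ p - x0 $ p\<bar> \<le> 16 * \<delta> i" for p
          using Q(3) x0(1) unfolding Q0_def by (intro kernel_embedding_inverse_lipschitz[OF \<tau> \<iota> e]) auto
        have "\<bar>of_int (z p) - (2 ^ s i *\<^sub>R x0) $ p\<bar> < 34" for p
        proof -
          have z: "of_int (z p) \<le> 2 ^ s i * x $ p" "2 ^ s i * x $ p \<le> of_int (z p) + 1" using Q(2) by (auto simp: dyadic_cube_def)
          have "\<bar>2 ^ s i * x $ p - 2 ^ s i * x0 $ p\<bar> = 2 ^ s i * \<bar>x $ p - x0 $ p\<bar>"
            by (simp add: abs_mult flip: right_diff_distrib)
          also have "\<dots> \<le> 2 ^ s i * (16 * \<delta> i)" using close by (intro mult_left_mono) auto
          also have "\<dots> < 2 ^ s i * (16 * (2 / 2 ^ s i))" using s(2)[OF i] by (intro mult_strict_left_mono) auto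
          also have "\<dots> = 32" by simp
          finally show ?thesis using z by (simp add: abs_less_iff)
        qed
        then show "Q \<in> Pair (s i) ` ?Z" using Q(1) by blast
      qed
      have Z: "finite ?Z" "real (card ?Z) \<le> (2 * 34 + 1) ^ CARD('k + 'k \<times> 'n)"
        by (rule card_int_vectors_le, simp)+
      have "finite (A i)" using AZ Z(1) by (rule finite_subset[OF _ finite_imageI])
      moreover have "card (A i) \<le> card ?Z"
        using card_mono[OF finite_imageI[OF Z(1)] AZ] card_image_le[OF Z(1), of "Pair (s i)"] by (rule order_trans)
      ultimately have "finite (A i)" "real (card (A i)) \<le> real (card ?Z)" by simp_all
      then show ?thesis using Z(2) unfolding K_def d_def by linarith
    next
      case False
      then have "A i = {}" by (auto simp: A_def)
      then show ?thesis using K by simp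
    qed
    define \<Q> where "\<Q> = (\<Union>i\<in>I. A i)"
    have wA: "0 \<le> w (fst Q) \<and> w (fst Q) \<le> g i" if "i \<in> I" "Q \<in> A i" for i Q
    proof -
      have "fst Q = s i" using that(2) by (auto simp: A_def)
      moreover have "f (1 / 2 ^ s i) \<le> f (\<delta> i)" using s(1) \<delta>(1) that(1) by (intro mono_onD[OF fmono]) auto
      ultimately show ?thesis using wpos[of "s i"] by (simp add: wf g_def)
    qed
    have \<Q>sum: "(\<lambda>Q. w (fst Q)) summable_on \<Q>" "infsum (\<lambda>Q. w (fst Q)) \<Q> \<le> K * infsum g I"
      unfolding \<Q>_def using K Afin wA
      by (intro infsum_le_of_cover[OF gsum gpos]; auto intro: less_imp_le)+
    have \<Q>level: "N \<le> fst Q" if "Q \<in> \<Q>" for Q using that sN by (auto simp: \<Q>_def A_def)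
    define L where "L = {z. subcube (N, z) Q0}"
    have L: "finite L" "card L = (2 ^ (N - fst Q0)) ^ d" using subcubes_at_level[OF N] by (simp_all add: L_def d_def)
    have "\<exists>z\<in>L. infsum (\<lambda>Q. w (fst Q)) {Q\<in>\<Q>. subcube Q (N, z)} < w N"
    proof (rule ccontr)
      assume "\<not> ?thesis"
      then have "(\<Sum>z\<in>L. w N) \<le> (\<Sum>z\<in>L. infsum (\<lambda>Q. w (fst Q)) {Q\<in>\<Q>. subcube Q (N, z)})"
        by (intro sum_mono) (auto simp: not_less)
      also have "\<dots> \<le> infsum (\<lambda>Q. w (fst Q)) \<Q>"
        using L(1) \<Q>sum(1) by (intro sum_infsum_disjoint_le) (auto simp: disjoint_family_on_def subcube_def less_imp_le[OF wpos])
      also have "\<dots> \<le> K * infsum g I" by (rule \<Q>sum(2))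
      also have "\<dots> \<le> K * M N" using gM K by (intro mult_left_mono) auto
      also have "\<dots> = (\<Sum>z\<in>L. w N) / 2" using K L(2) by (simp add: M_def)
      finally show False using L(2) wpos[of N] by simp
    qed
    then obtain z where z: "z \<in> L" "infsum (\<lambda>Q. w (fst Q)) {Q\<in>\<Q>. subcube Q (N, z)} < w N" by blast
    have "deficient w \<Q> (N, z)"
      unfolding deficient_def
    proof (intro conjI ballI notI)
      fix Q assume Q: "Q \<in> \<Q>" "subcube (N, z) Q"
      then have "Q = (N, z)" using \<Q>level[OF Q(1)] subcube_same_level[OF Q(2)] by (simp add: subcube_def)
      then have "sum (\<lambda>Q. w (fst Q)) {(N, z)} \<le> infsum (\<lambda>Q. w (fst Q)) {Q\<in>\<Q>. subcube Q (N, z)}"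
        using Q(1) subcube_refl \<Q>sum(1) wpos
        by (intro finite_sum_le_infsum summable_on_subset_banach[OF \<Q>sum(1)]) (auto intro: less_imp_le)
      then show False using z(2) by simp
    qed (use z(2) in simp)
    then obtain x where x: "x \<in> dyadic_cube (N, z)" "\<And>n. x \<in> plank \<Theta> n" "\<And>s. \<exists>z. x \<in> dyadic_cube (s, z) \<and> (s, z) \<notin> \<Q>"
      using limsup_planks_meet_deficient_cube[OF Fpos Fmono Fk \<Theta>pos \<Theta>anti div' w_def \<Q>sum(1)] by blast
    have xQ0: "x \<in> dyadic_cube Q0" using x(1) z(1) dyadic_cube_mono[of "(N, z)" Q0] by (auto simp: L_def)
    have "kernel_embedding \<tau> x \<in> W0 \<psi>"
      unfolding kernel_embedding_def
    proof (rule kernel_param_mem_W0[OF \<psi> \<tau>])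
      show "kernel_param \<tau> (\<chi> a. x $ Inl a) (\<chi> a l. x $ Inr (a, l)) \<in> unit_cube"
        using kernel_embedding_mem_unit_cube[OF xQ0[unfolded Q0_def] e] by (simp add: kernel_embedding_def)
      show "\<bar>(\<chi> a. x $ Inl a) $ a\<bar> \<le> 1" for a
      proof -
        have "0 \<le> x $ Inl a" "real ?k * x $ Inl a \<le> 1 / 8" using base_cube_bounds(1,2)[OF xQ0[unfolded Q0_def] e] by auto
        then show ?thesis using k1 mult_right_mono[of 1 "real ?k" "x $ Inl a"] by simp
      qed
      show "\<exists>a. T \<le> snd a \<and> 0 < snd a \<and> (\<chi> a. x $ Inl a) \<in> sup_ball (rational_point a) (\<psi> (real (snd a)) / (real ?k * real (snd a)))" for T
        using x(2)[of T] unfolding plank_def \<Theta>_def sup_ball_def by simp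
    qed
    then obtain i where i: "i \<in> I" "kernel_embedding \<tau> x \<in> B i" using cov by (auto simp: ball_cover_def)
    obtain y where y: "x \<in> dyadic_cube (s i, y)" "(s i, y) \<notin> \<Q>" using x(3) by blast
    have "(s i, y) \<in> A i" using y(1) xQ0 i(2) by (auto simp: A_def)
    then show False using y(2) i(1) by (auto simp: \<Q>_def)
  qed
  have "filterlim (\<lambda>N. 1 / 2 ^ N) (at_right (0::real)) sequentially"
    unfolding filterlim_at by (auto intro!: LIMSEQ_divide_realpow_zero always_eventually)
  then have lim2: "filterlim (\<lambda>N. f (1 / 2 ^ N) / (1 / 2 ^ N) ^ (?k * (?n + 1))) at_top sequentially"
    by (rule filterlim_compose[OF lim])
  have "B \<le> hausdorff_measure f (W0 \<psi> :: (real ^ 'n ^ 'm) set)" if B: "B = ennreal b" "0 \<le> b" for B b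
  proof -
    have "\<forall>\<^sub>F N in sequentially. b * (2 * K) * (2 ^ fst Q0) ^ d \<le> f (1 / 2 ^ N) / (1 / 2 ^ N) ^ (?k * (?n + 1))"
      using lim2 by (simp only: filterlim_at_top)
    then have "\<forall>\<^sub>F N in sequentially. fst Q0 \<le> N \<and> b * (2 * K) * (2 ^ fst Q0) ^ d \<le> f (1 / 2 ^ N) / (1 / 2 ^ N) ^ (?k * (?n + 1))"
      using eventually_ge_at_top by eventually_elim auto
    then obtain N where N: "fst Q0 \<le> N" "b * (2 * K) * (2 ^ fst Q0) ^ d \<le> f (1 / 2 ^ N) / (1 / 2 ^ N) ^ (?k * (?n + 1))"
      by (auto simp: eventually_sequentially)
    have "((2::real) ^ N) ^ d = (2 ^ fst Q0) ^ d * (2 ^ (N - fst Q0)) ^ d"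
      using N(1) by (simp flip: power_mult_distrib power_add)
    then have "b * (2 * K) * (2 ^ fst Q0) ^ d \<le> w N * ((2 ^ fst Q0) ^ d * (2 ^ (N - fst Q0)) ^ d)"
      using N(2) unfolding d(1)[symmetric] wf by (simp add: power_divide)
    then have "(b * (2 * K)) * (2 ^ fst Q0) ^ d \<le> (w N * (2 ^ (N - fst Q0)) ^ d) * (2 ^ fst Q0) ^ d" by (simp add: mult_ac)
    then have "b * (2 * K) \<le> w N * (2 ^ (N - fst Q0)) ^ d" by (rule mult_right_le_imp_le) simp
    then have "b \<le> M N" using K by (simp add: M_def pos_le_divide_eq mult_ac)
    then have "B \<le> ennreal (M N)" unfolding B by (rule ennreal_leI)
    also have "\<dots> \<le> hausdorff_premeasure f (1 / 2 ^ N) (W0 \<psi> :: (real ^ 'n ^ 'm) set)" by (rule key[OF N(1)])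
    also have "\<dots> \<le> hausdorff_measure f (W0 \<psi> :: (real ^ 'n ^ 'm) set)"
      unfolding hausdorff_measure_eq_SUP by (intro SUP_upper) simp
    finally show ?thesis .
  qed
  then have large: "ennreal (real n) \<le> hausdorff_measure f (W0 \<psi> :: (real ^ 'n ^ 'm) set)" for n :: nat by simp
  have "hausdorff_measure f (W0 \<psi> :: (real ^ 'n ^ 'm) set) = top"
  proof (rule ccontr)
    assume "hausdorff_measure f (W0 \<psi> :: (real ^ 'n ^ 'm) set) \<noteq> top"
    then have "hausdorff_measure f (W0 \<psi> :: (real ^ 'n ^ 'm) set) < top" by (simp add: less_top)
    then obtain n :: nat where "hausdorff_measure f (W0 \<psi> :: (real ^ 'n ^ 'm) set) < of_nat n"
      using ennreal_Ex_less_of_nat by blast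
    then show False using large[of n] by (simp add: ennreal_of_nat_eq_real_of_nat not_less[symmetric])
  qed
  then show ?thesis by (simp add: infinity_ennreal_def)
qed

section \<open>The three cases together\<close>

text \<open>The parameter \<open>v\<close> has one entry less than there are rows, which requires a type with
  one element less than \<open>'m\<close>. Types are nonempty, so a type with a single element is left
  unchanged.\<close>

typedef 'm punctured = "{x :: 'm. x \<noteq> (SOME y. True) \<or> CARD('m) = 1}"
proof (cases "CARD('m) = 1")
  case False
  have "\<exists>x :: 'm. x \<noteq> (SOME y. True)"
  proof (rule ccontr)
    assume "\<nexists>x :: 'm. x \<noteq> (SOME y. True)"
    then have "(UNIV :: 'm set) = {SOME y. True}" by blast
    then have "CARD('m) = card {SOME y :: 'm. True}" by (rule arg_cong)
    then show False using False by simp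
  qed
  then show ?thesis by blast
qed simp

instance punctured :: (finite) finite
proof
  have "finite (range (Rep_punctured :: 'a punctured \<Rightarrow> 'a))" by simp
  then show "finite (UNIV :: 'a punctured set)"
    by (rule finite_imageD) (simp add: inj_on_def Rep_punctured_inject)
qed

lemma CARD_punctured:
  assumes "2 \<le> CARD('m::finite)"
  shows "CARD('m punctured) = CARD('m) - 1"
proof -
  have "CARD('m punctured) = card {x :: 'm. x \<noteq> (SOME y. True) \<or> CARD('m) = 1}"
    by (rule type_definition.card[OF type_definition_punctured])
  also have "{x :: 'm. x \<noteq> (SOME y. True) \<or> CARD('m) = 1} = UNIV - {SOME y. True}" using assms by auto
  finally show ?thesis by (simp add: card_Diff_singleton)
qed

lemma exists_pointed_bijections:
  assumes "CARD('m::finite) = Suc CARD('k::finite)"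
  shows "\<exists>\<tau> :: 'm \<Rightarrow> 'm \<Rightarrow> 'k option. \<forall>j. bij (\<tau> j) \<and> \<tau> j j = None"
proof -
  have "CARD('m) = CARD('k option)" using assms by simp
  then obtain g :: "'m \<Rightarrow> 'k option" where g: "bij g"
    using finite_same_card_bij[of "UNIV :: 'm set" "UNIV :: 'k option set"] by auto
  obtain i0 where i0: "g i0 = None" using bij_pointE[OF g] by metis
  have "bij (g \<circ> Transposition.transpose j i0) \<and> (g \<circ> Transposition.transpose j i0) j = None" for j
    using g i0 by (simp add: bij_comp)
  then show ?thesis by (intro exI[of _ "\<lambda>j. g \<circ> Transposition.transpose j i0"]) blast
qed

theorem theorem2:
  fixes \<psi> \<Psi> f g :: "real \<Rightarrow> real" and m n :: nat
  assumes m: "m = CARD('m::finite)" and n: "n = CARD('n::finite)"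
    and "2 \<le> m" and "m \<le> n"
    and "approximating_function \<psi>"
    and \<Psi>: "\<And>r. r > 0 \<Longrightarrow> \<Psi> r = \<psi> r / r"
    and "dimension_function f" and "dimension_function g"
    and g: "\<And>r. r > 0 \<Longrightarrow> g r = f r / r ^ ((n - m + 1) * (m - 1))"
    and "mono_on {0<..} (\<lambda>r. f r / r ^ ((m - 1) * (n + 1))) \<or>
         antimono_on {0<..} (\<lambda>r. f r / r ^ ((m - 1) * (n + 1)))"
    and "mono_on {0<..} (\<lambda>r. f r / r ^ ((m - 1) * n))"
  shows
    "(summable (\<lambda>k. f (\<Psi> (real (Suc k))) / \<Psi> (real (Suc k)) ^ ((m - 1) * n) * real (Suc k) ^ (m - 1)) \<longrightarrow>
        hausdorff_measure f (W0 \<psi> :: (real ^ 'n ^ 'm) set) = 0) \<and>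
     (\<not> summable (\<lambda>k. f (\<Psi> (real (Suc k))) / \<Psi> (real (Suc k)) ^ ((m - 1) * n) * real (Suc k) ^ (m - 1)) \<longrightarrow>
        (filterlim (\<lambda>r. f r / r ^ ((m - 1) * (n + 1))) at_top (at_right 0) \<longrightarrow>
           hausdorff_measure f (W0 \<psi> :: (real ^ 'n ^ 'm) set) = \<infinity>) \<and>
        (\<forall>C>0. ((\<lambda>r. f r / r ^ ((m - 1) * (n + 1))) \<longlongrightarrow> C) (at_right 0) \<longrightarrow>
           hausdorff_measure f (W0 \<psi> :: (real ^ 'n ^ 'm) set) =
           hausdorff_measure f (low_rank :: (real ^ 'n ^ 'm) set)))"
proof -
  note \<psi> = \<open>approximating_function \<psi>\<close>
  have fpos: "0 < f r" if "0 < r" for r using \<open>dimension_function f\<close> that by (simp add: dimension_function_def)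
  have fmono: "mono_on {0<..} f" using \<open>dimension_function f\<close> by (simp add: dimension_function_def)
  have \<psi>pos: "0 < \<psi> r" if "0 < r" for r using \<psi> that by (simp add: approximating_function_def)
  define k where "k = CARD('m punctured)"
  have k: "k = m - 1" using CARD_punctured[where 'm = 'm] \<open>2 \<le> m\<close> m by (simp add: k_def)
  then have "CARD('m) = Suc CARD('m punctured)" using \<open>2 \<le> m\<close> m by (simp add: k_def)
  then obtain \<tau> :: "'m \<Rightarrow> 'm \<Rightarrow> 'm punctured option" where \<tau>: "\<And>j. bij (\<tau> j)" "\<And>j. \<tau> j j = None"
    using exists_pointed_bijections by blast
  have "k \<le> CARD('n)" using k \<open>m \<le> n\<close> n by simp
  then obtain \<iota> :: "'m punctured \<Rightarrow> 'n" where \<iota>: "inj \<iota>"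
    using card_le_inj[of "UNIV :: 'm punctured set" "UNIV :: 'n set"] by (auto simp: k_def)
  let ?t = "\<lambda>j. f (\<Psi> (real (Suc j))) / \<Psi> (real (Suc j)) ^ ((m - 1) * n) * real (Suc j) ^ (m - 1)"
  have convergent: "hausdorff_measure f (W0 \<psi> :: (real ^ 'n ^ 'm) set) = 0" if "summable ?t"
    using that unfolding m n by (intro hausdorff_measure_W0_eq_0[OF \<psi> \<Psi> fpos])
  have divergent: "hausdorff_measure f (W0 \<psi> :: (real ^ 'n ^ 'm) set) = \<infinity>"
    if div: "\<not> summable ?t" and lim: "filterlim (\<lambda>r. f r / r ^ ((m - 1) * (n + 1))) at_top (at_right 0)"
  proof -
    let ?F = "\<lambda>r. f r / r ^ ((m - 1) * (n + 1))"
    have "\<not> mono_on {0<..} ?F"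
    proof
      assume mono: "mono_on {0<..} ?F"
      have "\<forall>\<^sub>F r in at_right 0. ?F 1 < ?F r" using lim unfolding filterlim_at_top_dense by blast
      moreover have "\<forall>\<^sub>F r in at_right (0::real). 0 < r \<and> r < 1" by (simp add: eventually_at_right_field) (rule exI[of _ 1], simp)
      ultimately have "\<forall>\<^sub>F r in at_right (0::real). False"
      proof eventually_elim
        case (elim r)
        have "?F r \<le> ?F 1" using elim by (intro mono_onD[OF mono]) auto
        with elim show False by simp
      qed
      then show False by (simp add: trivial_limit_at_right_real)
    qed
    then have "antimono_on {0<..} ?F" using assms(10) by blast
    moreover have "\<not> summable (\<lambda>j. let r = real (Suc j) in f (\<psi> r / r) / (\<psi> r / r) ^ (k * CARD('n)) * r ^ k)"
      using div by (simp add: Let_def \<Psi> k n)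
    ultimately show ?thesis
      using lim \<open>mono_on {0<..} (\<lambda>r. f r / r ^ ((m - 1) * n))\<close> unfolding k[symmetric] n k_def
      by (intro hausdorff_measure_W0_eq_infinity[OF \<psi> fpos fmono \<tau>(1) \<iota>])
  qed
  have critical: "hausdorff_measure f (W0 \<psi> :: (real ^ 'n ^ 'm) set) = hausdorff_measure f (low_rank :: (real ^ 'n ^ 'm) set)"
    if div: "\<not> summable ?t" and C: "0 < C" and lim: "((\<lambda>r. f r / r ^ ((m - 1) * (n + 1))) \<longlongrightarrow> C) (at_right 0)" for C
  proof -
    have "\<not> summable (\<lambda>j. \<psi> (real (Suc j)) ^ k)"
    proof
      assume s: "summable (\<lambda>j. \<psi> (real (Suc j)) ^ k)"
      have \<psi>0: "(\<lambda>j. \<psi> (real (Suc j))) \<longlonglongrightarrow> 0"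
        using \<psi> filterlim_compose[OF _ filterlim_compose[OF filterlim_real_sequentially filterlim_Suc]]
        by (auto simp: approximating_function_def)
      have "(\<lambda>j. \<psi> (real (Suc j)) * (1 / real (Suc j))) \<longlonglongrightarrow> 0 * 0"
        using \<psi>0 LIMSEQ_Suc[OF lim_1_over_n] by (rule tendsto_mult)
      then have "filterlim (\<lambda>j. \<Psi> (real (Suc j))) (at_right 0) sequentially"
        by (intro tendsto_imp_filterlim_at_right always_eventually allI) (simp_all add: \<Psi> \<psi>pos)
      then have "(\<lambda>j. f (\<Psi> (real (Suc j))) / \<Psi> (real (Suc j)) ^ ((m - 1) * (n + 1))) \<longlonglongrightarrow> C"
        by (rule filterlim_compose[OF lim])
      then have "\<forall>\<^sub>F j in sequentially. f (\<Psi> (real (Suc j))) / \<Psi> (real (Suc j)) ^ ((m - 1) * (n + 1)) < 2 * C"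
        using C by (intro order_tendstoD(2)) auto
      then have "\<forall>\<^sub>F j in sequentially. norm (?t j) \<le> 2 * C * \<psi> (real (Suc j)) ^ k"
      proof eventually_elim
        case (elim j)
        define r where "r = real (Suc j)"
        have r: "0 < r" by (simp add: r_def)
        have \<Psi>r: "0 < \<Psi> r" "\<Psi> r * r = \<psi> r" using \<psi>pos[OF r] r by (simp_all add: \<Psi>)
        have "?t j = f (\<Psi> r) / \<Psi> r ^ ((m - 1) * (n + 1)) * (\<Psi> r * r) ^ (m - 1)"
          using \<Psi>r(1) by (simp add: r_def[symmetric] power_add power_mult_distrib del: of_nat_Suc)
        also have "\<dots> \<le> 2 * C * (\<Psi> r * r) ^ (m - 1)"
        proof (rule mult_right_mono)
          show "f (\<Psi> r) / \<Psi> r ^ ((m - 1) * (n + 1)) \<le> 2 * C" using elim unfolding r_def by (rule less_imp_le)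
          show "0 \<le> (\<Psi> r * r) ^ (m - 1)" using \<Psi>r(1) r by (intro zero_le_power mult_nonneg_nonneg) auto
        qed
        finally have "?t j \<le> 2 * C * \<psi> (real (Suc j)) ^ k" unfolding \<Psi>r(2) unfolding r_def k .
        moreover have "0 \<le> ?t j" using fpos[OF \<Psi>r(1)] \<Psi>r(1) r by (simp add: r_def[symmetric] del: of_nat_Suc)
        ultimately show ?case by simp
      qed
      then have "summable ?t" by (rule summable_comparison_test_ev) (intro summable_mult s)
      then show False using div by simp
    qed
    then show ?thesis
      using lim unfolding k[symmetric] n k_def
      by (intro hausdorff_measure_W0_eq_low_rank[OF \<psi> fpos \<tau> C])
  qed
  show ?thesis by (intro conjI impI allI convergent divergent critical)
qed

end
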